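(* Let $C$ be the non-complete intersection Gorenstein monomial curve $x_i=t^{n_i}$ ($1\le i\le4$) in $\mathbb{A}^4(K)$, with $n_1<n_2<n_3<n_4$. Suppose that $I(C)$ is given as in case 3(b), i.e. $I(C)$ is minimally generated by $$f_1=x_1^{a_1}-x_2^{a_{12}}x_4^{a_{14}},\quad f_2=x_2^{a_2}-x_3^{a_{23}}x_4^{a_{24}},\quad f_3=x_3^{a_3}-x_1^{a_{31}}x_2^{a_{32}},$$ $$f_4=x_4^{a_4}-x_1^{a_{41}}x_3^{a_{43}},\quad f_5=x_1^{a_{31}}x_4^{a_{24}}-x_2^{a_{12}}x_3^{a_{43}},$$ and $a_{43}\le a_{23}$. Then $C$ has Cohen-Macaulay tangent cone at the origin if and only if (1) $a_{12}+a_{43}\le a_{31}+a_{24}$, and (2) either $a_{24}<a_{14}$ and $a_2+a_{12}\le a_{31}+2a_{24}+a_{23}-a_{43}$, or $a_{14}\le a_{24}$ and $a_2+a_{12}\le a_1+a_{23}+a_{24}-a_{14}$.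
   Context: $K$ is a field and $n_1,\dots,n_4$ are positive integers with $\gcd(n_1,\dots,n_4)=1$. $I(C)$ is the kernel of the $K$-algebra homomorphism $K[x_1,\dots,x_4]\to K[t]$, $x_i\mapsto t^{n_i}$. $C$ is Gorenstein if the semigroup $\mathcal{S}=\{g_1n_1+\cdots+g_4n_4: g_i\in\mathbb{N}\}$ is symmetric ($\mathbb{N}$ = non-negative integers). In the description of $I(C)$, all exponents are integers with $0<a_{ij}<a_j$, and (by Bresinsky) $a_1=a_{31}+a_{41}$, $a_2=a_{12}+a_{32}$, $a_3=a_{23}+a_{43}$, $a_4=a_{14}+a_{24}$. $C$ has Cohen-Macaulay tangent cone at the origin if the ring $K[x_1,\dots,x_4]/I(C)_*$ is Cohen-Macaulay, where $I(C)_*$ is generated by the homogeneous (standard grading) summands $f_*$ of least degree of the polynomials $f\in I(C)$. *)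

theory Defs
  imports
    "HOL-Library.Poly_Mapping"
    "HOL-Library.Numeral_Type"
    "HOL-Library.Extended_Nat"
    "HOL-Computational_Algebra.Polynomial"
    "HOL-Algebra.Ring_Divisibility"
    "HOL-Algebra.Algebraic_Closure_Type"
begin

definition krull_dim :: "('a, 'b) ring_scheme \<Rightarrow> enat" where
  "krull_dim R = (SUP m \<in> {m. \<exists>p :: nat \<Rightarrow> 'a set.
      (\<forall>i\<le>m. primeideal (p i) R) \<and> (\<forall>i<m. p i \<subset> p (Suc i))}. enat m)"

text \<open>Each \<open>xs ! i\<close> is a nonzerodivisor on \<open>R / (xs ! 0, \<dots>, xs ! (i - 1))\<close>, and
  \<open>R / (xs)\<close> is nonzero.\<close>

definition regular_sequence :: "('a, 'b) ring_scheme \<Rightarrow> 'a list \<Rightarrow> bool" where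
  "regular_sequence R xs \<longleftrightarrow> set xs \<subseteq> carrier R \<and>
     (\<forall>i<length xs. \<forall>r\<in>carrier R.
        (xs ! i) \<otimes>\<^bsub>R\<^esub> r \<in> Idl\<^bsub>R\<^esub> (set (take i xs)) \<longrightarrow> r \<in> Idl\<^bsub>R\<^esub> (set (take i xs))) \<and>
     Idl\<^bsub>R\<^esub> (set xs) \<noteq> carrier R"

definition depth :: "'a set \<Rightarrow> ('a, 'b) ring_scheme \<Rightarrow> enat" where
  "depth I R = (SUP xs \<in> {xs. regular_sequence R xs \<and> set xs \<subseteq> I}. enat (length xs))"

definition local_ring :: "'a set \<Rightarrow> ('a, 'b) ring_scheme \<Rightarrow> bool" where
  "local_ring M R \<longleftrightarrow> cring R \<and> (\<forall>N. maximalideal N R \<longleftrightarrow> N = M)"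

definition local_cohen_macaulay :: "('a, 'b) ring_scheme \<Rightarrow> bool" where
  "local_cohen_macaulay R \<longleftrightarrow> noetherian_ring R \<and>
     (\<exists>M. local_ring M R \<and> depth M R = krull_dim R)"

definition fraction_rel ::
    "('a, 'b) ring_scheme \<Rightarrow> 'a set \<Rightarrow> (('a \<times> 'a) \<times> ('a \<times> 'a)) set" where
  "fraction_rel R S = {((a, s), (b, t)). a \<in> carrier R \<and> b \<in> carrier R \<and> s \<in> S \<and> t \<in> S \<and>
     (\<exists>u\<in>S. u \<otimes>\<^bsub>R\<^esub> (a \<otimes>\<^bsub>R\<^esub> t \<ominus>\<^bsub>R\<^esub> b \<otimes>\<^bsub>R\<^esub> s) = \<zero>\<^bsub>R\<^esub>)}"

definition fraction :: "('a, 'b) ring_scheme \<Rightarrow> 'a set \<Rightarrow> 'a \<Rightarrow> 'a \<Rightarrow> ('a \<times> 'a) set" where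
  "fraction R S a s = fraction_rel R S `` {(a, s)}"

text \<open>The ring \<open>S\<^sup>-\<^sup>1 R\<close>, for a multiplicatively closed set \<open>S\<close> containing one. The operations are
  taken over all representatives of the classes \<open>A\<close> and \<open>B\<close>; as these all produce the same class,
  the unions are unions of equal sets.\<close>

definition localization :: "('a, 'b) ring_scheme \<Rightarrow> 'a set \<Rightarrow> ('a \<times> 'a) set ring" where
  "localization R S = \<lparr>
     carrier = (carrier R \<times> S) // fraction_rel R S,
     monoid.mult = (\<lambda>A B. \<Union>(a, s)\<in>A. \<Union>(b, t)\<in>B. fraction R S (a \<otimes>\<^bsub>R\<^esub> b) (s \<otimes>\<^bsub>R\<^esub> t)),
     one = fraction R S \<one>\<^bsub>R\<^esub> \<one>\<^bsub>R\<^esub>,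
     zero = fraction R S \<zero>\<^bsub>R\<^esub> \<one>\<^bsub>R\<^esub>,
     add = (\<lambda>A B. \<Union>(a, s)\<in>A. \<Union>(b, t)\<in>B.
              fraction R S (a \<otimes>\<^bsub>R\<^esub> t \<oplus>\<^bsub>R\<^esub> b \<otimes>\<^bsub>R\<^esub> s) (s \<otimes>\<^bsub>R\<^esub> t)) \<rparr>"

definition cohen_macaulay :: "('a, 'b) ring_scheme \<Rightarrow> bool" where
  "cohen_macaulay R \<longleftrightarrow> cring R \<and> noetherian_ring R \<and>
     (\<forall>M. maximalideal M R \<longrightarrow> local_cohen_macaulay (localization R (carrier R - M)))"

text \<open>The variables are indexed by the four-element type \<open>4\<close>, whose elements are \<open>1\<close>, \<open>2\<close>, \<open>3\<close>
  and \<open>4\<close> (the last one being equal to \<open>0\<close>, as arithmetic in this type is modulo four). Monomials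
  are exponent vectors \<open>4 \<Rightarrow>\<^sub>0 nat\<close>, and the multiplication of \<open>\<Rightarrow>\<^sub>0\<close> is convolution.\<close>

type_synonym 'k poly4 = "(4 \<Rightarrow>\<^sub>0 nat) \<Rightarrow>\<^sub>0 'k"

definition Var :: "4 \<Rightarrow> 'k::field poly4" where
  "Var i = Poly_Mapping.single (Poly_Mapping.single i 1) 1"

abbreviation poly4_ring :: "'k::field poly4 ring" where
  "poly4_ring \<equiv> ring_of_type_algebra"

definition mono_degree :: "(4 \<Rightarrow>\<^sub>0 nat) \<Rightarrow> nat" where
  "mono_degree m = (\<Sum>i\<in>UNIV. Poly_Mapping.lookup m i)"

definition least_form :: "'k::field poly4 \<Rightarrow> 'k poly4" where
  "least_form f = (\<Sum>m \<in> {m \<in> Poly_Mapping.keys f. mono_degree m = Min (mono_degree ` Poly_Mapping.keys f)}.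
     Poly_Mapping.single m (Poly_Mapping.lookup f m))"

definition minimally_generates :: "('a, 'b) ring_scheme \<Rightarrow> 'a set \<Rightarrow> 'a set \<Rightarrow> bool" where
  "minimally_generates R G I \<longleftrightarrow> G \<subseteq> carrier R \<and> Idl\<^bsub>R\<^esub> G = I \<and> (\<forall>H. H \<subset> G \<longrightarrow> Idl\<^bsub>R\<^esub> H \<noteq> I)"

text \<open>The curve \<open>x\<^sub>i = t^(n i)\<close> is given by its exponents \<open>n\<close>; the field is carried by the type of the
  polynomials.\<close>

definition curve_hom :: "(4 \<Rightarrow> nat) \<Rightarrow> 'k::field poly4 \<Rightarrow> 'k poly" where
  "curve_hom n f = (\<Sum>m\<in>Poly_Mapping.keys f. smult (Poly_Mapping.lookup f m) (\<Prod>i\<in>UNIV. (Polynomial.monom 1 (n i)) ^ Poly_Mapping.lookup m i))"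

definition curve_ideal :: "(4 \<Rightarrow> nat) \<Rightarrow> 'k::field poly4 set" where
  "curve_ideal n = {f. curve_hom n f = 0}"

definition semigroup_of :: "(4 \<Rightarrow> nat) \<Rightarrow> nat set" where
  "semigroup_of n = {\<Sum>i\<in>UNIV. g i * n i | g. True}"

text \<open>The largest integer outside the semigroup (it is \<open>-1\<close> if the semigroup is all of \<open>nat\<close>);
  it exists when the semigroup has finite complement in \<open>nat\<close>.\<close>

definition frobenius_number :: "nat set \<Rightarrow> int" where
  "frobenius_number S = (GREATEST z. z \<notin> int ` S)"

definition symmetric_semigroup :: "nat set \<Rightarrow> bool" where
  "symmetric_semigroup S \<longleftrightarrow> (\<forall>z. z \<in> int ` S \<longleftrightarrow> frobenius_number S - z \<notin> int ` S)"

definition gorenstein_curve :: "(4 \<Rightarrow> nat) \<Rightarrow> bool" where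
  "gorenstein_curve n \<longleftrightarrow> symmetric_semigroup (semigroup_of n)"

text \<open>A curve in four-space has codimension three, so it is a complete intersection if its ideal is
  generated by three elements. The itself-argument supplies the field.\<close>

definition complete_intersection_curve :: "'k::field itself \<Rightarrow> (4 \<Rightarrow> nat) \<Rightarrow> bool" where
  "complete_intersection_curve _ n \<longleftrightarrow>
     (\<exists>A. finite A \<and> card A = 3 \<and> Idl\<^bsub>poly4_ring\<^esub> A = (curve_ideal n :: 'k poly4 set))"

definition tangent_cone_ideal :: "(4 \<Rightarrow> nat) \<Rightarrow> 'k::field poly4 set" where
  "tangent_cone_ideal n = Idl\<^bsub>poly4_ring\<^esub> (least_form ` (curve_ideal n - {0}))"

definition cohen_macaulay_tangent_cone :: "'k::field itself \<Rightarrow> (4 \<Rightarrow> nat) \<Rightarrow> bool" where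
  "cohen_macaulay_tangent_cone _ n \<longleftrightarrow>
     cohen_macaulay (poly4_ring Quot (tangent_cone_ideal n :: 'k poly4 set))"

end

theory Submission
  imports Defs
begin

text \<open>
  Let \<open>A\<close> be the ring of the tangent cone, the quotient of \<open>K[x\<^sub>1, \<dots>, x\<^sub>4]\<close> by the ideal of least forms. Give
  \<open>x\<^sub>i\<close> the weight \<open>n i\<close>. A binomial whose two monomials have the same weight lies in the curve ideal, so
  a monomial is a least form as soon as some monomial of the same weight has larger degree, and two monomials
  of the same weight and the same degree agree in \<open>A\<close>. Hence \<open>A\<close> has a basis indexed by the weights: the common
  class of the monomials that have the largest degree among all monomials of that weight (\<open>maxdeg\<close>). In
  other words, the ideal of the tangent cone is the kernel of an explicit linear map to \<open>K[t]\<close>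
  (\<open>tangent_cone_ideal_eq_kernel\<close>), and multiplication by \<open>x\<^sub>1\<close> is injective on \<open>A\<close> exactly if it
  maps \<open>maxdeg\<close> monomials to \<open>maxdeg\<close> monomials.

  As \<open>n 1\<close> is the smallest weight, the power \<open>x\<^sub>i ^ n 1\<close> with \<open>i \<noteq> 1\<close> has the same weight as \<open>x\<^sub>1 ^ n i\<close>,
  which has larger degree, and vanishes in \<open>A\<close>. So \<open>A\<close> is a finite module over \<open>K[x\<^sub>1]\<close>, its
  nilradical is \<open>(x\<^sub>2, x\<^sub>3, x\<^sub>4)\<close> with quotient \<open>K[x\<^sub>1]\<close>, and \<open>A\<close> is Noetherian of dimension one. If \<open>x\<^sub>1\<close> is a
  nonzerodivisor then so is every nonzero polynomial in \<open>x\<^sub>1\<close>; every maximal ideal contains such a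
  polynomial, and all local rings have depth one (\<open>cohen_macaulay_dim_one\<close>). If \<open>x\<^sub>1\<close> is a zerodivisor, then
  some nonzero monomial is killed by all four variables, and the local ring at the origin has depth zero
  but positive dimension (\<open>not_cohen_macaulay_if_socle\<close>). The result is \<open>cohen_macaulay_tangent_cone_iff\<close>:
  the tangent cone is Cohen-Macaulay if and only if, for every weight that is attained by a multiple of
  \<open>x\<^sub>1\<close>, the largest degree for this weight is attained by a multiple of \<open>x\<^sub>1\<close>.

  What is left is a question about exponent vectors. Since the five binomials generate the curve ideal, two monomials
  have the same weight if and only if they are connected by moves that replace one monomial of a generator
  by the other one. Consider a monomial without \<open>x\<^sub>1\<close> that has largest degree in its weight. The
  moves given by \<open>f1\<close>, \<open>f3\<close> and \<open>f4\<close> that create a factor \<open>x\<^sub>1\<close> raise the degree, because \<open>n\<close> is increasing; the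
  one given by \<open>f5\<close> does not lower it if (1) holds. A move by \<open>f2\<close> creates no \<open>x\<^sub>1\<close> and
  can only go from \<open>x\<^sub>2 ^ a2\<close> to \<open>x\<^sub>3 ^ a23 * x\<^sub>4 ^ a24\<close>; a second move, by \<open>f5\<close> or \<open>f1\<close>, is then possible only if
  the monomial is a multiple of \<open>x\<^sub>2 ^ (a2 + a12)\<close>, and (2) says that the better of these two second moves does not lower
  the degree in total (\<open>filled_by_x1I\<close>). Conversely, all monomials with the weight of \<open>x\<^sub>2 ^ a12 * x\<^sub>3 ^ a43\<close> and
  with the weight of \<open>x\<^sub>2 ^ (a2 + a12)\<close> can be listed, and comparing degrees gives (1) and (2)
  (\<open>filled_by_x1_cond1\<close>, \<open>filled_by_x1_cond2\<close>).
\<close>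

section \<open>Localization of a commutative ring\<close>

locale cring_localization = cring R for R (structure) +
  fixes S :: "'a set"
  assumes S_carrier: "S \<subseteq> carrier R"
    and one_mem_S: "\<one> \<in> S"
    and mult_mem_S: "\<lbrakk>s \<in> S; t \<in> S\<rbrakk> \<Longrightarrow> s \<otimes> t \<in> S"
begin

abbreviation frac where "frac \<equiv> fraction R S"
abbreviation Loc where "Loc \<equiv> localization R S"

lemma S_closed [simp]: "s \<in> S \<Longrightarrow> s \<in> carrier R"
  using S_carrier by blast

declare one_mem_S [simp] mult_mem_S [simp]

text \<open>A form of the relation without subtraction, so that the proofs below only rearrange products.\<close>

lemma mem_fraction_rel:
  "((a, s), (b, t)) \<in> fraction_rel R S \<longleftrightarrow>
     a \<in> carrier R \<and> b \<in> carrier R \<and> s \<in> S \<and> t \<in> S \<and> (\<exists>u\<in>S. u \<otimes> (a \<otimes> t) = u \<otimes> (b \<otimes> s))"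
proof -
  have "(u \<otimes> (a \<otimes> t \<ominus> b \<otimes> s) = \<zero>) = (u \<otimes> (a \<otimes> t) = u \<otimes> (b \<otimes> s))"
    if "a \<in> carrier R" "b \<in> carrier R" "s \<in> S" "t \<in> S" "u \<in> S" for u
  proof -
    have "u \<otimes> (a \<otimes> t \<ominus> b \<otimes> s) = u \<otimes> (a \<otimes> t) \<ominus> u \<otimes> (b \<otimes> s)"
      using that by (simp add: r_distr a_minus_def r_minus)
    then show ?thesis using that by simp
  qed
  then show ?thesis
    unfolding fraction_rel_def by auto
qed

lemma equiv_fraction_rel: "equiv (carrier R \<times> S) (fraction_rel R S)"
proof (rule equivI)
  show "fraction_rel R S \<subseteq> (carrier R \<times> S) \<times> (carrier R \<times> S)"
    unfolding fraction_rel_def by auto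
  show "refl_on (carrier R \<times> S) (fraction_rel R S)"
    by (auto simp: refl_on_def mem_fraction_rel)
  show "sym (fraction_rel R S)"
    unfolding sym_def by (auto simp: mem_fraction_rel) metis
  show "trans (fraction_rel R S)"
  proof (rule transI, clarify)
    fix a s b t c v
    assume 1: "((a, s), (b, t)) \<in> fraction_rel R S" and 2: "((b, t), (c, v)) \<in> fraction_rel R S"
    from 1 obtain x where x: "x \<in> S" "x \<otimes> (a \<otimes> t) = x \<otimes> (b \<otimes> s)"
      unfolding mem_fraction_rel by blast
    from 2 obtain y where y: "y \<in> S" "y \<otimes> (b \<otimes> v) = y \<otimes> (c \<otimes> t)"
      unfolding mem_fraction_rel by blast
    have c: "a \<in> carrier R" "b \<in> carrier R" "c \<in> carrier R" "s \<in> S" "t \<in> S" "v \<in> S"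
      using 1 2 unfolding mem_fraction_rel by blast+
    have "(x \<otimes> y \<otimes> t) \<otimes> (a \<otimes> v) = (y \<otimes> v) \<otimes> (x \<otimes> (a \<otimes> t))" using c x(1) y(1) by (simp add: m_ac)
    also have "\<dots> = (x \<otimes> s) \<otimes> (y \<otimes> (b \<otimes> v))" unfolding x(2) using c x(1) y(1) by (simp add: m_ac)
    also have "\<dots> = (x \<otimes> y \<otimes> t) \<otimes> (c \<otimes> s)" unfolding y(2) using c x(1) y(1) by (simp add: m_ac)
    finally show "((a, s), (c, v)) \<in> fraction_rel R S"
      unfolding mem_fraction_rel using c mult_mem_S[OF mult_mem_S[OF x(1) y(1)] c(5)] by blast
  qed
qed

lemma frac_eq_iff:
  assumes "a \<in> carrier R" "b \<in> carrier R" "s \<in> S" "t \<in> S"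
  shows "frac a s = frac b t \<longleftrightarrow> (\<exists>u\<in>S. u \<otimes> (a \<otimes> t) = u \<otimes> (b \<otimes> s))"
proof -
  have "frac a s = frac b t \<longleftrightarrow> ((a, s), (b, t)) \<in> fraction_rel R S"
    unfolding fraction_def using eq_equiv_class_iff[OF equiv_fraction_rel] assms by blast
  then show ?thesis unfolding mem_fraction_rel using assms by blast
qed

lemma frac_eqI:
  assumes "a \<in> carrier R" "b \<in> carrier R" "s \<in> S" "t \<in> S" "a \<otimes> t = b \<otimes> s"
  shows "frac a s = frac b t"
  unfolding frac_eq_iff[OF assms(1-4)] using assms(5) one_mem_S by (intro bexI[of _ \<one>]) simp_all

lemma frac_eqI':
  assumes "u \<otimes> (a \<otimes> t) = u \<otimes> (b \<otimes> s)" "u \<in> S" "a \<in> carrier R" "b \<in> carrier R" "s \<in> S" "t \<in> S"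
  shows "frac a s = frac b t"
  unfolding frac_eq_iff[OF assms(3-6)] using assms(1,2) by blast

lemma carrier_Loc: "carrier Loc = (\<lambda>(a, s). frac a s) ` (carrier R \<times> S)"
  unfolding localization_def fraction_def quotient_def by fastforce

lemma frac_carrier [simp]: "\<lbrakk>a \<in> carrier R; s \<in> S\<rbrakk> \<Longrightarrow> frac a s \<in> carrier Loc"
  by (auto simp: carrier_Loc)

lemma Loc_cases:
  assumes "x \<in> carrier Loc"
  obtains a s where "a \<in> carrier R" "s \<in> S" "x = frac a s"
  using assms by (auto simp: carrier_Loc)

lemma mem_frac:
  "(b, t) \<in> frac a s \<longleftrightarrow> ((a, s), (b, t)) \<in> fraction_rel R S"
  by (auto simp: fraction_def)

lemma mem_fracD:
  assumes "a \<in> carrier R" "s \<in> S" "(b, t) \<in> frac a s"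
  shows "b \<in> carrier R" "t \<in> S" "frac a s = frac b t"
proof -
  have *: "((a, s), (b, t)) \<in> fraction_rel R S" using assms(3) by (simp only: mem_frac)
  then show "b \<in> carrier R" "t \<in> S" unfolding mem_fraction_rel by blast+
  with * show "frac a s = frac b t"
    unfolding frac_eq_iff[OF assms(1) \<open>b \<in> carrier R\<close> assms(2) \<open>t \<in> S\<close>] mem_fraction_rel by blast
qed

lemma frac_self: "\<lbrakk>a \<in> carrier R; s \<in> S\<rbrakk> \<Longrightarrow> (a, s) \<in> frac a s"
  unfolding mem_frac mem_fraction_rel using one_mem_S by blast

text \<open>The operations of a localization are unions over all representatives. If the value does not depend on the
  representatives, the union collapses to the value at any one of them.\<close>

lemma UN_classes:
  assumes "a \<in> carrier R" "s \<in> S" "b \<in> carrier R" "t \<in> S"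
    and "\<And>a' s' b' t'. \<lbrakk>a' \<in> carrier R; s' \<in> S; b' \<in> carrier R; t' \<in> S; frac a s = frac a' s'; frac b t = frac b' t'\<rbrakk>
           \<Longrightarrow> F a' s' b' t' = F a s b t"
  shows "(\<Union>(a', s')\<in>frac a s. \<Union>(b', t')\<in>frac b t. F a' s' b' t') = F a s b t"
proof -
  have F: "F a' s' b' t' = F a s b t" if "(a', s') \<in> frac a s" "(b', t') \<in> frac b t" for a' s' b' t'
    using assms(5) mem_fracD[OF assms(1,2) that(1)] mem_fracD[OF assms(3,4) that(2)] by blast
  have "(\<Union>(b', t')\<in>frac b t. F a' s' b' t') = F a s b t" if "(a', s') \<in> frac a s" for a' s'
  proof (rule UN_constant_eq[OF frac_self[OF assms(3,4)]], rule ballI)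
    fix p assume "p \<in> frac b t"
    then show "(case p of (b', t') \<Rightarrow> F a' s' b' t') = F a s b t"
      using F[OF that, of "fst p" "snd p"] by (cases p) (simp only: split fst_conv snd_conv)
  qed
  note inner = this
  show ?thesis
  proof (rule UN_constant_eq[OF frac_self[OF assms(1,2)]], rule ballI)
    fix p assume "p \<in> frac a s"
    then show "(case p of (a', s') \<Rightarrow> \<Union>(b', t')\<in>frac b t. F a' s' b' t') = F a s b t"
      using inner[of "fst p" "snd p"] by (cases p) (simp only: split fst_conv snd_conv)
  qed
qed

lemma frac_mult:
  assumes "a \<in> carrier R" "s \<in> S" "b \<in> carrier R" "t \<in> S"
  shows "frac a s \<otimes>\<^bsub>Loc\<^esub> frac b t = frac (a \<otimes> b) (s \<otimes> t)"
proof -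
  have "frac (a' \<otimes> b') (s' \<otimes> t') = frac (a \<otimes> b) (s \<otimes> t)"
    if H: "a' \<in> carrier R" "s' \<in> S" "b' \<in> carrier R" "t' \<in> S" "frac a s = frac a' s'" "frac b t = frac b' t'"
    for a' s' b' t'
  proof -
    obtain x where x: "x \<in> S" "x \<otimes> (a \<otimes> s') = x \<otimes> (a' \<otimes> s)"
      using H frac_eq_iff[OF assms(1) H(1) assms(2) H(2)] by blast
    obtain y where y: "y \<in> S" "y \<otimes> (b \<otimes> t') = y \<otimes> (b' \<otimes> t)"
      using H frac_eq_iff[OF assms(3) H(3) assms(4) H(4)] by blast
    have "(x \<otimes> y) \<otimes> ((a' \<otimes> b') \<otimes> (s \<otimes> t)) = (x \<otimes> (a' \<otimes> s)) \<otimes> (y \<otimes> (b' \<otimes> t))"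
      using assms H x(1) y(1) by (simp add: m_ac)
    also have "\<dots> = (x \<otimes> (a \<otimes> s')) \<otimes> (y \<otimes> (b \<otimes> t'))" using x y by simp
    also have "\<dots> = (x \<otimes> y) \<otimes> ((a \<otimes> b) \<otimes> (s' \<otimes> t'))"
      using assms H x(1) y(1) by (simp add: m_ac)
    finally show ?thesis
      by (rule frac_eqI') (use assms H(1-4) x(1) y(1) in simp_all)
  qed
  note indep = this
  have "frac a s \<otimes>\<^bsub>Loc\<^esub> frac b t =
      (\<Union>(a', s')\<in>frac a s. \<Union>(b', t')\<in>frac b t. frac (a' \<otimes> b') (s' \<otimes> t'))"
    unfolding localization_def by (simp only: monoid.select_convs)
  also have "\<dots> = frac (a \<otimes> b) (s \<otimes> t)"
    by (rule UN_classes[OF assms, where F = "\<lambda>a s b t. frac (a \<otimes> b) (s \<otimes> t)"], rule indep)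
  finally show ?thesis .
qed

lemma frac_add:
  assumes "a \<in> carrier R" "s \<in> S" "b \<in> carrier R" "t \<in> S"
  shows "frac a s \<oplus>\<^bsub>Loc\<^esub> frac b t = frac (a \<otimes> t \<oplus> b \<otimes> s) (s \<otimes> t)"
proof -
  have "frac (a' \<otimes> t' \<oplus> b' \<otimes> s') (s' \<otimes> t') = frac (a \<otimes> t \<oplus> b \<otimes> s) (s \<otimes> t)"
    if H: "a' \<in> carrier R" "s' \<in> S" "b' \<in> carrier R" "t' \<in> S" "frac a s = frac a' s'" "frac b t = frac b' t'"
    for a' s' b' t'
  proof -
    obtain x where x: "x \<in> S" "x \<otimes> (a \<otimes> s') = x \<otimes> (a' \<otimes> s)"
      using H frac_eq_iff[OF assms(1) H(1) assms(2) H(2)] by blast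
    obtain y where y: "y \<in> S" "y \<otimes> (b \<otimes> t') = y \<otimes> (b' \<otimes> t)"
      using H frac_eq_iff[OF assms(3) H(3) assms(4) H(4)] by blast
    have "(x \<otimes> y) \<otimes> ((a' \<otimes> t' \<oplus> b' \<otimes> s') \<otimes> (s \<otimes> t)) =
        (y \<otimes> t \<otimes> t') \<otimes> (x \<otimes> (a' \<otimes> s)) \<oplus> (x \<otimes> s \<otimes> s') \<otimes> (y \<otimes> (b' \<otimes> t))"
      using assms H x(1) y(1) by (simp add: m_ac l_distr r_distr)
    also have "\<dots> = (y \<otimes> t \<otimes> t') \<otimes> (x \<otimes> (a \<otimes> s')) \<oplus> (x \<otimes> s \<otimes> s') \<otimes> (y \<otimes> (b \<otimes> t'))"
      using x y by simp
    also have "\<dots> = (x \<otimes> y) \<otimes> ((a \<otimes> t \<oplus> b \<otimes> s) \<otimes> (s' \<otimes> t'))"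
      using assms H x(1) y(1) by (simp add: m_ac l_distr r_distr)
    finally show ?thesis
      by (rule frac_eqI') (use assms H(1-4) x(1) y(1) in simp_all)
  qed
  note indep = this
  have "frac a s \<oplus>\<^bsub>Loc\<^esub> frac b t =
      (\<Union>(a', s')\<in>frac a s. \<Union>(b', t')\<in>frac b t. frac (a' \<otimes> t' \<oplus> b' \<otimes> s') (s' \<otimes> t'))"
    unfolding localization_def by (simp only: ring.select_convs)
  also have "\<dots> = frac (a \<otimes> t \<oplus> b \<otimes> s) (s \<otimes> t)"
    by (rule UN_classes[OF assms, where F = "\<lambda>a s b t. frac (a \<otimes> t \<oplus> b \<otimes> s) (s \<otimes> t)"], rule indep)
  finally show ?thesis .
qed

lemma Loc_one: "\<one>\<^bsub>Loc\<^esub> = frac \<one> \<one>" and Loc_zero: "\<zero>\<^bsub>Loc\<^esub> = frac \<zero> \<one>"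
  by (simp_all add: localization_def)

lemma frac_eq_zero_iff:
  assumes "a \<in> carrier R" "s \<in> S"
  shows "frac a s = \<zero>\<^bsub>Loc\<^esub> \<longleftrightarrow> (\<exists>u\<in>S. u \<otimes> a = \<zero>)"
  unfolding Loc_zero frac_eq_iff[OF assms(1) zero_closed assms(2) one_mem_S] using assms by simp

lemma cring_Loc: "cring Loc"
proof (rule cringI)
  show "abelian_group Loc"
  proof (rule abelian_groupI)
    fix x y z assume xyz: "x \<in> carrier Loc" "y \<in> carrier Loc" "z \<in> carrier Loc"
    obtain a s where x: "a \<in> carrier R" "s \<in> S" "x = frac a s" by (rule Loc_cases[OF xyz(1)])
    obtain b t where y: "b \<in> carrier R" "t \<in> S" "y = frac b t" by (rule Loc_cases[OF xyz(2)])
    obtain c v where z: "c \<in> carrier R" "v \<in> S" "z = frac c v" by (rule Loc_cases[OF xyz(3)])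
    show "x \<oplus>\<^bsub>Loc\<^esub> y \<in> carrier Loc" using x y by (simp add: frac_add)
    show "x \<oplus>\<^bsub>Loc\<^esub> y \<oplus>\<^bsub>Loc\<^esub> z = x \<oplus>\<^bsub>Loc\<^esub> (y \<oplus>\<^bsub>Loc\<^esub> z)"
      using x y z by (simp add: frac_add) (rule frac_eqI; simp add: m_ac l_distr r_distr a_ac)
    show "x \<oplus>\<^bsub>Loc\<^esub> y = y \<oplus>\<^bsub>Loc\<^esub> x" using x y by (simp add: frac_add m_ac a_ac)
    show "\<zero>\<^bsub>Loc\<^esub> \<oplus>\<^bsub>Loc\<^esub> x = x" using x by (simp add: frac_add Loc_zero)
    show "\<exists>y\<in>carrier Loc. y \<oplus>\<^bsub>Loc\<^esub> x = \<zero>\<^bsub>Loc\<^esub>"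
    proof (rule bexI[of _ "frac (\<ominus> a) s"])
      have "\<ominus> a \<otimes> s \<oplus> a \<otimes> s = \<zero>" using x by (simp add: l_minus l_neg)
      then show "frac (\<ominus> a) s \<oplus>\<^bsub>Loc\<^esub> x = \<zero>\<^bsub>Loc\<^esub>"
        using x by (simp add: frac_add Loc_zero) (rule frac_eqI; simp)
    qed (use x in simp)
  qed (simp add: Loc_zero)
  show "Group.comm_monoid Loc"
  proof (rule comm_monoidI)
    fix x y z assume xyz: "x \<in> carrier Loc" "y \<in> carrier Loc" "z \<in> carrier Loc"
    obtain a s where x: "a \<in> carrier R" "s \<in> S" "x = frac a s" by (rule Loc_cases[OF xyz(1)])
    obtain b t where y: "b \<in> carrier R" "t \<in> S" "y = frac b t" by (rule Loc_cases[OF xyz(2)])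
    obtain c v where z: "c \<in> carrier R" "v \<in> S" "z = frac c v" by (rule Loc_cases[OF xyz(3)])
    show "x \<otimes>\<^bsub>Loc\<^esub> y \<in> carrier Loc" using x y by (simp add: frac_mult)
    show "x \<otimes>\<^bsub>Loc\<^esub> y \<otimes>\<^bsub>Loc\<^esub> z = x \<otimes>\<^bsub>Loc\<^esub> (y \<otimes>\<^bsub>Loc\<^esub> z)"
      using x y z by (simp add: frac_mult m_ac)
    show "x \<otimes>\<^bsub>Loc\<^esub> y = y \<otimes>\<^bsub>Loc\<^esub> x" using x y by (simp add: frac_mult m_ac)
    show "\<one>\<^bsub>Loc\<^esub> \<otimes>\<^bsub>Loc\<^esub> x = x" using x by (simp add: frac_mult Loc_one)
  qed (simp add: Loc_one)
  fix x y z assume xyz: "x \<in> carrier Loc" "y \<in> carrier Loc" "z \<in> carrier Loc"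
  obtain a s where x: "a \<in> carrier R" "s \<in> S" "x = frac a s" by (rule Loc_cases[OF xyz(1)])
  obtain b t where y: "b \<in> carrier R" "t \<in> S" "y = frac b t" by (rule Loc_cases[OF xyz(2)])
  obtain c v where z: "c \<in> carrier R" "v \<in> S" "z = frac c v" by (rule Loc_cases[OF xyz(3)])
  show "(x \<oplus>\<^bsub>Loc\<^esub> y) \<otimes>\<^bsub>Loc\<^esub> z = x \<otimes>\<^bsub>Loc\<^esub> z \<oplus>\<^bsub>Loc\<^esub> y \<otimes>\<^bsub>Loc\<^esub> z"
    using x y z by (simp add: frac_add frac_mult) (rule frac_eqI; simp add: m_ac l_distr r_distr)
qed

lemma frac_eq_mult: "\<lbrakk>a \<in> carrier R; s \<in> S\<rbrakk> \<Longrightarrow> frac a s = frac a \<one> \<otimes>\<^bsub>Loc\<^esub> frac \<one> s"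
  by (simp add: frac_mult)

lemma frac_numerator: "\<lbrakk>a \<in> carrier R; s \<in> S\<rbrakk> \<Longrightarrow> frac a \<one> = frac s \<one> \<otimes>\<^bsub>Loc\<^esub> frac a s"
  by (simp add: frac_mult) (rule frac_eqI; simp add: m_ac)

lemma frac_hom: "ring_hom_cring R Loc (\<lambda>a. frac a \<one>)"
proof -
  interpret L: cring Loc by (rule cring_Loc)
  show ?thesis
    by (rule ring_hom_cringI[OF cring_axioms cring_Loc], rule ring_hom_memI)
      (auto simp: frac_mult frac_add Loc_one)
qed

definition contraction :: "('a \<times> 'a) set set \<Rightarrow> 'a set" where
  "contraction Q = {a \<in> carrier R. frac a \<one> \<in> Q}"

definition extension :: "'a set \<Rightarrow> ('a \<times> 'a) set set" where
  "extension P = {frac a s | a s. a \<in> P \<and> s \<in> S}"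

text \<open>Numerators decide membership, as denominators become units. This is why ideals of the localization are
  determined by their contractions.\<close>

lemma frac_mem_iff:
  assumes "ideal Q Loc" "a \<in> carrier R" "s \<in> S"
  shows "frac a s \<in> Q \<longleftrightarrow> a \<in> contraction Q"
proof -
  interpret Q: ideal Q Loc by fact
  show ?thesis
    using assms(2,3) Q.I_r_closed[of "frac a \<one>" "frac \<one> s"] Q.I_l_closed[of "frac a s" "frac s \<one>"]
    by (auto simp: contraction_def simp flip: frac_eq_mult frac_numerator)
qed

lemma contraction_ideal:
  assumes "ideal Q Loc" shows "ideal (contraction Q) R"
proof -
  interpret h: ring_hom_cring R Loc "\<lambda>a. frac a \<one>" by (rule frac_hom)
  have "ring_hom_ring R Loc (\<lambda>a. frac a \<one>)" by unfold_locales
  then show ?thesis unfolding contraction_def by (rule ring_hom_ring.ideal_vimage[OF _ assms])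
qed

lemma contraction_mono_strict:
  assumes "ideal P Loc" "ideal Q Loc" "P \<subset> Q" shows "contraction P \<subset> contraction Q"
proof -
  have "Q \<subseteq> carrier Loc" by (rule subsetI) (rule ideal.Icarr[OF assms(2)])
  obtain x where x: "x \<in> Q" "x \<notin> P" using assms(3) by blast
  obtain a s where as: "a \<in> carrier R" "s \<in> S" "x = frac a s"
    by (rule Loc_cases[OF subsetD[OF \<open>Q \<subseteq> carrier Loc\<close> x(1)]])
  have "a \<in> contraction Q" "a \<notin> contraction P"
    using frac_mem_iff[OF assms(2) as(1,2)] frac_mem_iff[OF assms(1) as(1,2)] x unfolding as(3) by blast+
  moreover have "contraction P \<subseteq> contraction Q" using assms(3) unfolding contraction_def by blast
  ultimately show ?thesis by blast
qed

lemma contraction_prime: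
  assumes "primeideal Q Loc" shows "primeideal (contraction Q) R" "contraction Q \<inter> S = {}"
proof -
  interpret Q: primeideal Q Loc by fact
  interpret I: ideal "contraction Q" R by (rule contraction_ideal[OF Q.is_ideal])
  show disj: "contraction Q \<inter> S = {}"
  proof (rule ccontr)
    assume "contraction Q \<inter> S \<noteq> {}"
    then obtain s where s: "s \<in> S" "s \<in> contraction Q" by blast
    have "frac s s \<in> Q" using s frac_mem_iff[OF Q.is_ideal] by simp
    moreover have "frac s s = \<one>\<^bsub>Loc\<^esub>" unfolding Loc_one by (rule frac_eqI) (use s in auto)
    ultimately show False using Q.I_notcarr Q.one_imp_carrier by auto
  qed
  show "primeideal (contraction Q) R"
  proof (rule primeidealI[OF I.is_ideal cring_axioms])
    show "carrier R \<noteq> contraction Q" using disj one_mem_S by blast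
    fix a b assume ab: "a \<in> carrier R" "b \<in> carrier R" "a \<otimes> b \<in> contraction Q"
    have "frac a \<one> \<otimes>\<^bsub>Loc\<^esub> frac b \<one> = frac (a \<otimes> b) \<one>"
      unfolding frac_mult[OF ab(1) one_mem_S ab(2) one_mem_S] by simp
    also have "\<dots> \<in> Q" using ab(3) unfolding contraction_def by blast
    finally have "frac a \<one> \<in> Q \<or> frac b \<one> \<in> Q"
      by (rule Q.I_prime[OF frac_carrier[OF ab(1) one_mem_S] frac_carrier[OF ab(2) one_mem_S]])
    then show "a \<in> contraction Q \<or> b \<in> contraction Q"
      unfolding contraction_def using ab(1,2) by blast
  qed
qed

lemma extension_ideal:
  assumes "ideal P R" shows "ideal (extension P) Loc"
proof -
  interpret P: ideal P R by fact
  interpret L: cring Loc by (rule cring_Loc)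
  have mem: "\<exists>a\<in>P. \<exists>s\<in>S. x = frac a s" if "x \<in> extension P" for x
    using that by (auto simp: extension_def)
  have I: "frac a s \<in> extension P" if "a \<in> P" "s \<in> S" for a s
    using that by (auto simp: extension_def)
  have m: "y \<otimes>\<^bsub>Loc\<^esub> x \<in> extension P" if xy: "x \<in> extension P" "y \<in> carrier Loc" for x y
  proof -
    obtain a s where as: "a \<in> P" "s \<in> S" "x = frac a s" using mem[OF xy(1)] by blast
    obtain b t where bt: "b \<in> carrier R" "t \<in> S" "y = frac b t" by (rule Loc_cases[OF xy(2)])
    have "frac (b \<otimes> a) (t \<otimes> s) \<in> extension P"
      by (rule I[OF P.I_l_closed[OF as(1) bt(1)] mult_mem_S[OF bt(2) as(2)]])
    then show ?thesis unfolding as(3) bt(3) frac_mult[OF bt(1,2) P.Icarr[OF as(1)] as(2)] .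
  qed
  have subset: "extension P \<subseteq> carrier Loc" unfolding extension_def using P.Icarr frac_carrier by blast
  show ?thesis
  proof (rule idealI[OF L.ring_axioms])
    show "subgroup (extension P) (add_monoid Loc)"
    proof (rule L.add.subgroupI)
      show "extension P \<subseteq> carrier Loc" by (rule subset)
      show "extension P \<noteq> {}" using I[OF P.zero_closed one_mem_S] by blast
      fix x assume x: "x \<in> extension P"
      have xc: "x \<in> carrier Loc" using x subset by blast
      have "\<ominus>\<^bsub>Loc\<^esub> x = (\<ominus>\<^bsub>Loc\<^esub> \<one>\<^bsub>Loc\<^esub>) \<otimes>\<^bsub>Loc\<^esub> x"
        using L.l_minus[OF L.one_closed xc] L.l_one[OF xc] by (simp only:)
      then show "\<ominus>\<^bsub>Loc\<^esub> x \<in> extension P"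
        using m[OF x L.a_inv_closed[OF L.one_closed]] by (simp only:)
      fix y assume y: "y \<in> extension P"
      obtain a s where as: "a \<in> P" "s \<in> S" "x = frac a s" using mem[OF x] by blast
      obtain b t where bt: "b \<in> P" "t \<in> S" "y = frac b t" using mem[OF y] by blast
      have "a \<otimes> t \<oplus> b \<otimes> s \<in> P"
        by (rule P.a_closed[OF P.I_r_closed[OF as(1) S_closed[OF bt(2)]] P.I_r_closed[OF bt(1) S_closed[OF as(2)]]])
      then show "x \<oplus>\<^bsub>Loc\<^esub> y \<in> extension P"
        unfolding as(3) bt(3) frac_add[OF P.Icarr[OF as(1)] as(2) P.Icarr[OF bt(1)] bt(2)]
        by (rule I[OF _ mult_mem_S[OF as(2) bt(2)]])
    qed
    fix x y assume xy: "x \<in> extension P" "y \<in> carrier Loc"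
    show "y \<otimes>\<^bsub>Loc\<^esub> x \<in> extension P" by (rule m[OF xy])
    then show "x \<otimes>\<^bsub>Loc\<^esub> y \<in> extension P"
      using L.m_comm[OF subsetD[OF subset xy(1)] xy(2)] by (simp only:)
  qed
qed

text \<open>Primes that avoid the denominators survive unchanged; with \<open>contraction_prime\<close> this identifies
  the primes of the localization with these primes.\<close>

lemma contraction_extension:
  assumes "primeideal P R" "P \<inter> S = {}" shows "contraction (extension P) = P"
proof -
  interpret P: primeideal P R by fact
  show ?thesis
  proof
    show "P \<subseteq> contraction (extension P)"
      unfolding contraction_def extension_def using P.Icarr one_mem_S by blast
    show "contraction (extension P) \<subseteq> P"
    proof
      fix a assume "a \<in> contraction (extension P)"
      then obtain b s where a: "a \<in> carrier R" "b \<in> P" "s \<in> S" "frac a \<one> = frac b s"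
        unfolding contraction_def extension_def by blast
      then obtain u where u: "u \<in> S" "u \<otimes> (a \<otimes> s) = u \<otimes> (b \<otimes> \<one>)"
        using frac_eq_iff[OF a(1) P.Icarr[OF a(2)] one_mem_S a(3)] by blast
      have "b \<otimes> \<one> = b" by (rule r_one[OF P.Icarr[OF a(2)]])
      then have "u \<otimes> (a \<otimes> s) \<in> P"
        unfolding u(2) using P.I_l_closed[OF a(2) S_closed[OF u(1)]] by (simp only:)
      then have "u \<in> P \<or> a \<otimes> s \<in> P"
        by (rule P.I_prime[OF S_closed[OF u(1)] m_closed[OF a(1) S_closed[OF a(3)]]])
      then have "a \<otimes> s \<in> P" using u(1) assms(2) by blast
      then have "a \<in> P \<or> s \<in> P" by (rule P.I_prime[OF a(1) S_closed[OF a(3)]])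
      then show "a \<in> P" using a(3) assms(2) by blast
    qed
  qed
qed

lemma extension_prime:
  assumes "primeideal P R" "P \<inter> S = {}" shows "primeideal (extension P) Loc"
proof -
  interpret P: primeideal P R by fact
  have ideal: "ideal (extension P) Loc" by (rule extension_ideal[OF P.is_ideal])
  note mem = frac_mem_iff[OF ideal, unfolded contraction_extension[OF assms]]
  show ?thesis
  proof (rule primeidealI[OF ideal cring_Loc])
    show "carrier Loc \<noteq> extension P"
      using mem[OF one_closed one_mem_S] frac_carrier[OF one_closed one_mem_S] assms(2) one_mem_S by blast
    fix x y assume xy: "x \<in> carrier Loc" "y \<in> carrier Loc" "x \<otimes>\<^bsub>Loc\<^esub> y \<in> extension P"
    obtain a s where x: "a \<in> carrier R" "s \<in> S" "x = frac a s" by (rule Loc_cases[OF xy(1)])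
    obtain b t where y: "b \<in> carrier R" "t \<in> S" "y = frac b t" by (rule Loc_cases[OF xy(2)])
    have "a \<otimes> b \<in> P"
      using xy(3) mem[OF m_closed[OF x(1) y(1)] mult_mem_S[OF x(2) y(2)]]
      unfolding x(3) y(3) frac_mult[OF x(1,2) y(1,2)] by blast
    then have "a \<in> P \<or> b \<in> P" by (rule P.I_prime[OF x(1) y(1)])
    then show "x \<in> extension P \<or> y \<in> extension P"
      unfolding x(3) y(3) mem[OF x(1,2)] mem[OF y(1,2)] .
  qed
qed

text \<open>The numerators of an ideal form an ideal of the original ring, and generators of it generate the ideal.\<close>

lemma noetherian_Loc:
  assumes "noetherian_ring R" shows "noetherian_ring Loc"
proof -
  interpret L: cring Loc by (rule cring_Loc)
  interpret N: noetherian_ring R by fact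
  show ?thesis
  proof (rule L.noetherian_ringI)
    fix Q assume Q: "ideal Q Loc"
    interpret Q: ideal Q Loc by fact
    interpret C: ideal "contraction Q" R by (rule contraction_ideal[OF Q])
    obtain G where G: "G \<subseteq> carrier R" "finite G" "contraction Q = Idl G"
      using N.finetely_gen[OF C.is_ideal] by blast
    let ?G = "(\<lambda>a. frac a \<one>) ` G"
    have sub: "?G \<subseteq> carrier Loc" using G(1) frac_carrier one_mem_S by blast
    have id: "ideal (Idl\<^bsub>Loc\<^esub> ?G) Loc" by (rule L.genideal_ideal[OF sub])
    have "?G \<subseteq> Q"
      using G(3) genideal_self[OF G(1)] unfolding contraction_def by blast
    then have 1: "Idl\<^bsub>Loc\<^esub> ?G \<subseteq> Q" by (rule L.genideal_minimal[OF Q])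
    have "G \<subseteq> contraction (Idl\<^bsub>Loc\<^esub> ?G)"
      using G(1) L.genideal_self[OF sub] unfolding contraction_def by blast
    then have sub': "contraction Q \<subseteq> contraction (Idl\<^bsub>Loc\<^esub> ?G)"
      unfolding G(3) by (rule genideal_minimal[OF contraction_ideal[OF id]])
    have "Q \<subseteq> Idl\<^bsub>Loc\<^esub> ?G"
    proof (intro subsetI)
      fix x assume x: "x \<in> Q"
      obtain a s where as: "a \<in> carrier R" "s \<in> S" "x = frac a s" by (rule Loc_cases[OF Q.Icarr[OF x]])
      have "a \<in> contraction Q" using x frac_mem_iff[OF Q as(1,2)] by (simp only: as(3))
      then have "a \<in> contraction (Idl\<^bsub>Loc\<^esub> ?G)" using sub' by blast
      then show "x \<in> Idl\<^bsub>Loc\<^esub> ?G" by (simp only: as(3) frac_mem_iff[OF id as(1,2)])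
    qed
    with 1 have "Q = Idl\<^bsub>Loc\<^esub> ?G" by (rule equalityI[rotated])
    moreover have "finite ?G" using G(2) by (rule finite_imageI)
    ultimately show "\<exists>A\<subseteq>carrier Loc. finite A \<and> Q = Idl\<^bsub>Loc\<^esub> A" by (intro exI[of _ ?G] conjI sub)
  qed
qed

end

section \<open>Cohen-Macaulay rings of dimension one\<close>

text \<open>Krull's argument: an ideal maximal among those that avoid a multiplicatively closed set is prime, since two
  larger ideals both meet the set and then so does their product. In a Noetherian ring the maximal element exists
  because every chain of ideals contains its union.\<close>

lemma (in cring) prime_avoiding:
  assumes "noetherian_ring R" "ideal I R" "T \<subseteq> carrier R" "\<one> \<in> T"
    and closed: "\<And>s t. \<lbrakk>s \<in> T; t \<in> T\<rbrakk> \<Longrightarrow> s \<otimes> t \<in> T"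
    and "I \<inter> T = {}"
  obtains P where "primeideal P R" "I \<subseteq> P" "P \<inter> T = {}"
proof -
  define A where "A = {J. ideal J R \<and> I \<subseteq> J \<and> J \<inter> T = {}}"
  have "\<exists>M\<in>A. \<forall>J\<in>A. M \<subseteq> J \<longrightarrow> J = M"
  proof (rule subset_Zorn_nonempty)
    show "A \<noteq> {}" using assms(2,6) by (auto simp: A_def)
    fix C assume C: "C \<noteq> {}" "subset.chain A C"
    have "subset.chain {J. ideal J R} C" using C(2) by (auto simp: A_def pred_on.chain_def)
    then have "\<Union>C \<in> C" by (rule noetherian_ring.ideal_chain_is_trivial[OF assms(1) C(1)])
    then show "\<Union>C \<in> A" using C(2) by (auto simp: pred_on.chain_def)
  qed
  then obtain M where M: "M \<in> A" and max: "\<And>J. \<lbrakk>J \<in> A; M \<subseteq> J\<rbrakk> \<Longrightarrow> J = M" by blast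
  from M have MI: "ideal M R" "I \<subseteq> M" "M \<inter> T = {}" by (auto simp: A_def)
  interpret M: ideal M R by fact
  have meets: "\<exists>m\<in>M. \<exists>r\<in>carrier R. m \<oplus> r \<otimes> a \<in> T" if a: "a \<in> carrier R" "a \<notin> M" for a
  proof -
    define J where "J = M <+>\<^bsub>R\<^esub> PIdl a"
    have J: "ideal J R" unfolding J_def by (rule add_ideals[OF MI(1) cgenideal_ideal[OF a(1)]])
    have mem: "m \<oplus> r \<otimes> a \<in> J" if "m \<in> M" "r \<in> carrier R" for m r
      using that unfolding J_def set_add_def' cgenideal_def by blast
    have "M \<subseteq> J"
    proof
      fix m assume m: "m \<in> M"
      have "m \<oplus> \<zero> \<otimes> a = m" using a(1) M.Icarr[OF m] by simp
      then show "m \<in> J" using mem[OF m zero_closed] by simp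
    qed
    have "\<zero> \<oplus> \<one> \<otimes> a = a" using a(1) by simp
    then have "a \<in> J" using mem[OF M.zero_closed one_closed] by simp
    have "J \<inter> T \<noteq> {}"
    proof
      assume "J \<inter> T = {}"
      then have "J \<in> A" using J MI(2) \<open>M \<subseteq> J\<close> by (auto simp: A_def)
      then show False using max[OF _ \<open>M \<subseteq> J\<close>] \<open>a \<in> J\<close> a(2) by blast
    qed
    then show ?thesis unfolding J_def set_add_def' cgenideal_def by blast
  qed
  have "primeideal M R"
  proof (rule primeidealI[OF MI(1) is_cring])
    show "carrier R \<noteq> M" using MI(3) assms(4) one_closed by blast
    fix a b assume a: "a \<in> carrier R" and b: "b \<in> carrier R" and ab: "a \<otimes> b \<in> M"
    show "a \<in> M \<or> b \<in> M"
    proof (rule ccontr)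
      assume "\<not> (a \<in> M \<or> b \<in> M)"
      then have "a \<notin> M" "b \<notin> M" by blast+
      obtain m r where m: "m \<in> M" "r \<in> carrier R" "m \<oplus> r \<otimes> a \<in> T"
        using meets[OF a \<open>a \<notin> M\<close>] by blast
      obtain m' r' where m': "m' \<in> M" "r' \<in> carrier R" "m' \<oplus> r' \<otimes> b \<in> T"
        using meets[OF b \<open>b \<notin> M\<close>] by blast
      have c: "m \<in> carrier R" "m' \<in> carrier R" using m(1) m'(1) by (blast intro: M.Icarr)+
      have "(m \<oplus> r \<otimes> a) \<otimes> (m' \<oplus> r' \<otimes> b) = (m' \<oplus> r' \<otimes> b) \<otimes> m \<oplus> ((r \<otimes> a) \<otimes> m' \<oplus> (r \<otimes> r') \<otimes> (a \<otimes> b))"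
        using a b c m(2) m'(2) by algebra
      also have "\<dots> \<in> M"
        using a b c m(2) m'(2)
        by (intro M.a_closed M.I_l_closed[OF m(1)] M.I_l_closed[OF m'(1)] M.I_l_closed[OF ab]) simp_all
      finally show False using closed[OF m(3) m'(3)] MI(3) by blast
    qed
  qed
  then show ?thesis using that MI by blast
qed

lemma (in ring) Idl_empty: "Idl {} = {\<zero>}"
  using genideal_minimal[OF zeroideal, of "{}"] additive_subgroup.zero_closed[OF ideal.axioms(1)[OF genideal_ideal[of "{}"]]]
  by auto

lemma krull_dim_ge_one:
  assumes "primeideal P R" "primeideal Q R" "P \<subset> Q" shows "1 \<le> krull_dim R"
proof -
  have "(\<forall>i\<le>1. primeideal (if i = (0::nat) then P else Q) R) \<and>
      (\<forall>i<1. (if i = (0::nat) then P else Q) \<subset> (if Suc i = 0 then P else Q))"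
    using assms by auto
  then have "(1::nat) \<in> {m. \<exists>p :: nat \<Rightarrow> 'a set. (\<forall>i\<le>m. primeideal (p i) R) \<and> (\<forall>i<m. p i \<subset> p (Suc i))}"
    by (intro CollectI exI[of _ "\<lambda>i. if i = 0 then P else Q"])
  then have "enat 1 \<le> krull_dim R" unfolding krull_dim_def by (rule SUP_upper)
  then show ?thesis by (simp add: one_enat_def)
qed

lemma krull_dim_le_one:
  assumes "\<And>P0 P1 P2. \<lbrakk>primeideal P0 R; primeideal P1 R; primeideal P2 R; P0 \<subset> P1\<rbrakk> \<Longrightarrow> \<not> P1 \<subset> P2"
  shows "krull_dim R \<le> 1"
  unfolding krull_dim_def
proof (rule SUP_least)
  fix m assume "m \<in> {m. \<exists>p :: nat \<Rightarrow> 'a set. (\<forall>i\<le>m. primeideal (p i) R) \<and> (\<forall>i<m. p i \<subset> p (Suc i))}"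
  then obtain p :: "nat \<Rightarrow> 'a set" where p: "\<forall>i\<le>m. primeideal (p i) R" "\<forall>i<m. p i \<subset> p (Suc i)" by blast
  have "\<not> 2 \<le> m"
  proof
    assume "2 \<le> m"
    then show False
      using assms[of "p 0" "p 1" "p 2"] p(1)[rule_format, of 0] p(1)[rule_format, of 1] p(1)[rule_format, of 2]
        p(2)[rule_format, of 0] p(2)[rule_format, of 1] by (simp add: numeral_2_eq_2)
  qed
  then show "enat m \<le> 1" by (simp add: one_enat_def)
qed

lemma (in cring) depth_ge_oneD:
  assumes "1 \<le> depth I R"
  obtains y where "y \<in> I" "y \<in> carrier R" "\<And>r. \<lbrakk>r \<in> carrier R; y \<otimes> r = \<zero>\<rbrakk> \<Longrightarrow> r = \<zero>"
proof -
  have "\<exists>xs. regular_sequence R xs \<and> set xs \<subseteq> I \<and> xs \<noteq> []"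
  proof (rule ccontr)
    assume "\<nexists>xs. regular_sequence R xs \<and> set xs \<subseteq> I \<and> xs \<noteq> []"
    then have "depth I R \<le> 0" unfolding depth_def by (intro SUP_least) (auto simp: zero_enat_def)
    then show False using assms by simp
  qed
  then obtain y xs where xs: "regular_sequence R (y # xs)" "y \<in> I" by (metis list.exhaust list.set_intros(1) subsetD)
  then have "y \<in> carrier R" by (simp add: regular_sequence_def)
  moreover have "r = \<zero>" if "r \<in> carrier R" "y \<otimes> r = \<zero>" for r
  proof -
    have "\<forall>r\<in>carrier R. ((y # xs) ! 0) \<otimes> r \<in> Idl (set (take 0 (y # xs))) \<longrightarrow> r \<in> Idl (set (take 0 (y # xs)))"
      using xs(1) unfolding regular_sequence_def by blast
    then show ?thesis using that by (simp add: Idl_empty)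
  qed
  ultimately show ?thesis using xs(2) that by blast
qed

text \<open>There is no regular sequence \<open>y, z\<close> if a power of \<open>z\<close> is a multiple of \<open>y\<close>: cancelling the factors \<open>z\<close> modulo
  \<open>y\<close> one after the other would make \<open>y\<close> a unit.\<close>

lemma (in cring) depth_eq_one:
  assumes I: "ideal I R" "I \<noteq> carrier R"
    and y: "y \<in> I" "\<And>r. \<lbrakk>r \<in> carrier R; y \<otimes> r = \<zero>\<rbrakk> \<Longrightarrow> r = \<zero>"
    and power: "\<And>y z. \<lbrakk>y \<in> I; \<And>r. \<lbrakk>r \<in> carrier R; y \<otimes> r = \<zero>\<rbrakk> \<Longrightarrow> r = \<zero>; z \<in> I\<rbrakk>
      \<Longrightarrow> \<exists>k::nat. z [^] k \<in> Idl {y}"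
  shows "depth I R = 1"
proof (rule antisym)
  interpret I: ideal I R by fact
  have "Idl {y} \<subseteq> I" using y(1) by (intro genideal_minimal[OF I(1)]) simp
  then have "Idl {y} \<noteq> carrier R" using I(2) I.a_subset by blast
  moreover have "\<forall>r\<in>carrier R. y \<otimes> r = \<zero> \<longrightarrow> r = \<zero>" using y(2) by blast
  ultimately have "regular_sequence R [y]"
    using I.Icarr[OF y(1)] by (simp add: regular_sequence_def Idl_empty)
  then have "enat (length [y]) \<le> depth I R"
    unfolding depth_def using y(1) by (intro SUP_upper) simp
  then show "1 \<le> depth I R" by (simp add: one_enat_def)
  show "depth I R \<le> 1"
    unfolding depth_def
  proof (rule SUP_least)
    fix xs assume xs: "xs \<in> {xs. regular_sequence R xs \<and> set xs \<subseteq> I}"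
    show "enat (length xs) \<le> 1"
    proof (rule ccontr)
      assume "\<not> enat (length xs) \<le> 1"
      then have len: "2 \<le> length xs" by (simp add: one_enat_def)
      then obtain a b ys where e: "xs = a # b # ys"
        by (metis Suc_le_length_iff numeral_2_eq_2)
      have reg: "regular_sequence R (a # b # ys)" and ab: "a \<in> I" "b \<in> I" using xs e by auto
      have R: "\<And>i r. \<lbrakk>i < length (a # b # ys); r \<in> carrier R; ((a # b # ys) ! i) \<otimes> r \<in> Idl (set (take i (a # b # ys)))\<rbrakk>
          \<Longrightarrow> r \<in> Idl (set (take i (a # b # ys)))"
        and ne: "Idl (set (a # b # ys)) \<noteq> carrier R" and sub: "set (a # b # ys) \<subseteq> carrier R"
        using reg unfolding regular_sequence_def by blast+
      have a: "r = \<zero>" if "r \<in> carrier R" "a \<otimes> r = \<zero>" for r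
        using R[of 0 r] that by (simp add: Idl_empty)
      obtain k :: nat where k: "b [^] k \<in> Idl {a}"
        using power[OF ab(1) a ab(2)] by blast
      have b: "r \<in> Idl {a}" if "r \<in> carrier R" "b \<otimes> r \<in> Idl {a}" for r
        using R[of 1 r] that by simp
      have bc: "b \<in> carrier R" using sub by simp
      have "b [^] j \<in> Idl {a} \<Longrightarrow> \<one> \<in> Idl {a}" for j :: nat
      proof (induction j)
        case (Suc j)
        have "b \<otimes> b [^] j \<in> Idl {a}" using Suc.prems bc by (simp add: m_comm)
        then show ?case using Suc.IH b bc by blast
      qed simp
      then have "\<one> \<in> Idl {a}" using k by blast
      moreover have "Idl {a} \<subseteq> Idl (set (a # b # ys))"
        using sub by (intro subset_Idl_subset) auto
      ultimately show False
        using ne ideal.one_imp_carrier[OF genideal_ideal[OF sub]] by blast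
    qed
  qed
qed

context cring_localization
begin

lemma frac_pow:
  assumes "a \<in> carrier R" "s \<in> S" shows "frac a s [^]\<^bsub>Loc\<^esub> (k::nat) = frac (a [^] k) (s [^] k)"
    and "s [^] k \<in> S"
proof -
  interpret L: cring Loc by (rule cring_Loc)
  show S: "s [^] k \<in> S" for k :: nat
    by (induction k) (simp_all add: assms(2))
  show "frac a s [^]\<^bsub>Loc\<^esub> k = frac (a [^] k) (s [^] k)"
  proof (induction k)
    case 0 then show ?case by (simp add: Loc_one)
  next
    case (Suc k)
    then show ?case
      using frac_mult[OF nat_pow_closed[OF assms(1)] S assms] by (simp only: L.nat_pow_Suc nat_pow_Suc)
  qed
qed

end

lemma (in cring) cring_localization_prime:
  assumes "primeideal M R" shows "cring_localization R (carrier R - M)"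
proof -
  interpret M: primeideal M R by fact
  show ?thesis
  proof
    show "\<one> \<in> carrier R - M" using M.I_notcarr M.one_imp_carrier by auto
    fix s t assume "s \<in> carrier R - M" "t \<in> carrier R - M"
    then show "s \<otimes> t \<in> carrier R - M" using M.I_prime by auto
  qed auto
qed

text \<open>A fraction whose numerator is outside \<open>M\<close> is invertible, so every proper ideal lies in the
  extension of \<open>M\<close>.\<close>

lemma (in cring) local_ring_localization:
  assumes "primeideal M R"
  shows "local_ring (cring_localization.extension R (carrier R - M) M) (localization R (carrier R - M))"
proof -
  interpret M: primeideal M R by fact
  interpret S: cring_localization R "carrier R - M" by (rule cring_localization_prime[OF assms])
  interpret L: cring S.Loc by (rule S.cring_Loc)
  let ?E = "S.extension M"
  have disj: "M \<inter> (carrier R - M) = {}" by blast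
  have E: "primeideal ?E S.Loc" by (rule S.extension_prime[OF assms disj])
  then have EI: "ideal ?E S.Loc" by (rule primeideal.axioms(1))
  have proper: "J \<subseteq> ?E" if J: "ideal J S.Loc" "J \<noteq> carrier S.Loc" for J
  proof
    fix x assume x: "x \<in> J"
    then have xc: "x \<in> carrier S.Loc" by (rule ideal.Icarr[OF J(1)])
    obtain a s where as: "a \<in> carrier R" "s \<in> carrier R - M" "x = S.frac a s" by (rule S.Loc_cases[OF xc])
    show "x \<in> ?E"
    proof (rule ccontr)
      assume "x \<notin> ?E"
      then have "a \<notin> M"
        unfolding as(3) S.frac_mem_iff[OF EI as(1,2)] S.contraction_extension[OF assms disj] .
      then have a: "a \<in> carrier R - M" using as(1) by blast
      have sc: "s \<in> carrier R" using as(2) by blast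
      have "S.frac s a \<otimes>\<^bsub>S.Loc\<^esub> x = S.frac (s \<otimes> a) (a \<otimes> s)"
        unfolding as(3) by (rule S.frac_mult[OF sc a as(1,2)])
      also have "\<dots> = \<one>\<^bsub>S.Loc\<^esub>"
        unfolding S.Loc_one
        by (rule S.frac_eqI[OF m_closed[OF sc as(1)] one_closed S.mult_mem_S[OF a as(2)] S.one_mem_S])
          (use sc as(1) in \<open>simp add: m_comm\<close>)
      finally have "\<one>\<^bsub>S.Loc\<^esub> \<in> J"
        using ideal.I_l_closed[OF J(1) x S.frac_carrier[OF sc a]] by simp
      then show False using ideal.one_imp_carrier[OF J(1)] J(2) by blast
    qed
  qed
  have Emax: "maximalideal ?E S.Loc"
  proof (rule maximalidealI[OF EI])
    show "carrier S.Loc \<noteq> ?E" using primeideal.I_notcarr[OF E] .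
    fix J assume "ideal J S.Loc" "?E \<subseteq> J" "J \<subseteq> carrier S.Loc"
    then show "J = ?E \<or> J = carrier S.Loc" using proper by blast
  qed
  have "maximalideal N S.Loc \<longleftrightarrow> N = ?E" for N
  proof
    assume N: "maximalideal N S.Loc"
    then have "ideal N S.Loc" "N \<noteq> carrier S.Loc"
      using maximalideal.axioms(1) maximalideal.I_notcarr by metis+
    then have "N \<subseteq> ?E" by (rule proper)
    moreover have "?E \<subseteq> carrier S.Loc" using ideal.Icarr[OF EI] by blast
    ultimately have "?E = N \<or> ?E = carrier S.Loc" by (intro maximalideal.I_maximal[OF N EI])
    then show "N = ?E" using primeideal.I_notcarr[OF E] by blast
  qed (use Emax in blast)
  then show ?thesis unfolding local_ring_def using S.cring_Loc by blast
qed

text \<open>The hypotheses say that \<open>N\<close> is the nilradical and that all other primes are maximal. The local ring at \<open>M\<close>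
  then has the two primes \<open>N\<close> and \<open>M\<close>, hence dimension one, and the nonzerodivisor in \<open>M\<close> gives depth at least one.
  The depth is not larger: a regular \<open>y\<close> is not nilpotent, so the maximal ideal is the only prime above \<open>y\<close> and all its
  elements have a power that is a multiple of \<open>y\<close>.\<close>

theorem (in cring) cohen_macaulay_dim_one:
  assumes noeth: "noetherian_ring R" and N: "primeideal N R"
    and nil: "\<And>a. a \<in> N \<Longrightarrow> \<exists>k::nat. a [^] k = \<zero>"
    and dim: "\<And>P. \<lbrakk>primeideal P R; P \<noteq> N\<rbrakk> \<Longrightarrow> maximalideal P R"
    and nzd: "\<And>M. maximalideal M R \<Longrightarrow> \<exists>f\<in>M. f \<notin> N \<and> (\<forall>r\<in>carrier R. f \<otimes> r = \<zero> \<longrightarrow> r = \<zero>)"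
  shows "cohen_macaulay R"
  unfolding cohen_macaulay_def
proof (intro conjI allI impI noeth is_cring)
  fix M assume M: "maximalideal M R"
  then have MP: "primeideal M R" by (rule maximalideal_prime)
  interpret N: primeideal N R by fact
  interpret M: primeideal M R by fact
  interpret S: cring_localization R "carrier R - M" by (rule cring_localization_prime[OF MP])
  interpret L: cring S.Loc by (rule S.cring_Loc)
  let ?E = "S.extension M"
  have disj: "M \<inter> (carrier R - M) = {}" by blast
  have E: "primeideal ?E S.Loc" by (rule S.extension_prime[OF MP disj])
  then have EI: "ideal ?E S.Loc" by (rule primeideal.axioms(1))
  have nil_le: "N \<subseteq> P" if P: "primeideal P R" for P
  proof
    interpret P: primeideal P R by fact
    fix a assume a: "a \<in> N"
    then have ac: "a \<in> carrier R" by (rule N.Icarr)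
    obtain k :: nat where k: "a [^] k = \<zero>" using nil[OF a] by blast
    have "a [^] j \<in> P \<Longrightarrow> a \<in> P" for j :: nat
    proof (induction j)
      case 0 then show ?case using P.one_imp_carrier P.I_notcarr by simp
    next
      case (Suc j)
      then show ?case using P.I_prime[OF nat_pow_closed[OF ac] ac] by auto
    qed
    then show "a \<in> P" using k P.zero_closed by metis
  qed
  obtain f where f: "f \<in> M" "f \<notin> N" "\<And>r. \<lbrakk>r \<in> carrier R; f \<otimes> r = \<zero>\<rbrakk> \<Longrightarrow> r = \<zero>"
    using nzd[OF M] by blast
  have fc: "f \<in> carrier R" using f(1) by (rule M.Icarr)
  have NM: "N \<subset> M" using nil_le[OF MP] f by blast
  have Ndisj: "N \<inter> (carrier R - M) = {}" using NM by blast
  have EN: "primeideal (S.extension N) S.Loc" by (rule S.extension_prime[OF N Ndisj])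
  have ENM: "S.extension N \<subset> ?E"
  proof -
    have "S.extension N \<subseteq> ?E" using NM unfolding S.extension_def by blast
    moreover have "S.contraction (S.extension N) \<noteq> S.contraction ?E"
      unfolding S.contraction_extension[OF N Ndisj] S.contraction_extension[OF MP disj] using NM by blast
    ultimately show ?thesis by (metis psubsetI)
  qed
  have contr: "S.contraction P = N \<or> S.contraction P = M" if P: "primeideal P S.Loc" for P
  proof (rule disjCI)
    note P' = S.contraction_prime[OF P]
    assume ne: "S.contraction P \<noteq> M"
    have sub: "S.contraction P \<subseteq> M"
      using P'(2) unfolding S.contraction_def by blast
    show "S.contraction P = N"
    proof (rule ccontr)
      assume "S.contraction P \<noteq> N"
      then have "maximalideal (S.contraction P) R" by (rule dim[OF P'(1)])
      then have "M = S.contraction P \<or> M = carrier R"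
        by (rule maximalideal.I_maximal[OF _ M.is_ideal sub M.a_subset])
      then show False using ne M.I_notcarr by metis
    qed
  qed
  have "krull_dim S.Loc = 1"
  proof (rule antisym)
    show "1 \<le> krull_dim S.Loc" by (rule krull_dim_ge_one[OF EN E ENM])
    show "krull_dim S.Loc \<le> 1"
    proof (rule krull_dim_le_one, rule notI)
      fix P0 P1 P2
      assume P: "primeideal P0 S.Loc" "primeideal P1 S.Loc" "primeideal P2 S.Loc" "P0 \<subset> P1" "P1 \<subset> P2"
      note I = P(1-3)[THEN primeideal.axioms(1)]
      show False
        using contr[OF P(1)] contr[OF P(2)] contr[OF P(3)] NM
          S.contraction_mono_strict[OF I(1,2) P(4)] S.contraction_mono_strict[OF I(2,3) P(5)] by blast
    qed
  qed
  moreover have "depth ?E S.Loc = 1"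
  proof (rule L.depth_eq_one[OF EI])
    show "?E \<noteq> carrier S.Loc" using primeideal.I_notcarr[OF E] by blast
    show "S.frac f \<one> \<in> ?E" unfolding S.extension_def using f(1) S.one_mem_S by blast
    fix r assume r: "r \<in> carrier S.Loc" "S.frac f \<one> \<otimes>\<^bsub>S.Loc\<^esub> r = \<zero>\<^bsub>S.Loc\<^esub>"
    obtain a s where as: "a \<in> carrier R" "s \<in> carrier R - M" "r = S.frac a s" by (rule S.Loc_cases[OF r(1)])
    have "S.frac (f \<otimes> a) (\<one> \<otimes> s) = \<zero>\<^bsub>S.Loc\<^esub>"
      using r(2) unfolding as(3) S.frac_mult[OF fc S.one_mem_S as(1,2)] .
    then obtain u where u: "u \<in> carrier R - M" "u \<otimes> (f \<otimes> a) = \<zero>"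
      unfolding S.frac_eq_zero_iff[OF m_closed[OF fc as(1)] S.mult_mem_S[OF S.one_mem_S as(2)]] by blast
    have uc: "u \<in> carrier R" using u(1) by blast
    have "f \<otimes> (u \<otimes> a) = \<zero>" using u(2) uc fc as(1) by (simp add: m_ac)
    then have "u \<otimes> a = \<zero>" using f(3) uc as(1) by blast
    then show "r = \<zero>\<^bsub>S.Loc\<^esub>"
      unfolding as(3) S.frac_eq_zero_iff[OF as(1,2)] using u(1) by blast
  next
    fix y z assume y: "y \<in> ?E" "\<And>r. \<lbrakk>r \<in> carrier S.Loc; y \<otimes>\<^bsub>S.Loc\<^esub> r = \<zero>\<^bsub>S.Loc\<^esub>\<rbrakk> \<Longrightarrow> r = \<zero>\<^bsub>S.Loc\<^esub>"
      and z: "z \<in> ?E"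
    have yc: "y \<in> carrier S.Loc" and zc: "z \<in> carrier S.Loc" using y(1) z ideal.Icarr[OF EI] by blast+
    show "\<exists>k::nat. z [^]\<^bsub>S.Loc\<^esub> k \<in> Idl\<^bsub>S.Loc\<^esub> {y}"
    proof (rule ccontr)
      assume no: "\<nexists>k::nat. z [^]\<^bsub>S.Loc\<^esub> k \<in> Idl\<^bsub>S.Loc\<^esub> {y}"
      define T where "T = range (\<lambda>k::nat. z [^]\<^bsub>S.Loc\<^esub> k)"
      have Iy: "ideal (Idl\<^bsub>S.Loc\<^esub> {y}) S.Loc" using yc by (intro L.genideal_ideal) simp
      have "\<one>\<^bsub>S.Loc\<^esub> \<in> T" unfolding T_def by (rule range_eqI[of _ _ 0]) simp
      moreover have "T \<subseteq> carrier S.Loc" unfolding T_def using zc by auto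
      moreover have "s \<otimes>\<^bsub>S.Loc\<^esub> t \<in> T" if "s \<in> T" "t \<in> T" for s t
        using that zc unfolding T_def by (auto simp: L.nat_pow_mult)
      moreover have "Idl\<^bsub>S.Loc\<^esub> {y} \<inter> T = {}" using no unfolding T_def by blast
      ultimately obtain P where P: "primeideal P S.Loc" "Idl\<^bsub>S.Loc\<^esub> {y} \<subseteq> P" "P \<inter> T = {}"
        using L.prime_avoiding[OF S.noetherian_Loc[OF noeth] Iy] by metis
      note PI = primeideal.axioms(1)[OF P(1)]
      have yP: "y \<in> P" using P(2) L.genideal_self'[OF yc] by blast
      have "z \<in> T" unfolding T_def by (rule range_eqI[of _ _ 1]) (use zc in simp)
      from contr[OF P(1)] show False
      proof
        assume C: "S.contraction P = N"
        obtain a s where as: "a \<in> carrier R" "s \<in> carrier R - M" "y = S.frac a s" by (rule S.Loc_cases[OF yc])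
        have "a \<in> N" using yP unfolding as(3) S.frac_mem_iff[OF PI as(1,2)] C .
        then obtain k :: nat where k: "a [^] k = \<zero>" using nil by blast
        have "y [^]\<^bsub>S.Loc\<^esub> k = S.frac \<zero> (s [^] k)"
          unfolding as(3) S.frac_pow(1)[OF as(1,2)] k ..
        also have "\<dots> = \<zero>\<^bsub>S.Loc\<^esub>"
          unfolding S.frac_eq_zero_iff[OF zero_closed S.frac_pow(2)[OF as(1,2)]]
          by (rule bexI[OF _ S.one_mem_S]) simp
        finally have "y [^]\<^bsub>S.Loc\<^esub> k = \<zero>\<^bsub>S.Loc\<^esub>" .
        moreover have "y [^]\<^bsub>S.Loc\<^esub> j \<noteq> \<zero>\<^bsub>S.Loc\<^esub>" for j :: nat
        proof (induction j)
          case 0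
          have "\<one>\<^bsub>S.Loc\<^esub> \<notin> ?E" using ideal.one_imp_carrier[OF EI] primeideal.I_notcarr[OF E] by blast
          moreover have "\<zero>\<^bsub>S.Loc\<^esub> \<in> ?E" by (rule additive_subgroup.zero_closed[OF ideal.axioms(1)[OF EI]])
          ultimately show ?case by (metis L.nat_pow_0)
        next
          case (Suc j)
          show ?case
          proof
            assume "y [^]\<^bsub>S.Loc\<^esub> Suc j = \<zero>\<^bsub>S.Loc\<^esub>"
            then have "y \<otimes>\<^bsub>S.Loc\<^esub> y [^]\<^bsub>S.Loc\<^esub> j = \<zero>\<^bsub>S.Loc\<^esub>" using L.nat_pow_Suc2[OF yc] by simp
            then show False using y(2) L.nat_pow_closed[OF yc] Suc.IH by blast
          qed
        qed
        ultimately show False by blast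
      next
        assume C: "S.contraction P = M"
        obtain a s where as: "a \<in> carrier R" "s \<in> carrier R - M" "z = S.frac a s" by (rule S.Loc_cases[OF zc])
        have "a \<in> M"
          using z unfolding as(3) S.frac_mem_iff[OF EI as(1,2)] S.contraction_extension[OF MP disj] .
        then have "z \<in> P" unfolding as(3) S.frac_mem_iff[OF PI as(1,2)] C .
        then show False using \<open>z \<in> T\<close> P(3) by blast
      qed
    qed
  qed
  ultimately have "depth ?E S.Loc = krull_dim S.Loc" by simp
  then show "local_cohen_macaulay S.Loc"
    unfolding local_cohen_macaulay_def
    using S.noetherian_Loc[OF noeth] local_ring_localization[OF MP] by blast
qed

text \<open>The element \<open>g\<close> stays nonzero in the local ring at \<open>M\<close> and is killed by the whole maximal ideal, so no element of
  the maximal ideal is regular, whereas \<open>N\<close> and \<open>M\<close> form a chain of length one.\<close>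

theorem (in cring) not_cohen_macaulay_if_socle:
  assumes N: "primeideal N R" and M: "maximalideal M R" and NM: "N \<subset> M"
    and g: "g \<in> carrier R" "\<And>f. f \<in> M \<Longrightarrow> f \<otimes> g = \<zero>" "\<And>u. u \<in> carrier R - M \<Longrightarrow> u \<otimes> g \<noteq> \<zero>"
  shows "\<not> cohen_macaulay R"
proof
  assume "cohen_macaulay R"
  then have lcm: "local_cohen_macaulay (localization R (carrier R - M))"
    unfolding cohen_macaulay_def using M by blast
  have MP: "primeideal M R" using M by (rule maximalideal_prime)
  interpret S: cring_localization R "carrier R - M" by (rule cring_localization_prime[OF MP])
  interpret L: cring S.Loc by (rule S.cring_Loc)
  let ?E = "S.extension M"
  have disj: "M \<inter> (carrier R - M) = {}" and Ndisj: "N \<inter> (carrier R - M) = {}" using NM by blast+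
  have "S.extension N \<subseteq> ?E" using NM unfolding S.extension_def by blast
  moreover have "S.contraction (S.extension N) \<noteq> S.contraction ?E"
    unfolding S.contraction_extension[OF N Ndisj] S.contraction_extension[OF MP disj] using NM by blast
  ultimately have "S.extension N \<subset> ?E" by (metis psubsetI)
  then have dim: "1 \<le> krull_dim S.Loc"
    by (rule krull_dim_ge_one[OF S.extension_prime[OF N Ndisj] S.extension_prime[OF MP disj]])
  obtain M' where M': "local_ring M' S.Loc" "depth M' S.Loc = krull_dim S.Loc"
    using lcm unfolding local_cohen_macaulay_def by blast
  have "M' = ?E"
    using M'(1) local_ring_localization[OF MP] unfolding local_ring_def by blast
  then have "1 \<le> depth ?E S.Loc" using M'(2) dim by simp
  then obtain y where y: "y \<in> ?E" "\<And>r. \<lbrakk>r \<in> carrier S.Loc; y \<otimes>\<^bsub>S.Loc\<^esub> r = \<zero>\<^bsub>S.Loc\<^esub>\<rbrakk> \<Longrightarrow> r = \<zero>\<^bsub>S.Loc\<^esub>"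
    by (rule L.depth_ge_oneD) blast
  obtain f s where fs: "f \<in> M" "s \<in> carrier R - M" "y = S.frac f s" using y(1) unfolding S.extension_def by blast
  have fc: "f \<in> carrier R" using fs(1) ideal.Icarr[OF primeideal.axioms(1)[OF MP]] by blast
  have "S.frac (f \<otimes> g) (s \<otimes> \<one>) = \<zero>\<^bsub>S.Loc\<^esub>"
    unfolding g(2)[OF fs(1)] S.frac_eq_zero_iff[OF zero_closed S.mult_mem_S[OF fs(2) S.one_mem_S]]
    by (rule bexI[OF _ S.one_mem_S]) simp
  then have "y \<otimes>\<^bsub>S.Loc\<^esub> S.frac g \<one> = \<zero>\<^bsub>S.Loc\<^esub>"
    unfolding fs(3) S.frac_mult[OF fc fs(2) g(1) S.one_mem_S] .
  then have "S.frac g \<one> = \<zero>\<^bsub>S.Loc\<^esub>" by (rule y(2)[OF S.frac_carrier[OF g(1) S.one_mem_S]])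
  then show False
    unfolding S.frac_eq_zero_iff[OF g(1) S.one_mem_S] using g(3) by blast
qed

section \<open>Ideals and quotients of a ring given by a type\<close>

lemma ring_of_type_algebra_simps [simp]:
  "carrier (ring_of_type_algebra :: 'r::ring_1 ring) = UNIV"
  "monoid.mult (ring_of_type_algebra :: 'r::ring_1 ring) x y = x * y"
  "ring.add (ring_of_type_algebra :: 'r::ring_1 ring) x y = x + y"
  "monoid.one (ring_of_type_algebra :: 'r::ring_1 ring) = 1"
  "ring.zero (ring_of_type_algebra :: 'r::ring_1 ring) = 0"
  by (simp_all add: ring_of_type_algebra_def)

lemma cring_ring_of_type_algebra: "cring (ring_of_type_algebra :: 'r::comm_ring_1 ring)"
  by (rule cring_from_type_algebra)

definition is_ideal :: "'r::comm_ring_1 set \<Rightarrow> bool" where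
  "is_ideal J \<longleftrightarrow> 0 \<in> J \<and> (\<forall>a\<in>J. \<forall>b\<in>J. a + b \<in> J) \<and> (\<forall>h. \<forall>a\<in>J. h * a \<in> J)"

lemma is_idealI:
  assumes "0 \<in> J" "\<And>a b. \<lbrakk>a \<in> J; b \<in> J\<rbrakk> \<Longrightarrow> a + b \<in> J" "\<And>h a. a \<in> J \<Longrightarrow> h * a \<in> J"
  shows "is_ideal J"
  using assms unfolding is_ideal_def by blast

lemma is_ideal_zero: "is_ideal J \<Longrightarrow> 0 \<in> J"
  unfolding is_ideal_def by blast

lemma is_ideal_add: "is_ideal J \<Longrightarrow> a \<in> J \<Longrightarrow> b \<in> J \<Longrightarrow> a + b \<in> J"
  unfolding is_ideal_def by blast

lemma is_ideal_mult: "is_ideal J \<Longrightarrow> a \<in> J \<Longrightarrow> h * a \<in> J"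
  unfolding is_ideal_def by blast

lemma is_ideal_mult2: "is_ideal J \<Longrightarrow> a \<in> J \<Longrightarrow> a * h \<in> J"
  using is_ideal_mult[of J a h] by (simp only: mult.commute)

lemma is_ideal_uminus: "is_ideal J \<Longrightarrow> a \<in> J \<Longrightarrow> - a \<in> J"
  using is_ideal_mult[of J a "-1"] by (simp only: mult_minus1)

lemma is_ideal_diff: "is_ideal J \<Longrightarrow> a \<in> J \<Longrightarrow> b \<in> J \<Longrightarrow> a - b \<in> J"
  using is_ideal_add[of J a "- b"] is_ideal_uminus[of J b] by (simp only: diff_conv_add_uminus)

lemma is_ideal_diff_iff:
  assumes "is_ideal J" "a - b \<in> J" shows "a \<in> J \<longleftrightarrow> b \<in> J"
proof
  assume "a \<in> J"
  then have "a - (a - b) \<in> J" by (rule is_ideal_diff[OF assms(1) _ assms(2)])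
  then show "b \<in> J" by simp
next
  assume "b \<in> J"
  then have "(a - b) + b \<in> J" by (rule is_ideal_add[OF assms])
  then show "a \<in> J" by simp
qed

lemma is_ideal_sum: "is_ideal J \<Longrightarrow> (\<And>x. x \<in> A \<Longrightarrow> f x \<in> J) \<Longrightarrow> sum f A \<in> J"
  by (induction A rule: infinite_finite_induct) (auto intro: is_ideal_zero is_ideal_add)

lemma ideal_ring_of_type_algebra:
  "ideal J (ring_of_type_algebra :: 'r::comm_ring_1 ring) \<longleftrightarrow> is_ideal J"
proof
  assume J: "ideal J (ring_of_type_algebra :: 'r ring)"
  then have "additive_subgroup J (ring_of_type_algebra :: 'r ring)" by (rule ideal.axioms)
  from additive_subgroup.zero_closed[OF this] additive_subgroup.a_closed[OF this] ideal.I_l_closed[OF J]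
  show "is_ideal J" unfolding is_ideal_def ring_of_type_algebra_simps by blast
next
  interpret R: cring "ring_of_type_algebra :: 'r ring" by (rule cring_ring_of_type_algebra)
  assume J: "is_ideal J"
  show "ideal J (ring_of_type_algebra :: 'r ring)"
  proof (rule idealI[OF R.ring_axioms])
    show "subgroup J (add_monoid (ring_of_type_algebra :: 'r ring))"
    proof (rule R.add.subgroupI)
      fix a assume a: "a \<in> J"
      have "\<ominus>\<^bsub>ring_of_type_algebra\<^esub> a = - a" by (rule R.minus_equality) simp_all
      then show "\<ominus>\<^bsub>ring_of_type_algebra\<^esub> a \<in> J" using is_ideal_uminus[OF J a] by simp
    next
      show "J \<noteq> {}" using is_ideal_zero[OF J] by blast
    qed (simp_all add: is_ideal_add[OF J])
  qed (simp_all add: is_ideal_mult[OF J] is_ideal_mult2[OF J])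
qed

lemma is_ideal_Idl: "is_ideal (Idl\<^bsub>ring_of_type_algebra\<^esub> (G :: 'r::comm_ring_1 set))"
proof -
  interpret R: cring "ring_of_type_algebra :: 'r ring" by (rule cring_ring_of_type_algebra)
  show ?thesis using R.genideal_ideal[of G] by (simp add: ideal_ring_of_type_algebra)
qed

lemma Idl_contains: "(G :: 'r::comm_ring_1 set) \<subseteq> Idl\<^bsub>ring_of_type_algebra\<^esub> G"
proof -
  interpret R: cring "ring_of_type_algebra :: 'r ring" by (rule cring_ring_of_type_algebra)
  show ?thesis by (rule R.genideal_self) simp
qed

lemma Idl_least: "is_ideal J \<Longrightarrow> (G :: 'r::comm_ring_1 set) \<subseteq> J \<Longrightarrow> Idl\<^bsub>ring_of_type_algebra\<^esub> G \<subseteq> J"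
proof -
  interpret R: cring "ring_of_type_algebra :: 'r ring" by (rule cring_ring_of_type_algebra)
  assume "is_ideal J" "G \<subseteq> J"
  then show ?thesis by (intro R.genideal_minimal) (simp_all add: ideal_ring_of_type_algebra)
qed

text \<open>Statements about \<open>ring_of_type_algebra Quot J\<close> are translated into statements about the elements and
  ideals of the type itself, where ordinary algebraic simplification is available.\<close>

locale type_quotient =
  fixes J :: "'r::comm_ring_1 set"
  assumes J: "is_ideal J"
begin

abbreviation RT :: "'r ring" where "RT \<equiv> ring_of_type_algebra"
abbreviation A :: "'r set ring" where "A \<equiv> ring_of_type_algebra Quot J"
abbreviation proj :: "'r \<Rightarrow> 'r set" where "proj \<equiv> a_r_coset RT J"

lemma cring_A: "cring A"
  by (rule ideal.quotient_is_cring[OF _ cring_ring_of_type_algebra]) (simp add: ideal_ring_of_type_algebra J)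

lemma proj_hom: "proj \<in> ring_hom RT A"
  by (rule ideal.rcos_ring_hom) (simp add: ideal_ring_of_type_algebra J)

lemma proj_mult: "proj (f * g) = proj f \<otimes>\<^bsub>A\<^esub> proj g"
  using ring_hom_mult[OF proj_hom, of f g] by simp

lemma proj_add: "proj (f + g) = proj f \<oplus>\<^bsub>A\<^esub> proj g"
  using ring_hom_add[OF proj_hom, of f g] by simp

lemma proj_one: "proj 1 = \<one>\<^bsub>A\<^esub>"
  using ring_hom_one[OF proj_hom] by simp

lemma proj_closed: "proj f \<in> carrier A"
  using ring_hom_closed[OF proj_hom, of f] by simp

lemma carrier_A: "carrier A = range proj"
  by (auto simp: FactRing_def A_RCOSETS_def RCOSETS_def a_r_coset_def)

lemma proj_eq_iff: "proj f = proj g \<longleftrightarrow> f - g \<in> J"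
proof -
  interpret R: cring RT by (rule cring_ring_of_type_algebra)
  have I: "ideal J RT" by (simp add: ideal_ring_of_type_algebra J)
  have "\<ominus>\<^bsub>RT\<^esub> g = - g" by (rule R.minus_equality) simp_all
  then have "f \<ominus>\<^bsub>RT\<^esub> g = f - g" by (simp add: a_minus_def)
  then show ?thesis using R.quotient_eq_iff_same_a_r_cos[OF I, of f g] by simp
qed

lemma proj_zero: "proj 0 = \<zero>\<^bsub>A\<^esub>"
proof -
  interpret A: cring A by (rule cring_A)
  have "proj 0 \<oplus>\<^bsub>A\<^esub> proj 0 = proj 0" using proj_add[of 0 0] by simp
  then show ?thesis using A.add.l_cancel_one'[OF proj_closed[of 0] proj_closed[of 0]] by simp
qed

lemma proj_eq_zero_iff: "proj f = \<zero>\<^bsub>A\<^esub> \<longleftrightarrow> f \<in> J"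
  using proj_eq_iff[of f 0] by (simp add: proj_zero)

lemma proj_pow: "proj f [^]\<^bsub>A\<^esub> (k::nat) = proj (f ^ k)"
proof -
  interpret A: cring A by (rule cring_A)
  show ?thesis by (induction k) (simp_all add: proj_one proj_mult[symmetric] mult.commute)
qed

definition preimage :: "'r set set \<Rightarrow> 'r set" where
  "preimage Q = {f. proj f \<in> Q}"

lemma is_ideal_preimage:
  assumes "ideal Q A" shows "is_ideal (preimage Q)"
proof -
  interpret Q: ideal Q A by fact
  show ?thesis
  proof (rule is_idealI)
    show "0 \<in> preimage Q" unfolding preimage_def using Q.zero_closed by (simp add: proj_zero)
    fix a b assume "a \<in> preimage Q" "b \<in> preimage Q"
    then show "a + b \<in> preimage Q" unfolding preimage_def using Q.a_closed by (simp add: proj_add)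
  next
    fix h a assume "a \<in> preimage Q"
    then show "h * a \<in> preimage Q"
      unfolding preimage_def using Q.I_l_closed[OF _ proj_closed] by (simp add: proj_mult)
  qed
qed

lemma J_le_preimage:
  assumes "ideal Q A" shows "J \<subseteq> preimage Q"
proof
  fix f assume "f \<in> J"
  then have "proj f = \<zero>\<^bsub>A\<^esub>" by (simp add: proj_eq_zero_iff)
  then show "f \<in> preimage Q"
    using additive_subgroup.zero_closed[OF ideal.axioms(1)[OF assms]] by (simp add: preimage_def)
qed

lemma image_preimage:
  assumes "ideal Q A" shows "proj ` preimage Q = Q"
  using ideal.Icarr[OF assms] unfolding preimage_def carrier_A by blast

lemma preimage_image:
  assumes "is_ideal K" "J \<subseteq> K" shows "preimage (proj ` K) = K"
proof
  show "preimage (proj ` K) \<subseteq> K"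
  proof
    fix f assume "f \<in> preimage (proj ` K)"
    then obtain g where g: "g \<in> K" "proj f = proj g" by (auto simp: preimage_def)
    then have "f - g \<in> K" using assms(2) by (auto simp: proj_eq_iff)
    then show "f \<in> K" using is_ideal_diff_iff[OF assms(1)] g(1) by blast
  qed
qed (auto simp: preimage_def)

lemma ideal_image:
  assumes "is_ideal K" shows "ideal (proj ` K) A"
proof -
  interpret R: cring RT by (rule cring_ring_of_type_algebra)
  show ?thesis
    by (rule R.ring_ideal_imp_quot_ideal) (simp_all add: ideal_ring_of_type_algebra J assms)
qed

text \<open>The preimages in the type of the prime ideals of the quotient.\<close>

definition is_prime :: "'r set \<Rightarrow> bool" where
  "is_prime P \<longleftrightarrow> is_ideal P \<and> J \<subseteq> P \<and> 1 \<notin> P \<and> (\<forall>f g. f * g \<in> P \<longrightarrow> f \<in> P \<or> g \<in> P)"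

lemma one_in_preimage:
  assumes "ideal Q A" shows "1 \<in> preimage Q \<longleftrightarrow> Q = carrier A"
proof
  assume "1 \<in> preimage Q"
  then have "\<one>\<^bsub>A\<^esub> \<in> Q" by (simp add: preimage_def proj_one)
  then show "Q = carrier A" by (rule ideal.one_imp_carrier[OF assms])
qed (simp add: preimage_def proj_closed)

lemma is_prime_preimage:
  assumes "primeideal P A" shows "is_prime (preimage P)"
proof -
  interpret P: primeideal P A by fact
  have "f \<in> preimage P \<or> g \<in> preimage P" if "f * g \<in> preimage P" for f g
  proof -
    have "proj f \<otimes>\<^bsub>A\<^esub> proj g \<in> P" using that by (simp add: preimage_def proj_mult)
    then have "proj f \<in> P \<or> proj g \<in> P" by (rule P.I_prime[OF proj_closed proj_closed])
    then show ?thesis by (simp add: preimage_def)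
  qed
  then show ?thesis
    unfolding is_prime_def
    using is_ideal_preimage[OF P.is_ideal] J_le_preimage[OF P.is_ideal] one_in_preimage[OF P.is_ideal] P.I_notcarr
    by blast
qed

lemma primeideal_image:
  assumes "is_prime P" shows "primeideal (proj ` P) A"
proof -
  have P: "is_ideal P" "J \<subseteq> P" "1 \<notin> P" using assms unfolding is_prime_def by blast+
  note pre = preimage_image[OF P(1,2)]
  show ?thesis
  proof (rule primeidealI[OF ideal_image[OF P(1)] cring_A])
    show "carrier A \<noteq> proj ` P" using one_in_preimage[OF ideal_image[OF P(1)]] P(3) unfolding pre by blast
    fix x y assume xy: "x \<in> carrier A" "y \<in> carrier A" "x \<otimes>\<^bsub>A\<^esub> y \<in> proj ` P"
    obtain f where f: "x = proj f" using xy(1) unfolding carrier_A by blast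
    obtain g where g: "y = proj g" using xy(2) unfolding carrier_A by blast
    have "f * g \<in> preimage (proj ` P)" using xy(3) by (simp add: preimage_def f g proj_mult)
    then have "f * g \<in> P" unfolding pre .
    then have "f \<in> P \<or> g \<in> P" using assms unfolding is_prime_def by blast
    then show "x \<in> proj ` P \<or> y \<in> proj ` P" unfolding f g by blast
  qed
qed

lemma maximalideal_image:
  assumes "is_ideal P" "J \<subseteq> P" "1 \<notin> P" and max: "\<And>K. \<lbrakk>is_ideal K; P \<subset> K\<rbrakk> \<Longrightarrow> 1 \<in> K"
  shows "maximalideal (proj ` P) A"
proof (rule maximalidealI[OF ideal_image[OF assms(1)]])
  note pre = preimage_image[OF assms(1,2)]
  show "carrier A \<noteq> proj ` P" using one_in_preimage[OF ideal_image[OF assms(1)]] assms(3) unfolding pre by blast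
  fix Q assume Q: "ideal Q A" "proj ` P \<subseteq> Q"
  have "P \<subseteq> preimage Q" using Q(2) unfolding preimage_def by blast
  then consider "P = preimage Q" | "P \<subset> preimage Q" by blast
  then show "Q = proj ` P \<or> Q = carrier A"
  proof cases
    case 1 then show ?thesis using image_preimage[OF Q(1)] by simp
  next
    case 2 then show ?thesis using max[OF is_ideal_preimage[OF Q(1)]] one_in_preimage[OF Q(1)] by blast
  qed
qed

lemma noetherian_A:
  assumes fg: "\<And>K. \<lbrakk>is_ideal K; J \<subseteq> K\<rbrakk> \<Longrightarrow> \<exists>G. finite G \<and> G \<subseteq> K \<and> K \<subseteq> Idl\<^bsub>RT\<^esub> (G \<union> J)"
  shows "noetherian_ring A"
proof -
  interpret A: cring A by (rule cring_A)
  show ?thesis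
  proof (rule A.noetherian_ringI)
    fix Q assume Q: "ideal Q A"
    obtain G where G: "finite G" "G \<subseteq> preimage Q" "preimage Q \<subseteq> Idl\<^bsub>RT\<^esub> (G \<union> J)"
      using fg[OF is_ideal_preimage[OF Q] J_le_preimage[OF Q]] by blast
    have sub: "proj ` G \<subseteq> carrier A" using proj_closed by blast
    let ?I = "Idl\<^bsub>A\<^esub> (proj ` G)"
    have I: "ideal ?I A" by (rule A.genideal_ideal[OF sub])
    have "proj ` G \<subseteq> Q" using G(2) unfolding preimage_def by blast
    then have 1: "?I \<subseteq> Q" by (rule A.genideal_minimal[OF Q])
    have "G \<subseteq> preimage ?I" using A.genideal_self[OF sub] unfolding preimage_def by blast
    then have "Idl\<^bsub>RT\<^esub> (G \<union> J) \<subseteq> preimage ?I"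
      using J_le_preimage[OF I] by (intro Idl_least[OF is_ideal_preimage[OF I]]) blast
    then have "preimage Q \<subseteq> preimage ?I" using G(3) by blast
    then have "proj ` preimage Q \<subseteq> proj ` preimage ?I" by (rule image_mono)
    then have "Q \<subseteq> ?I" unfolding image_preimage[OF Q] image_preimage[OF I] .
    with 1 have "Q = ?I" by (rule equalityI[rotated])
    then show "\<exists>B\<subseteq>carrier A. finite B \<and> Q = Idl\<^bsub>A\<^esub> B" using sub finite_imageI[OF G(1)] by blast
  qed
qed

text \<open>The criterion \<open>cohen_macaulay_dim_one\<close> for a quotient, stated for ideals of the type that contain \<open>J\<close>. A proper ideal
  strictly above \<open>N\<close> shows that \<open>N\<close> is not maximal, so that every maximal ideal is strictly above \<open>N\<close>.\<close>

theorem quotient_cohen_macaulayI: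
  assumes fg: "\<And>K. \<lbrakk>is_ideal K; J \<subseteq> K\<rbrakk> \<Longrightarrow> \<exists>G. finite G \<and> G \<subseteq> K \<and> K \<subseteq> Idl\<^bsub>RT\<^esub> (G \<union> J)"
    and N: "is_prime N" and nil: "\<And>f. f \<in> N \<Longrightarrow> \<exists>k::nat. f ^ k \<in> J"
    and N_not_max: "is_ideal K" "N \<subset> K" "1 \<notin> K"
    and dim: "\<And>P K. \<lbrakk>is_prime P; N \<subset> P; is_ideal K; P \<subset> K\<rbrakk> \<Longrightarrow> 1 \<in> K"
    and nzd: "\<And>P. \<lbrakk>is_prime P; N \<subset> P\<rbrakk> \<Longrightarrow> \<exists>f\<in>P. f \<notin> N \<and> (\<forall>g. f * g \<in> J \<longrightarrow> g \<in> J)"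
  shows "cohen_macaulay A"
proof -
  interpret A: cring A by (rule cring_A)
  have NI: "is_ideal N" "J \<subseteq> N" using N unfolding is_prime_def by blast+
  have N_le: "N \<subseteq> P" if P: "is_prime P" for P
  proof
    fix f assume "f \<in> N"
    then obtain k :: nat where k: "f ^ k \<in> J" using nil by blast
    have "f ^ j \<in> P \<Longrightarrow> f \<in> P" for j :: nat
      using P by (induction j) (auto simp: is_prime_def)
    then show "f \<in> P" using k P unfolding is_prime_def by blast
  qed
  show ?thesis
  proof (rule A.cohen_macaulay_dim_one[OF noetherian_A[OF fg] primeideal_image[OF N]])
    fix x assume "x \<in> proj ` N"
    then obtain f where f: "f \<in> N" "x = proj f" by blast
    obtain k :: nat where "f ^ k \<in> J" using nil[OF f(1)] by blast
    then show "\<exists>k::nat. x [^]\<^bsub>A\<^esub> k = \<zero>\<^bsub>A\<^esub>" unfolding f(2) proj_pow proj_eq_zero_iff by blast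
  next
    fix P assume P: "primeideal P A" "P \<noteq> proj ` N"
    note pP = is_prime_preimage[OF P(1)]
    have PI: "ideal P A" using P(1) by (rule primeideal.axioms(1))
    have "preimage P \<noteq> N" using P(2) image_preimage[OF PI] by blast
    then have "N \<subset> preimage P" using N_le[OF pP] by blast
    then have "maximalideal (proj ` preimage P) A"
      using pP dim[OF pP] unfolding is_prime_def by (intro maximalideal_image) blast+
    then show "maximalideal P A" unfolding image_preimage[OF PI] .
  next
    fix M assume M: "maximalideal M A"
    then have MP: "primeideal M A" by (rule A.maximalideal_prime)
    have MI: "ideal M A" using M by (rule maximalideal.axioms(1))
    note pM = is_prime_preimage[OF MP]
    have "preimage M \<noteq> N"
    proof
      assume e: "preimage M = N"
      have "M \<subseteq> proj ` K" using image_preimage[OF MI] N_not_max(2) unfolding e by blast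
      then have "proj ` K = M \<or> proj ` K = carrier A"
        using ideal.Icarr[OF ideal_image[OF N_not_max(1)]]
        by (intro maximalideal.I_maximal[OF M ideal_image[OF N_not_max(1)]]) blast+
      moreover have pre: "preimage (proj ` K) = K" by (rule preimage_image) (use N_not_max NI in blast)+
      moreover have "proj ` K \<noteq> carrier A"
        using one_in_preimage[OF ideal_image[OF N_not_max(1)]] N_not_max(3) unfolding pre by blast
      ultimately show False using e N_not_max(2) by auto
    qed
    then have "N \<subset> preimage M" using N_le[OF pM] by blast
    from nzd[OF pM this] obtain f where f: "f \<in> preimage M" "f \<notin> N" "\<And>g. f * g \<in> J \<Longrightarrow> g \<in> J" by blast
    show "\<exists>x\<in>M. x \<notin> proj ` N \<and> (\<forall>r\<in>carrier A. x \<otimes>\<^bsub>A\<^esub> r = \<zero>\<^bsub>A\<^esub> \<longrightarrow> r = \<zero>\<^bsub>A\<^esub>)"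
    proof (intro bexI conjI ballI impI)
      show "proj f \<in> M" using f(1) by (simp add: preimage_def)
      show "proj f \<notin> proj ` N" using f(2) preimage_image[OF NI] unfolding preimage_def by blast
      fix r assume r: "r \<in> carrier A" "proj f \<otimes>\<^bsub>A\<^esub> r = \<zero>\<^bsub>A\<^esub>"
      obtain g where g: "r = proj g" using r(1) unfolding carrier_A by blast
      have "f * g \<in> J" using r(2) unfolding g proj_mult[symmetric] proj_eq_zero_iff .
      then show "r = \<zero>\<^bsub>A\<^esub>" unfolding g proj_eq_zero_iff by (rule f(3))
    qed
  qed
qed

theorem quotient_not_cohen_macaulayI:
  assumes N: "is_prime N" and NM: "N \<subset> M"
    and M: "is_ideal M" "1 \<notin> M" "\<And>K. \<lbrakk>is_ideal K; M \<subset> K\<rbrakk> \<Longrightarrow> 1 \<in> K"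
    and g: "\<And>f. f \<in> M \<Longrightarrow> f * g \<in> J" "\<And>u. u \<notin> M \<Longrightarrow> u * g \<notin> J"
  shows "\<not> cohen_macaulay A"
proof -
  interpret A: cring A by (rule cring_A)
  have JN: "is_ideal N" "J \<subseteq> N" using N unfolding is_prime_def by blast+
  then have JM: "J \<subseteq> M" using NM by blast
  note pre = preimage_image[OF M(1) JM]
  have max: "maximalideal (proj ` M) A"
    by (rule maximalideal_image[OF M(1) JM M(2)]) (rule M(3))
  show ?thesis
  proof (rule A.not_cohen_macaulay_if_socle[OF primeideal_image[OF N] max])
    have "proj ` N \<noteq> proj ` M"
    proof
      assume "proj ` N = proj ` M"
      then have "preimage (proj ` N) = preimage (proj ` M)" by (simp only:)
      then show False using NM unfolding preimage_image[OF JN] pre by blast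
    qed
    then show "proj ` N \<subset> proj ` M" using NM by blast
    show "proj g \<in> carrier A" by (rule proj_closed)
    fix x assume "x \<in> proj ` M"
    then obtain f where f: "f \<in> M" "x = proj f" by blast
    show "x \<otimes>\<^bsub>A\<^esub> proj g = \<zero>\<^bsub>A\<^esub>" unfolding f(2) proj_mult[symmetric] proj_eq_zero_iff by (rule g(1)[OF f(1)])
  next
    fix x assume x: "x \<in> carrier A - proj ` M"
    then obtain u where u: "x = proj u" unfolding carrier_A by blast
    have "u \<notin> M" using x unfolding u by blast
    then show "x \<otimes>\<^bsub>A\<^esub> proj g \<noteq> \<zero>\<^bsub>A\<^esub>" unfolding u proj_mult[symmetric] proj_eq_zero_iff by (rule g(2))
  qed
qed

end

section \<open>The tangent cone as the kernel of a linear map\<close>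

lemma UNIV_4: "(UNIV :: 4 set) = {1, 2, 3, 4}"
proof (rule sym, rule card_subset_eq)
  show "card {1, 2, 3, 4 :: 4} = card (UNIV :: 4 set)" by simp
qed simp_all

lemma sum_4: "(\<Sum>i\<in>UNIV. f i) = f (1::4) + f 2 + f 3 + (f 4 :: 'a::comm_monoid_add)"
  unfolding UNIV_4 by (simp add: ac_simps)

lemma prod_4: "(\<Prod>i\<in>UNIV. f i) = f (1::4) * f 2 * f 3 * (f 4 :: 'a::comm_monoid_mult)"
  unfolding UNIV_4 by (simp add: ac_simps)

lemma exponent_eqI:
  fixes m m' :: "4 \<Rightarrow>\<^sub>0 nat"
  assumes "Poly_Mapping.lookup m 1 = Poly_Mapping.lookup m' 1" "Poly_Mapping.lookup m 2 = Poly_Mapping.lookup m' 2"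
    "Poly_Mapping.lookup m 3 = Poly_Mapping.lookup m' 3" "Poly_Mapping.lookup m 4 = Poly_Mapping.lookup m' 4"
  shows "m = m'"
proof (rule poly_mapping_eqI)
  fix i :: 4
  have "i \<in> {1, 2, 3, 4}" using UNIV_4 by blast
  then show "Poly_Mapping.lookup m i = Poly_Mapping.lookup m' i" using assms by auto
qed

lemma sum_single_lookup: "(\<Sum>m\<in>Poly_Mapping.keys f. Poly_Mapping.single m (Poly_Mapping.lookup f m)) = f"
proof (rule poly_mapping_eqI)
  fix k
  have "Poly_Mapping.lookup (\<Sum>m\<in>Poly_Mapping.keys f. Poly_Mapping.single m (Poly_Mapping.lookup f m)) k
      = (\<Sum>m\<in>Poly_Mapping.keys f. if m = k then Poly_Mapping.lookup f m else 0)"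
    by (simp add: lookup_sum lookup_single when_def)
  also have "\<dots> = Poly_Mapping.lookup f k" by (simp add: in_keys_iff)
  finally show "Poly_Mapping.lookup (\<Sum>m\<in>Poly_Mapping.keys f. Poly_Mapping.single m (Poly_Mapping.lookup f m)) k
      = Poly_Mapping.lookup f k" .
qed

lemma poly_mapping_induct_add [case_names single add]:
  fixes f :: "'m \<Rightarrow>\<^sub>0 'k::comm_monoid_add"
  assumes single: "\<And>m c. P (Poly_Mapping.single m c)"
    and add: "\<And>f g. P f \<Longrightarrow> P g \<Longrightarrow> P (f + g)"
  shows "P f"
proof -
  have zero: "P 0" using single[of undefined 0] by simp
  have "P (\<Sum>m\<in>A. Poly_Mapping.single m (h m))" if "finite A" for A and h :: "'m \<Rightarrow> 'k"
    using that by (induction A rule: finite_induct) (simp_all add: zero single add)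
  from this[of "Poly_Mapping.keys f" "Poly_Mapping.lookup f"] show ?thesis by (simp add: sum_single_lookup)
qed

text \<open>The linear extension of a map that is given on monomials. All linear maps on polynomials in four variables
  that occur below have values in \<open>K[t]\<close> and are of this form.\<close>

definition linext :: "('m \<Rightarrow> 'k poly) \<Rightarrow> ('m \<Rightarrow>\<^sub>0 'k::field) \<Rightarrow> 'k poly" where
  "linext \<phi> f = (\<Sum>m\<in>Poly_Mapping.keys f. smult (Poly_Mapping.lookup f m) (\<phi> m))"

lemma linext_superset:
  assumes "finite A" "Poly_Mapping.keys f \<subseteq> A"
  shows "linext \<phi> f = (\<Sum>m\<in>A. smult (Poly_Mapping.lookup f m) (\<phi> m))"
  unfolding linext_def by (rule sum.mono_neutral_left) (use assms in \<open>auto simp: in_keys_iff\<close>)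

lemma linext_single [simp]: "linext \<phi> (Poly_Mapping.single m c) = smult c (\<phi> m)"
  by (subst linext_superset[of "{m}"]) simp_all

lemma linext_add: "linext \<phi> (f + g) = linext \<phi> f + linext \<phi> g"
proof -
  let ?A = "Poly_Mapping.keys f \<union> Poly_Mapping.keys g"
  have "finite ?A" "Poly_Mapping.keys (f + g) \<subseteq> ?A" using keys_add[of f g] by auto
  then have "linext \<phi> (f + g) = (\<Sum>m\<in>?A. smult (Poly_Mapping.lookup (f + g) m) (\<phi> m))" by (rule linext_superset)
  also have "\<dots> = (\<Sum>m\<in>?A. smult (Poly_Mapping.lookup f m) (\<phi> m)) + (\<Sum>m\<in>?A. smult (Poly_Mapping.lookup g m) (\<phi> m))"
    by (simp add: lookup_add smult_add_left sum.distrib)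
  also have "\<dots> = linext \<phi> f + linext \<phi> g"
    using linext_superset[of ?A f \<phi>] linext_superset[of ?A g \<phi>] by simp
  finally show ?thesis .
qed

lemma linext_zero [simp]: "linext \<phi> 0 = 0"
  by (simp add: linext_def)

lemma linext_diff: "linext \<phi> (f - g) = linext \<phi> f - linext \<phi> g"
  using linext_add[of \<phi> "f - g" g] by simp

lemma linext_sum: "linext \<phi> (sum h A) = (\<Sum>x\<in>A. linext \<phi> (h x))"
  by (induction A rule: infinite_finite_induct) (simp_all add: linext_add)

lemma linext_scale: "linext (\<lambda>m. p * \<phi> m) f = p * linext \<phi> f"
  by (simp add: linext_def sum_distrib_left)

lemma linext_mult_single:
  fixes f :: "('m::monoid_add) \<Rightarrow>\<^sub>0 'k::field"
  shows "linext \<phi> (Poly_Mapping.single a c * f) = smult c (linext (\<lambda>m. \<phi> (a + m)) f)"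
  by (induction f rule: poly_mapping_induct_add) (simp_all add: mult_single linext_add distrib_left smult_add_right)

lemma linext_mult:
  fixes f g :: "('m::monoid_add) \<Rightarrow>\<^sub>0 'k::field"
  assumes "\<And>a b. \<phi> (a + b) = \<phi> a * \<phi> b"
  shows "linext \<phi> (f * g) = linext \<phi> f * linext \<phi> g"
proof (induction f rule: poly_mapping_induct_add)
  case (single m c)
  show ?case by (simp add: linext_mult_single assms linext_scale)
qed (simp add: linext_add distrib_right)

lemma coeff_linext: "coeff (linext \<phi> f) j = (\<Sum>m\<in>Poly_Mapping.keys f. Poly_Mapping.lookup f m * coeff (\<phi> m) j)"
  by (simp add: linext_def coeff_sum)

text \<open>Closure under multiplication by monomials is enough for a kernel to be an ideal.\<close>

lemma is_ideal_kernel_linext: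
  fixes \<phi> :: "('m::comm_monoid_add) \<Rightarrow> 'k::field poly"
  assumes "\<And>a f. linext \<phi> f = 0 \<Longrightarrow> linext (\<lambda>m. \<phi> (a + m)) f = 0"
  shows "is_ideal {f. linext \<phi> f = 0}"
proof (rule is_idealI)
  fix h f assume "f \<in> {f. linext \<phi> f = 0}"
  then have "linext \<phi> f = 0" by blast
  from assms[OF this] have "linext \<phi> (h * f) = 0"
    by (induction h rule: poly_mapping_induct_add) (simp_all add: linext_mult_single linext_add distrib_right)
  then show "h * f \<in> {f. linext \<phi> f = 0}" by blast
qed (simp_all add: linext_add)

abbreviation mon :: "(4 \<Rightarrow>\<^sub>0 nat) \<Rightarrow> 'k::field poly4" where
  "mon m \<equiv> Poly_Mapping.single m 1"

definition weight :: "(4 \<Rightarrow> nat) \<Rightarrow> (4 \<Rightarrow>\<^sub>0 nat) \<Rightarrow> nat" where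
  "weight n m = (\<Sum>i\<in>UNIV. Poly_Mapping.lookup m i * n i)"

lemma weight_add: "weight n (a + b) = weight n a + weight n b"
  by (simp add: weight_def lookup_add algebra_simps sum.distrib)

lemma mono_degree_add: "mono_degree (a + b) = mono_degree a + mono_degree b"
  by (simp add: mono_degree_def lookup_add sum.distrib)

lemma weight_single: "weight n (Poly_Mapping.single i k) = k * n i"
  by (simp add: weight_def lookup_single when_def if_distrib[of "\<lambda>x. x * _"] cong: if_cong)

lemma mono_degree_single: "mono_degree (Poly_Mapping.single i k) = k"
  by (simp add: mono_degree_def lookup_single when_def)

lemma Var_power: "(Var i :: 'k::field poly4) ^ k = mon (Poly_Mapping.single i k)"
proof (induction k)
  case 0 then show ?case by simp
next
  case (Suc k)
  have "(Var i :: 'k poly4) ^ Suc k = mon (Poly_Mapping.single i 1) * mon (Poly_Mapping.single i k)"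
    unfolding power_Suc Suc by (simp only: Var_def)
  also have "\<dots> = mon (Poly_Mapping.single i (Suc k))"
    by (simp add: mult_single flip: single_add)
  finally show ?case .
qed

lemma mult_mon: "(mon a :: 'k::field poly4) * mon b = mon (a + b)"
  by (simp add: mult_single)

lemma curve_hom_eq: "curve_hom n f = linext (\<lambda>m. monom 1 (weight n m)) f"
proof -
  have "(\<Prod>i\<in>UNIV. (Polynomial.monom 1 (n i) :: 'a poly) ^ Poly_Mapping.lookup m i) = monom 1 (weight n m)" for m
    unfolding weight_def prod_4 sum_4 by (simp add: monom_power mult_monom mult.commute add_ac)
  then show ?thesis unfolding curve_hom_def linext_def by simp
qed

lemma curve_ideal_iff: "f \<in> curve_ideal n \<longleftrightarrow> linext (\<lambda>m. monom 1 (weight n m)) f = 0"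
  by (simp add: curve_ideal_def curve_hom_eq)

definition maxdeg :: "(4 \<Rightarrow> nat) \<Rightarrow> (4 \<Rightarrow>\<^sub>0 nat) \<Rightarrow> bool" where
  "maxdeg n m \<longleftrightarrow> (\<forall>v. weight n v = weight n m \<longrightarrow> mono_degree v \<le> mono_degree m)"

text \<open>The linear extension of this map is the projection from the polynomial ring to the tangent cone, when the
  basis element of weight \<open>s\<close> is written as \<open>t ^ s\<close>.\<close>

definition cone_val :: "(4 \<Rightarrow> nat) \<Rightarrow> (4 \<Rightarrow>\<^sub>0 nat) \<Rightarrow> 'k::field poly" where
  "cone_val n m = (if maxdeg n m then monom 1 (weight n m) else 0)"

text \<open>A larger monomial of the same weight could be substituted for the factor \<open>m\<close>.\<close>

lemma maxdeg_right:
  assumes "maxdeg n (a + m)" shows "maxdeg n m"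
  unfolding maxdeg_def
proof (intro allI impI)
  fix v assume "weight n v = weight n m"
  then have "weight n (a + v) = weight n (a + m)" by (simp add: weight_add)
  then have "mono_degree (a + v) \<le> mono_degree (a + m)" using assms unfolding maxdeg_def by blast
  then show "mono_degree v \<le> mono_degree m" by (simp add: mono_degree_add)
qed

lemma maxdeg_same:
  assumes "maxdeg n m" "maxdeg n m'" "weight n m = weight n m'"
  shows "mono_degree m = mono_degree m'"
  using assms unfolding maxdeg_def by (metis order_antisym)

lemma maxdeg_transfer:
  assumes "maxdeg n m" "weight n m' = weight n m" "mono_degree m \<le> mono_degree m'"
  shows "maxdeg n m'"
  using assms unfolding maxdeg_def by (metis order_trans)

text \<open>Multiplication by the monomial \<open>a\<close> shifts weights, and whether a shifted basis element survives depends only on its weight: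
  all \<open>maxdeg\<close> monomials of one weight have the same degree. So this multiplication is well defined on the values of
  the linear map, which makes the kernel an ideal.\<close>

lemma coeff_linext_cone_shift:
  "coeff (linext (\<lambda>m. cone_val n (a + m)) f) s =
     (if weight n a \<le> s \<and> (\<exists>m. weight n m = s - weight n a \<and> maxdeg n (a + m))
      then coeff (linext (cone_val n) f) (s - weight n a) else 0)"
proof (induction f rule: poly_mapping_induct_add)
  case (single m c)
  have "maxdeg n (a + m)" if "maxdeg n m" "maxdeg n (a + m')" "weight n m' = weight n m" for m'
  proof (rule maxdeg_transfer[OF that(2)])
    show "weight n (a + m) = weight n (a + m')" using that(3) by (simp add: weight_add)
    show "mono_degree (a + m') \<le> mono_degree (a + m)"
      using maxdeg_same[OF that(1) maxdeg_right[OF that(2)]] that(3) by (simp add: mono_degree_add)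
  qed
  note same = this
  show ?case
  proof (cases "s = weight n (a + m)")
    case True
    then have s: "s - weight n a = weight n m" "weight n a \<le> s" by (simp_all add: weight_add)
    show ?thesis
    proof (cases "maxdeg n (a + m)")
      case True
      then show ?thesis using maxdeg_right[OF True] s
        by (auto simp: cone_val_def weight_add)
    next
      case False
      then have "\<not> (maxdeg n m \<and> (\<exists>m'. weight n m' = weight n m \<and> maxdeg n (a + m')))" using same by blast
      then show ?thesis using False unfolding s(1) by (auto simp: cone_val_def)
    qed
  next
    case False
    then have "s - weight n a \<noteq> weight n m" if "weight n a \<le> s" using that by (auto simp: weight_add)
    then show ?thesis using False by (auto simp: cone_val_def)
  qed
next
  case (add f g)
  show ?case unfolding linext_add coeff_add add
    by (cases "weight n a \<le> s \<and> (\<exists>m. weight n m = s - weight n a \<and> maxdeg n (a + m))")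
      (simp_all only: simp_thms if_True if_False add_0_left)
qed

lemma is_ideal_cone_kernel: "is_ideal {f :: 'k::field poly4. linext (cone_val n) f = 0}"
proof (rule is_ideal_kernel_linext)
  fix a and f :: "'k poly4" assume "linext (cone_val n) f = 0"
  then show "linext (\<lambda>m. cone_val n (a + m)) f = 0"
    by (intro poly_eqI) (simp add: coeff_linext_cone_shift)
qed

lemma lookup_least_form:
  "Poly_Mapping.lookup (least_form f) m =
     (if m \<in> Poly_Mapping.keys f \<and> mono_degree m = Min (mono_degree ` Poly_Mapping.keys f)
      then Poly_Mapping.lookup f m else 0)"
proof -
  let ?K = "{m \<in> Poly_Mapping.keys f. mono_degree m = Min (mono_degree ` Poly_Mapping.keys f)}"
  have "Poly_Mapping.lookup (least_form f) m = (\<Sum>k\<in>?K. if k = m then Poly_Mapping.lookup f k else 0)"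
    by (simp add: least_form_def lookup_sum lookup_single when_def)
  also have "\<dots> = (if m \<in> ?K then Poly_Mapping.lookup f m else 0)"
    by (subst sum.delta) simp_all
  finally show ?thesis by simp
qed

text \<open>If the least degree of \<open>f\<close> equals the largest degree for the weight \<open>s\<close>, all terms of \<open>f\<close> of weight \<open>s\<close> belong
  to the least form, and their coefficients add up to zero because \<open>f\<close> vanishes on the curve. Otherwise the least form
  has no \<open>maxdeg\<close> term of weight \<open>s\<close>.\<close>

lemma least_form_in_kernel:
  assumes "f \<in> curve_ideal n" shows "linext (cone_val n) (least_form f) = 0"
proof (rule poly_eqI)
  fix s
  define K where "K = Poly_Mapping.keys f"
  define d where "d = Min (mono_degree ` K)"
  have keys: "Poly_Mapping.keys (least_form f) \<subseteq> K"
    by (auto simp: in_keys_iff lookup_least_form K_def)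
  have fin: "finite K" by (simp add: K_def)
  have "coeff (linext (cone_val n) (least_form f)) s =
      (\<Sum>m\<in>K. coeff (smult (Poly_Mapping.lookup (least_form f) m) (cone_val n m)) s)"
    unfolding linext_superset[OF fin keys] by (simp add: coeff_sum)
  also have "\<dots> = (\<Sum>m\<in>K. if mono_degree m = d \<and> maxdeg n m \<and> weight n m = s then Poly_Mapping.lookup f m else 0)"
    by (rule sum.cong) (auto simp: lookup_least_form cone_val_def K_def[symmetric] d_def[symmetric])
  also have "\<dots> = 0"
  proof (cases "\<exists>m0\<in>K. mono_degree m0 = d \<and> maxdeg n m0 \<and> weight n m0 = s")
    case True
    then obtain m0 where m0: "m0 \<in> K" "mono_degree m0 = d" "maxdeg n m0" "weight n m0 = s" by blast
    have all: "mono_degree m = d \<and> maxdeg n m" if "m \<in> K" "weight n m = s" for m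
    proof -
      have "d \<le> mono_degree m" unfolding d_def using that(1) fin by simp
      moreover have "mono_degree m \<le> d" using m0 that(2) unfolding maxdeg_def by metis
      ultimately show ?thesis using maxdeg_transfer[OF m0(3), of m] m0 that by simp
    qed
    have "(\<Sum>m\<in>K. if mono_degree m = d \<and> maxdeg n m \<and> weight n m = s then Poly_Mapping.lookup f m else 0) =
        (\<Sum>m\<in>K. Poly_Mapping.lookup f m * coeff (monom 1 (weight n m)) s)"
      by (rule sum.cong) (use all in auto)
    also have "\<dots> = coeff (linext (\<lambda>m. monom 1 (weight n m)) f) s"
      unfolding coeff_linext K_def ..
    also have "\<dots> = 0" using assms by (simp add: curve_ideal_iff)
    finally show ?thesis .
  next
    case False
    then show ?thesis by (intro sum.neutral) auto
  qed
  finally show "coeff (linext (cone_val n) (least_form f)) s = coeff 0 s" by simp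
qed

lemma keys_binomial:
  fixes c :: "'k::field"
  assumes "m \<noteq> v" "c \<noteq> 0"
  shows "Poly_Mapping.keys (Poly_Mapping.single m c - Poly_Mapping.single v c) = {m, v}"
  using assms by (auto simp: in_keys_iff lookup_minus lookup_single when_def split: if_splits)

lemma least_form_binomial:
  assumes "m \<noteq> v" "c \<noteq> 0" "mono_degree m \<le> mono_degree v"
  shows "least_form (Poly_Mapping.single m c - Poly_Mapping.single v c) =
     (if mono_degree m = mono_degree v then Poly_Mapping.single m c - Poly_Mapping.single v c else Poly_Mapping.single m c)"
proof (rule poly_mapping_eqI)
  fix k
  have "Min (mono_degree ` {m, v}) = mono_degree m" using assms(3) by simp
  then show "Poly_Mapping.lookup (least_form (Poly_Mapping.single m c - Poly_Mapping.single v c)) k =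
    Poly_Mapping.lookup (if mono_degree m = mono_degree v then Poly_Mapping.single m c - Poly_Mapping.single v c else Poly_Mapping.single m c) k"
    using assms unfolding lookup_least_form keys_binomial[OF assms(1,2)]
    by (auto simp: lookup_minus lookup_single when_def)
qed

lemma binomial_in_curve_ideal:
  "weight n m = weight n v \<Longrightarrow> Poly_Mapping.single m c - Poly_Mapping.single v c \<in> curve_ideal n"
  by (simp add: curve_ideal_iff linext_diff)

lemma least_form_in_cone: "f \<in> curve_ideal n \<Longrightarrow> f \<noteq> 0 \<Longrightarrow> least_form f \<in> tangent_cone_ideal n"
  unfolding tangent_cone_ideal_def by (rule subsetD[OF Idl_contains]) blast

lemma is_ideal_tangent_cone: "is_ideal (tangent_cone_ideal n)"
  unfolding tangent_cone_ideal_def by (rule is_ideal_Idl)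

lemma single_in_cone:
  assumes "\<not> maxdeg n m" shows "Poly_Mapping.single m c \<in> tangent_cone_ideal n"
proof (cases "c = 0")
  case True then show ?thesis using is_ideal_zero[OF is_ideal_tangent_cone] by simp
next
  case False
  obtain v where v: "weight n v = weight n m" "mono_degree m < mono_degree v"
    using assms unfolding maxdeg_def by (auto simp: not_le)
  then have "m \<noteq> v" by auto
  have "Poly_Mapping.single m c - Poly_Mapping.single v c \<noteq> 0"
    using keys_binomial[OF \<open>m \<noteq> v\<close> False] by auto
  from least_form_in_cone[OF binomial_in_curve_ideal[OF v(1)[symmetric]] this]
  show ?thesis using least_form_binomial[OF \<open>m \<noteq> v\<close> False] v(2) by simp
qed

lemma binomial_in_cone:
  assumes "weight n m = weight n v" "mono_degree m = mono_degree v"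
  shows "Poly_Mapping.single m c - Poly_Mapping.single v c \<in> tangent_cone_ideal n"
proof (cases "c = 0 \<or> m = v")
  case True then show ?thesis using is_ideal_zero[OF is_ideal_tangent_cone] by auto
next
  case False
  then have F: "c \<noteq> 0" "m \<noteq> v" by auto
  have "Poly_Mapping.single m c - Poly_Mapping.single v c \<noteq> 0"
    using keys_binomial[OF F(2,1)] by auto
  from least_form_in_cone[OF binomial_in_curve_ideal[OF assms(1)] this]
  show ?thesis using least_form_binomial[OF F(2,1)] assms(2) by simp
qed

text \<open>Modulo the tangent cone ideal, a polynomial is congruent to the combination of chosen \<open>maxdeg\<close>
  representatives, one for each weight, whose coefficients are those of its image under the linear map.\<close>

theorem tangent_cone_ideal_eq_kernel:
  "tangent_cone_ideal n = {f :: 'k::field poly4. linext (cone_val n) f = 0}"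
proof
  show "tangent_cone_ideal n \<subseteq> {f :: 'k poly4. linext (cone_val n) f = 0}"
    unfolding tangent_cone_ideal_def
    by (rule Idl_least[OF is_ideal_cone_kernel]) (use least_form_in_kernel in blast)
  show "{f :: 'k poly4. linext (cone_val n) f = 0} \<subseteq> tangent_cone_ideal n"
  proof
    fix f :: "'k poly4" assume "f \<in> {f. linext (cone_val n) f = 0}"
    then have f: "linext (cone_val n) f = 0" by blast
    define \<rho> where "\<rho> s = (SOME m. maxdeg n m \<and> weight n m = s)" for s
    define N where "N = Max (weight n ` Poly_Mapping.keys f)"
    define M where "M p = (\<Sum>i\<le>N. Poly_Mapping.single (\<rho> i) (coeff p i))" for p :: "'k poly"
    have M_sum: "M (sum h A) = (\<Sum>x\<in>A. M (h x))" for h and A :: "(4 \<Rightarrow>\<^sub>0 nat) set"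
      by (induction A rule: infinite_finite_induct) (simp_all add: M_def single_add sum.distrib)
    have "Poly_Mapping.single m c - M (linext (cone_val n) (Poly_Mapping.single m c)) \<in> tangent_cone_ideal n"
      if m: "m \<in> Poly_Mapping.keys f" for m c
    proof (cases "maxdeg n m")
      case True
      have \<rho>: "maxdeg n (\<rho> (weight n m)) \<and> weight n (\<rho> (weight n m)) = weight n m"
        unfolding \<rho>_def by (rule someI[of _ m]) (use True in simp)
      have "weight n m \<le> N" unfolding N_def using m by simp
      then have "M (linext (cone_val n) (Poly_Mapping.single m c)) = Poly_Mapping.single (\<rho> (weight n m)) c"
        using True by (simp add: M_def cone_val_def smult_monom if_distrib[of "Poly_Mapping.single _"] cong: if_cong)
      then show ?thesis using \<rho> maxdeg_same[OF True] by (simp add: binomial_in_cone)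
    next
      case False
      then show ?thesis using single_in_cone[OF False] by (simp add: M_def cone_val_def)
    qed
    then have "(\<Sum>m\<in>Poly_Mapping.keys f. Poly_Mapping.single m (Poly_Mapping.lookup f m) -
        M (linext (cone_val n) (Poly_Mapping.single m (Poly_Mapping.lookup f m)))) \<in> tangent_cone_ideal n"
      by (intro is_ideal_sum[OF is_ideal_tangent_cone])
    also have "(\<Sum>m\<in>Poly_Mapping.keys f. Poly_Mapping.single m (Poly_Mapping.lookup f m) -
        M (linext (cone_val n) (Poly_Mapping.single m (Poly_Mapping.lookup f m)))) = f - M (linext (cone_val n) f)"
      unfolding sum_subtractf sum_single_lookup M_sum[symmetric] linext_sum[symmetric] ..
    also have "\<dots> = f" unfolding f by (simp add: M_def)
    finally show "f \<in> tangent_cone_ideal n" .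
  qed
qed

section \<open>Restriction to the first coordinate axis\<close>

text \<open>Setting \<open>x\<^sub>2\<close>, \<open>x\<^sub>3\<close> and \<open>x\<^sub>4\<close> to zero.\<close>

definition axis_val :: "(4 \<Rightarrow>\<^sub>0 nat) \<Rightarrow> 'k::field poly" where
  "axis_val m = (if Poly_Mapping.lookup m 2 = 0 \<and> Poly_Mapping.lookup m 3 = 0 \<and> Poly_Mapping.lookup m 4 = 0
     then monom 1 (Poly_Mapping.lookup m 1) else 0)"

definition to_axis :: "'k::field poly4 \<Rightarrow> 'k poly" where
  "to_axis = linext axis_val"

lemma to_axis_simps [simp]:
  "to_axis 0 = 0" "to_axis (f + g) = to_axis f + to_axis g" "to_axis (f - g) = to_axis f - to_axis g"
  "to_axis (f * g) = to_axis f * to_axis g" "to_axis (Poly_Mapping.single m c) = smult c (axis_val m)"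
  by (simp_all add: to_axis_def linext_add linext_diff) (rule linext_mult, auto simp: axis_val_def lookup_add mult_monom)

definition axis_poly :: "'k::field poly \<Rightarrow> 'k poly4" where
  "axis_poly p = poly (map_poly (Poly_Mapping.single 0) p) (Var 1)"

lemma axis_poly_0 [simp]: "axis_poly 0 = 0"
  by (simp add: axis_poly_def)

lemma axis_poly_pCons: "axis_poly (pCons c p) = Poly_Mapping.single 0 c + Var 1 * axis_poly p"
  by (simp add: axis_poly_def map_poly_pCons)

lemma axis_poly_add: "axis_poly (p + q) = axis_poly p + axis_poly q"
  by (induction p q rule: poly_induct2) (simp_all add: axis_poly_pCons single_add algebra_simps)

lemma axis_poly_smult: "axis_poly (smult c p) = Poly_Mapping.single 0 c * axis_poly p"
  by (induction p) (simp_all add: axis_poly_pCons mult_single algebra_simps)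

lemma axis_poly_mult: "axis_poly (p * q) = axis_poly p * axis_poly q"
proof (induction p)
  case (pCons a p)
  have "axis_poly (pCons 0 (p * q)) = Var 1 * (axis_poly p * axis_poly q)"
    using pCons by (simp add: axis_poly_pCons)
  then show ?case
    by (simp add: axis_poly_add axis_poly_smult axis_poly_pCons[of a p] algebra_simps)
qed simp

lemma axis_poly_1: "axis_poly 1 = 1"
  by (simp add: one_pCons axis_poly_pCons)

lemma axis_val_zero [simp]: "axis_val 0 = 1"
  by (simp add: axis_val_def one_pCons monom_0)

lemma monom_1_mult: "monom (1::'k::field) (Suc 0) * p = pCons 0 p"
  by (simp add: monom_Suc monom_0)

lemma to_axis_Var1 [simp]: "to_axis (Var 1) = monom 1 1"
  by (simp add: Var_def axis_val_def lookup_single when_def)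

lemma to_axis_axis_poly [simp]: "to_axis (axis_poly p) = p"
  by (induction p) (simp_all add: axis_poly_pCons monom_1_mult)

text \<open>Division with remainder by an element of least degree.\<close>

lemma is_ideal_principal:
  fixes L :: "'k::field poly set"
  assumes L: "is_ideal L"
  obtains c where "c \<in> L" "\<And>a. a \<in> L \<Longrightarrow> c dvd a"
proof (cases "L \<subseteq> {0}")
  case True
  then show ?thesis using that[of 0] is_ideal_zero[OF L] by auto
next
  case False
  then have "\<exists>c. c \<in> L \<and> c \<noteq> 0" by blast
  then obtain c where c: "c \<in> L \<and> c \<noteq> 0" and min: "\<And>a. a \<in> L \<and> a \<noteq> 0 \<Longrightarrow> degree c \<le> degree a"
    using ex_has_least_nat[of "\<lambda>c. c \<in> L \<and> c \<noteq> 0" _ degree] by blast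
  have "c dvd a" if "a \<in> L" for a
  proof -
    have "a mod c = a - (a div c) * c" by (simp add: minus_div_mult_eq_mod)
    then have "a mod c \<in> L" using is_ideal_diff[OF L that is_ideal_mult[OF L]] c by simp
    then have "\<not> degree (a mod c) < degree c \<or> a mod c = 0" using min[of "a mod c"] not_less by blast
    then have "a mod c = 0" using degree_mod_less[of c a] c by blast
    then show ?thesis by (simp add: mod_eq_0_iff_dvd)
  qed
  then show ?thesis using that[of c] c by blast
qed

lemma is_ideal_axis_poly_vimage:
  assumes "is_ideal P" shows "is_ideal {p. axis_poly p \<in> P}"
  by (rule is_idealI) (simp_all add: is_ideal_zero[OF assms] axis_poly_add is_ideal_add[OF assms] axis_poly_mult is_ideal_mult[OF assms])

definition strip :: "(4 \<Rightarrow>\<^sub>0 nat) \<Rightarrow> (4 \<Rightarrow>\<^sub>0 nat)" where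
  "strip m = Poly_Mapping.update 1 0 m"

lemma strip_shift: "strip (Poly_Mapping.single 1 1 + m) = strip m"
  by (rule poly_mapping_eqI) (auto simp: strip_def lookup_update lookup_add lookup_single when_def)

lemma strip_eqD: "strip m = strip m' \<Longrightarrow> Poly_Mapping.lookup m 1 = Poly_Mapping.lookup m' 1 \<Longrightarrow> m = m'"
  by (rule poly_mapping_eqI) (metis lookup_update strip_def)

text \<open>For a set \<open>E\<close> of monomials without \<open>x\<^sub>1\<close> this is the free \<open>K[x\<^sub>1]\<close>-module with basis \<open>E\<close>.\<close>

definition strip_span :: "(4 \<Rightarrow>\<^sub>0 nat) set \<Rightarrow> 'k::field poly4 set" where
  "strip_span E = {f. \<forall>m\<in>Poly_Mapping.keys f. strip m \<in> E}"

lemma strip_span_add: "f \<in> strip_span E \<Longrightarrow> g \<in> strip_span E \<Longrightarrow> f + g \<in> strip_span E"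
  unfolding strip_span_def using keys_add[of f g] by blast

lemma strip_span_diff: "f \<in> strip_span E \<Longrightarrow> g \<in> strip_span E \<Longrightarrow> f - g \<in> strip_span E"
  using strip_span_add[of f E "- g"]
  by (simp add: strip_span_def in_keys_iff)

lemma strip_span_scale: "f \<in> strip_span E \<Longrightarrow> Poly_Mapping.single 0 c * f \<in> strip_span E"
  unfolding strip_span_def using keys_mult[of "Poly_Mapping.single 0 c" f] by (auto split: if_splits)

lemma strip_span_Var1:
  assumes "f \<in> strip_span E" shows "Var 1 * f \<in> strip_span E"
  unfolding strip_span_def
proof (intro CollectI ballI)
  fix m assume "m \<in> Poly_Mapping.keys (Var 1 * f)"
  then have "m \<in> {a + b |a b. a \<in> Poly_Mapping.keys (Var 1 :: 'a poly4) \<and> b \<in> Poly_Mapping.keys f}"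
    using keys_mult by blast
  then obtain b where b: "m = Poly_Mapping.single 1 1 + b" "b \<in> Poly_Mapping.keys f"
    unfolding Var_def keys_single by (auto split: if_splits)
  then show "strip m \<in> E" using assms unfolding b(1) strip_shift strip_span_def by blast
qed

lemma strip_span_axis_poly: "f \<in> strip_span E \<Longrightarrow> axis_poly p * f \<in> strip_span E"
proof (induction p)
  case 0 then show ?case by (simp add: strip_span_def)
next
  case (pCons a p)
  have "axis_poly (pCons a p) * f = Poly_Mapping.single 0 a * f + Var 1 * (axis_poly p * f)"
    by (simp add: axis_poly_pCons algebra_simps)
  then show ?case using pCons by (simp add: strip_span_add strip_span_scale strip_span_Var1)
qed

text \<open>The linear extension is the coordinate in \<open>K[x\<^sub>1]\<close> at the basis element \<open>e\<close>.\<close>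

definition strip_val :: "(4 \<Rightarrow>\<^sub>0 nat) \<Rightarrow> (4 \<Rightarrow>\<^sub>0 nat) \<Rightarrow> 'k::field poly" where
  "strip_val e m = (if strip m = e then monom 1 (Poly_Mapping.lookup m 1) else 0)"

lemma linext_axis_poly_mult:
  assumes "\<And>m. \<phi> (Poly_Mapping.single 1 1 + m) = q * \<phi> m"
  shows "linext \<phi> (axis_poly p * f) = pcompose p q * linext \<phi> f"
proof (induction p)
  case (pCons a p)
  have "axis_poly (pCons a p) * f = Poly_Mapping.single 0 a * f + Var 1 * (axis_poly p * f)"
    by (simp add: axis_poly_pCons algebra_simps)
  moreover have "linext \<phi> (Var 1 * g) = q * linext \<phi> g" for g
    unfolding Var_def by (simp only: linext_mult_single assms linext_scale smult_1_left)
  moreover have "linext \<phi> (Poly_Mapping.single 0 a * f) = smult a (linext \<phi> f)"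
    by (simp add: linext_mult_single)
  ultimately have "linext \<phi> (axis_poly (pCons a p) * f) = smult a (linext \<phi> f) + q * (pcompose p q * linext \<phi> f)"
    using pCons.IH by (simp only: linext_add)
  then show ?case by (simp add: pcompose_pCons algebra_simps)
qed simp

lemma linext_strip_val_axis_poly: "linext (strip_val e) (axis_poly p * f) = p * linext (strip_val e) f"
proof -
  have "strip_val e (Poly_Mapping.single 1 1 + m) = monom 1 1 * strip_val e m" for m
    unfolding strip_val_def strip_shift by (simp add: lookup_add mult_monom)
  from linext_axis_poly_mult[of "strip_val e", OF this] have "linext (strip_val e) (axis_poly p * f) = pcompose p (monom 1 1) * linext (strip_val e) f" .
  moreover have "pcompose p (monom 1 1) = p"
    by (induction p) (simp_all add: pcompose_pCons monom_1_mult)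
  ultimately show ?thesis by simp
qed

lemma strip_span_insert_kernel:
  assumes f: "f \<in> strip_span (insert e E)" "linext (strip_val e) f = 0" shows "f \<in> strip_span E"
proof -
  have "strip m \<noteq> e" if m: "m \<in> Poly_Mapping.keys f" for m
  proof
    assume e: "strip m = e"
    have "coeff (linext (strip_val e) f) (Poly_Mapping.lookup m 1) =
        (\<Sum>m'\<in>Poly_Mapping.keys f. if m' = m then Poly_Mapping.lookup f m' else 0)"
      unfolding coeff_linext
      by (rule sum.cong) (use e strip_eqD in \<open>auto simp: strip_val_def\<close>)
    also have "\<dots> = Poly_Mapping.lookup f m" using m by simp
    finally show False using f(2) m by (simp add: in_keys_iff)
  qed
  then show ?thesis using f(1) unfolding strip_span_def by blast
qed

text \<open>Submodules of a finite free module over a principal ideal domain are finitely generated. In the step, the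
  coordinates at \<open>e\<close> of elements of \<open>K\<close> form a principal ideal; subtracting a multiple of an element with the generating coordinate
  leads back to the module without \<open>e\<close>.\<close>

lemma strip_span_noetherian:
  fixes K :: "'k::field poly4 set"
  assumes "finite E" and K: "is_ideal K"
  shows "\<exists>G. finite G \<and> G \<subseteq> K \<and> K \<inter> strip_span E \<subseteq> Idl\<^bsub>poly4_ring\<^esub> G"
  using assms(1)
proof (induction E rule: finite_induct)
  case empty
  have "f = 0" if "f \<in> strip_span {}" for f :: "'k poly4"
    using that by (simp add: strip_span_def)
  then have "K \<inter> strip_span {} \<subseteq> Idl\<^bsub>poly4_ring\<^esub> {}" using is_ideal_zero[OF is_ideal_Idl] by blast
  then show ?case by (intro exI[of _ "{}"]) simp
next
  case (insert e E)
  then obtain G where G: "finite G" "G \<subseteq> K" "K \<inter> strip_span E \<subseteq> Idl\<^bsub>poly4_ring\<^esub> G" by blast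
  define L where "L = linext (strip_val e) ` (K \<inter> strip_span (insert e E))"
  have "is_ideal L"
  proof (rule is_idealI)
    have "0 \<in> K \<inter> strip_span (insert e E)" using is_ideal_zero[OF K] by (simp add: strip_span_def)
    then show "0 \<in> L" unfolding L_def by (rule rev_image_eqI) simp
  next
    fix a b assume "a \<in> L" "b \<in> L"
    then obtain f g where "f \<in> K \<inter> strip_span (insert e E)" "a = linext (strip_val e) f"
      "g \<in> K \<inter> strip_span (insert e E)" "b = linext (strip_val e) g" unfolding L_def by blast
    then show "a + b \<in> L" unfolding L_def
      by (intro rev_image_eqI[of "f + g"]) (simp_all add: is_ideal_add[OF K] strip_span_add linext_add)
  next
    fix h a assume "a \<in> L"
    then obtain f where "f \<in> K \<inter> strip_span (insert e E)" "a = linext (strip_val e) f" unfolding L_def by blast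
    then show "h * a \<in> L" unfolding L_def
      by (intro rev_image_eqI[of "axis_poly h * f"]) (simp_all add: is_ideal_mult[OF K] strip_span_axis_poly linext_strip_val_axis_poly)
  qed
  then obtain c where c: "c \<in> L" "\<And>a. a \<in> L \<Longrightarrow> c dvd a" by (rule is_ideal_principal) blast
  then obtain g where g: "g \<in> K" "g \<in> strip_span (insert e E)" "c = linext (strip_val e) g" unfolding L_def by blast
  let ?I = "Idl\<^bsub>poly4_ring\<^esub> (insert g G)"
  have "f \<in> ?I" if f: "f \<in> K" "f \<in> strip_span (insert e E)" for f
  proof -
    have "linext (strip_val e) f \<in> L" unfolding L_def using f by blast
    then obtain p where p: "linext (strip_val e) f = c * p" using c(2) by (meson dvdE)
    let ?d = "f - axis_poly p * g"
    have "linext (strip_val e) ?d = 0"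
      by (simp only: linext_diff linext_strip_val_axis_poly p g(3)) (simp add: mult.commute)
    with strip_span_diff[OF f(2) strip_span_axis_poly[OF g(2)]] have "?d \<in> strip_span E"
      by (rule strip_span_insert_kernel)
    moreover have "?d \<in> K" by (intro is_ideal_diff[OF K] is_ideal_mult[OF K] f(1) g(1))
    ultimately have "?d \<in> Idl\<^bsub>poly4_ring\<^esub> G" using G(3) by blast
    moreover have "Idl\<^bsub>poly4_ring\<^esub> G \<subseteq> ?I"
      using Idl_contains[of "insert g G"] by (intro Idl_least[OF is_ideal_Idl]) blast
    ultimately have "?d \<in> ?I" by blast
    moreover have "g \<in> ?I" using Idl_contains[of "insert g G"] by blast
    then have "axis_poly p * g \<in> ?I" by (rule is_ideal_mult[OF is_ideal_Idl])
    ultimately have "?d + axis_poly p * g \<in> ?I" by (rule is_ideal_add[OF is_ideal_Idl])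
    then show ?thesis by simp
  qed
  then show ?case using G(1,2) g(1) by (intro exI[of _ "insert g G"]) blast
qed

lemma power_single:
  fixes c :: "'k::field"
  shows "\<exists>m'. (Poly_Mapping.single m c :: 'k poly4) ^ k = Poly_Mapping.single m' (c ^ k) \<and>
    (\<forall>i. Poly_Mapping.lookup m' i = k * Poly_Mapping.lookup m i)"
proof (induction k)
  case 0 then show ?case by (intro exI[of _ 0]) simp
next
  case (Suc k)
  then obtain m' where "(Poly_Mapping.single m c :: 'k poly4) ^ k = Poly_Mapping.single m' (c ^ k)"
    "\<forall>i. Poly_Mapping.lookup m' i = k * Poly_Mapping.lookup m i" by blast
  then show ?case by (intro exI[of _ "m + m'"]) (simp add: mult_single lookup_add)
qed

text \<open>In each term of the binomial expansion one of the two exponents is large enough.\<close>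

lemma is_ideal_radical_add:
  fixes J :: "'r::comm_ring_1 set"
  assumes J: "is_ideal J" and f: "f ^ i \<in> J" and g: "g ^ j \<in> J"
  shows "(f + g) ^ (i + j) \<in> J"
  unfolding binomial_ring
proof (rule is_ideal_sum[OF J])
  fix k assume "k \<in> {..i + j}"
  show "of_nat (i + j choose k) * f ^ k * g ^ (i + j - k) \<in> J"
  proof (cases "i \<le> k")
    case True
    then have "f ^ k = f ^ (k - i) * f ^ i" by (simp flip: power_add)
    then have "f ^ k \<in> J" using is_ideal_mult[OF J f] by simp
    then show ?thesis by (intro is_ideal_mult2[OF J] is_ideal_mult[OF J])
  next
    case False
    then have "i + j - k = (i - k) + j" by simp
    then have "g ^ (i + j - k) = g ^ (i - k) * g ^ j" by (simp add: power_add)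
    then have "g ^ (i + j - k) \<in> J" using is_ideal_mult[OF J g] by simp
    then show ?thesis by (rule is_ideal_mult[OF J])
  qed
qed

section \<open>Cohen-Macaulay tangent cones\<close>

lemma weight_4: "weight n m = Poly_Mapping.lookup m 1 * n 1 + Poly_Mapping.lookup m 2 * n 2 +
    Poly_Mapping.lookup m 3 * n 3 + Poly_Mapping.lookup m 4 * n 4"
  by (simp add: weight_def sum_4)

lemma mono_degree_4: "mono_degree m = Poly_Mapping.lookup m 1 + Poly_Mapping.lookup m 2 +
    Poly_Mapping.lookup m 3 + Poly_Mapping.lookup m 4"
  by (simp add: mono_degree_def sum_4)

lemma index_cases: "i = 1 \<or> i = 2 \<or> i = 3 \<or> i = (4 :: 4)"
  using UNIV_4 by blast

text \<open>Reading off single coefficients is what links the restriction to the axis with the support of a polynomial.\<close>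

lemma coeff_to_axis: "coeff (to_axis f) k = Poly_Mapping.lookup f (Poly_Mapping.single 1 k)"
proof -
  have val: "coeff (axis_val m) k = (if m = Poly_Mapping.single 1 k then 1 else (0 :: 'a))" for m
  proof (cases "m = Poly_Mapping.single 1 k")
    case True
    then show ?thesis by (simp add: axis_val_def lookup_single when_def)
  next
    case False
    then have "\<not> (Poly_Mapping.lookup m 1 = k \<and> Poly_Mapping.lookup m 2 = 0 \<and> Poly_Mapping.lookup m 3 = 0 \<and> Poly_Mapping.lookup m 4 = 0)"
      using exponent_eqI[of m "Poly_Mapping.single 1 k"] by (auto simp: lookup_single when_def)
    then show ?thesis using False by (auto simp: axis_val_def)
  qed
  have "coeff (to_axis f) k = (\<Sum>m\<in>Poly_Mapping.keys f. if m = Poly_Mapping.single 1 k then Poly_Mapping.lookup f m else 0)"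
    unfolding to_axis_def coeff_linext val by (rule sum.cong) auto
  also have "\<dots> = Poly_Mapping.lookup f (Poly_Mapping.single 1 k)" by (simp add: in_keys_iff)
  finally show ?thesis .
qed

lemma to_axis_one [simp]: "to_axis 1 = 1"
proof -
  have "to_axis (Poly_Mapping.single 0 1) = (1 :: 'a poly)" by (simp del: single_one)
  then show ?thesis by simp
qed

definition axis_ideal :: "'k::field poly4 set" where
  "axis_ideal = {f. to_axis f = 0}"

definition origin_ideal :: "'k::field poly4 set" where
  "origin_ideal = {f. coeff (to_axis f) 0 = 0}"

lemma is_ideal_axis: "is_ideal axis_ideal"
  by (rule is_idealI) (simp_all add: axis_ideal_def)

lemma is_ideal_origin: "is_ideal origin_ideal"
  by (rule is_idealI) (simp_all add: origin_ideal_def coeff_mult_0)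

lemma axis_less_origin: "(axis_ideal :: 'k::field poly4 set) \<subset> origin_ideal"
proof -
  have "(Var 1 :: 'k poly4) \<in> origin_ideal" "(Var 1 :: 'k poly4) \<notin> axis_ideal"
    by (simp_all add: origin_ideal_def axis_ideal_def)
  moreover have "(axis_ideal :: 'k poly4 set) \<subseteq> origin_ideal" by (auto simp: origin_ideal_def axis_ideal_def)
  ultimately show ?thesis by blast
qed

lemma one_not_in_origin: "1 \<notin> origin_ideal"
  by (simp add: origin_ideal_def)

lemma diff_constant_in_origin: "f - Poly_Mapping.single 0 (coeff (to_axis f) 0) \<in> origin_ideal"
  by (simp add: origin_ideal_def)

lemma origin_maximal:
  fixes K :: "'k::field poly4 set"
  assumes K: "is_ideal K" "origin_ideal \<subset> K" shows "1 \<in> K"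
proof -
  obtain u where u: "u \<in> K" "u \<notin> origin_ideal" using K(2) by blast
  define c where "c = coeff (to_axis u) 0"
  have c: "c \<noteq> 0" using u(2) by (simp add: origin_ideal_def c_def)
  have "u - Poly_Mapping.single 0 c \<in> K" unfolding c_def using diff_constant_in_origin K(2) by blast
  then have "Poly_Mapping.single 0 c \<in> K" using is_ideal_diff_iff[OF K(1)] u(1) by blast
  then have "Poly_Mapping.single 0 (inverse c) * Poly_Mapping.single 0 c \<in> K" by (rule is_ideal_mult[OF K(1)])
  then show ?thesis using c by (simp add: mult_single)
qed

lemma diff_axis_poly_to_axis: "f - axis_poly (to_axis f) \<in> axis_ideal"
  by (simp add: axis_ideal_def)

locale curve_exponents =
  fixes n :: "4 \<Rightarrow> nat"
  assumes n_order: "0 < n 1" "n 1 < n 2" "n 2 < n 3" "n 3 < n 4"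
begin

lemma n1_less: "i \<noteq> 1 \<Longrightarrow> n 1 < n i"
  using index_cases[of i] n_order by auto

text \<open>The extra summand makes the inequality strict for a monomial that is not a power of \<open>x\<^sub>1\<close>; this is
  where the minimality of \<open>n 1\<close> enters.\<close>

lemma mono_degree_le_weight: "mono_degree m * n 1 + (Poly_Mapping.lookup m 2 + Poly_Mapping.lookup m 3 + Poly_Mapping.lookup m 4) \<le> weight n m"
proof -
  have "k * n 1 + k \<le> k * n i" if "n 1 < n i" for k i
    using mult_le_mono2[of "Suc (n 1)" "n i" k] that by simp
  note this[OF n1_less]
  from this[of 2 "Poly_Mapping.lookup m 2"] this[of 3 "Poly_Mapping.lookup m 3"] this[of 4 "Poly_Mapping.lookup m 4"]
  show ?thesis unfolding weight_4 mono_degree_4 by (simp add: algebra_simps)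
qed

lemma mono_degree_bound: "mono_degree m \<le> weight n m"
proof -
  have "mono_degree m \<le> mono_degree m * n 1" using n_order by simp
  then show ?thesis using mono_degree_le_weight[of m] by linarith
qed

lemma maxdeg_axis: "maxdeg n (Poly_Mapping.single 1 k)"
  unfolding maxdeg_def
proof (intro allI impI)
  fix v assume "weight n v = weight n (Poly_Mapping.single 1 k)"
  then have "mono_degree v * n 1 \<le> k * n 1"
    using mono_degree_le_weight[of v] unfolding weight_single by linarith
  then show "mono_degree v \<le> mono_degree (Poly_Mapping.single 1 k)"
    using n_order(1) unfolding mono_degree_single mult_le_cancel2 by blast
qed

lemma maxdeg_weight_axis:
  assumes "maxdeg n m" "weight n m = k * n 1" shows "m = Poly_Mapping.single 1 k"
proof -
  have "mono_degree m = k"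
    using maxdeg_same[OF assms(1) maxdeg_axis[of k]] assms(2) by (simp add: weight_single mono_degree_single)
  then have "Poly_Mapping.lookup m 2 + Poly_Mapping.lookup m 3 + Poly_Mapping.lookup m 4 = 0" "mono_degree m = k"
    using mono_degree_le_weight[of m] assms(2) by simp_all
  then show ?thesis
    by (intro exponent_eqI) (simp_all add: mono_degree_4 lookup_single when_def)
qed

text \<open>The monomial \<open>x\<^sub>1 ^ k\<close> is the only \<open>maxdeg\<close> monomial of weight \<open>k * n 1\<close>, so its coefficient is a
  coordinate of the image of \<open>f\<close> in the tangent cone.\<close>

lemma cone_le_axis: "tangent_cone_ideal n \<subseteq> (axis_ideal :: 'k::field poly4 set)"
proof
  fix f :: "'k poly4" assume "f \<in> tangent_cone_ideal n"
  then have f: "linext (cone_val n) f = 0" unfolding tangent_cone_ideal_eq_kernel by blast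
  have "coeff (to_axis f) k = 0" for k
  proof -
    have val: "coeff (cone_val n m) (k * n 1) = (if m = Poly_Mapping.single 1 k then 1 else (0 :: 'k))" for m
    proof (cases "m = Poly_Mapping.single 1 k")
      case True
      show ?thesis unfolding True cone_val_def by (simp add: maxdeg_axis weight_single)
    next
      case False
      then have "\<not> (maxdeg n m \<and> weight n m = k * n 1)" using maxdeg_weight_axis by blast
      then show ?thesis using False by (simp add: cone_val_def)
    qed
    have "coeff (linext (cone_val n) f) (k * n 1) =
        (\<Sum>m\<in>Poly_Mapping.keys f. if m = Poly_Mapping.single 1 k then Poly_Mapping.lookup f m else 0)"
      unfolding coeff_linext val by (rule sum.cong) auto
    also have "\<dots> = Poly_Mapping.lookup f (Poly_Mapping.single 1 k)" by (simp add: in_keys_iff)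
    finally show ?thesis unfolding coeff_to_axis f by simp
  qed
  then show "f \<in> axis_ideal" by (simp add: axis_ideal_def poly_eq_iff)
qed

text \<open>The factor \<open>x\<^sub>i ^ n 1\<close> can be replaced by \<open>x\<^sub>1 ^ n i\<close>.\<close>

lemma not_maxdeg_large:
  assumes "i \<noteq> 1" "n 1 \<le> Poly_Mapping.lookup m i" shows "\<not> maxdeg n m"
proof
  assume max: "maxdeg n m"
  have "m = Poly_Mapping.update i (Poly_Mapping.lookup m i - n 1) m + Poly_Mapping.single i (n 1)"
    using assms(2) by (intro poly_mapping_eqI) (auto simp: lookup_add lookup_update lookup_single when_def)
  then have "maxdeg n (Poly_Mapping.single i (n 1))" using max maxdeg_right by metis
  moreover have "weight n (Poly_Mapping.single 1 (n i)) = weight n (Poly_Mapping.single i (n 1))"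
    by (simp add: weight_single)
  ultimately have "mono_degree (Poly_Mapping.single 1 (n i)) \<le> mono_degree (Poly_Mapping.single i (n 1))"
    unfolding maxdeg_def by blast
  then have "n i \<le> n 1" by (simp only: mono_degree_single)
  then show False using n1_less[OF assms(1)] by simp
qed

lemma axis_nilpotent:
  fixes f :: "'k::field poly4"
  assumes "f \<in> axis_ideal" shows "\<exists>k::nat. f ^ k \<in> tangent_cone_ideal n"
proof -
  note J = is_ideal_tangent_cone[of n]
  have "\<exists>k::nat. (Poly_Mapping.single m (Poly_Mapping.lookup f m) :: 'k poly4) ^ k \<in> tangent_cone_ideal n"
    if m: "m \<in> Poly_Mapping.keys f" for m
  proof -
    have "\<exists>i. i \<noteq> 1 \<and> Poly_Mapping.lookup m i \<noteq> 0"
    proof (rule ccontr)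
      assume no: "\<nexists>i. i \<noteq> 1 \<and> Poly_Mapping.lookup m i \<noteq> 0"
      have "m = Poly_Mapping.single 1 (Poly_Mapping.lookup m 1)"
        by (rule poly_mapping_eqI) (use no in \<open>auto simp: lookup_single when_def\<close>)
      then have "coeff (to_axis f) (Poly_Mapping.lookup m 1) = Poly_Mapping.lookup f m" by (simp add: coeff_to_axis)
      then show False using assms m by (simp add: axis_ideal_def in_keys_iff)
    qed
    then obtain i where i: "i \<noteq> 1" "Poly_Mapping.lookup m i \<noteq> 0" by blast
    obtain m' where m': "(Poly_Mapping.single m (Poly_Mapping.lookup f m) :: 'k poly4) ^ n 1 =
        Poly_Mapping.single m' (Poly_Mapping.lookup f m ^ n 1)" "\<forall>i. Poly_Mapping.lookup m' i = n 1 * Poly_Mapping.lookup m i"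
      using power_single by blast
    have "\<not> maxdeg n m'" using not_maxdeg_large[OF i(1), of m'] m'(2) i(2) by simp
    then show ?thesis using single_in_cone m'(1) by metis
  qed
  note nil_single = this
  have "\<exists>k::nat. (\<Sum>m\<in>B. Poly_Mapping.single m (Poly_Mapping.lookup f m) :: 'k poly4) ^ k \<in> tangent_cone_ideal n"
    if "finite B" "B \<subseteq> Poly_Mapping.keys f" for B
    using that
  proof (induction B rule: finite_induct)
    case empty
    then show ?case using is_ideal_zero[OF J] by (intro exI[of _ 1]) simp
  next
    case (insert m B)
    then obtain i j :: nat where "(Poly_Mapping.single m (Poly_Mapping.lookup f m) :: 'k poly4) ^ i \<in> tangent_cone_ideal n"
      "(\<Sum>m\<in>B. Poly_Mapping.single m (Poly_Mapping.lookup f m) :: 'k poly4) ^ j \<in> tangent_cone_ideal n"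
      using nil_single[of m] by blast
    from is_ideal_radical_add[OF J this] show ?case using insert.hyps by auto
  qed
  from this[OF finite_keys subset_refl] show ?thesis by (simp only: sum_single_lookup)
qed

lemma type_quotient_cone: "type_quotient (tangent_cone_ideal n :: 'k::field poly4 set)"
  by unfold_locales (rule is_ideal_tangent_cone)

lemma axis_prime: "type_quotient.is_prime (tangent_cone_ideal n) (axis_ideal :: 'k::field poly4 set)"
proof -
  interpret C: type_quotient "tangent_cone_ideal n :: 'k poly4 set" by (rule type_quotient_cone)
  show ?thesis
    unfolding C.is_prime_def using is_ideal_axis cone_le_axis by (auto simp: axis_ideal_def)
qed

lemma axis_poly_to_axis_mem:
  assumes "is_ideal K" "axis_ideal \<subseteq> K" "f \<in> K" shows "axis_poly (to_axis f) \<in> K"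
  using is_ideal_diff_iff[OF assms(1) subsetD[OF assms(2) diff_axis_poly_to_axis]] assms(3) by blast

text \<open>Modulo \<open>(x\<^sub>2, x\<^sub>3, x\<^sub>4)\<close> this is the statement that nonzero primes of \<open>K[x\<^sub>1]\<close> are maximal. The polynomials \<open>c\<close>
  and \<open>d\<close> generate the restrictions of \<open>P\<close> and \<open>K\<close>; \<open>P\<close> contains one factor of \<open>c = d * e\<close>, and the
  factor \<open>d\<close> would force \<open>K\<close> into \<open>P\<close>, so it is \<open>e\<close> and \<open>d\<close> is a unit.\<close>

lemma prime_over_axis_maximal:
  fixes P :: "'k::field poly4 set"
  assumes P: "type_quotient.is_prime (tangent_cone_ideal n) P" "axis_ideal \<subset> P"
    and K: "is_ideal K" "P \<subset> K"
  shows "1 \<in> K"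
proof -
  interpret C: type_quotient "tangent_cone_ideal n :: 'k poly4 set" by (rule type_quotient_cone)
  have PI: "is_ideal P" and prime: "\<And>f g. f * g \<in> P \<Longrightarrow> f \<in> P \<or> g \<in> P"
    using P(1) unfolding C.is_prime_def by blast+
  have NP: "axis_ideal \<subseteq> P" and NK: "axis_ideal \<subseteq> K" using P(2) K(2) by blast+
  obtain f where f: "f \<in> P" "f \<notin> axis_ideal" using P(2) by blast
  obtain h where h: "h \<in> K" "h \<notin> P" using K(2) by blast
  have hP: "axis_poly (to_axis h) \<notin> P"
    using is_ideal_diff_iff[OF PI subsetD[OF NP diff_axis_poly_to_axis]] h(2) by blast
  obtain c where c: "c \<in> {p. axis_poly p \<in> P}" "\<And>a. a \<in> {p. axis_poly p \<in> P} \<Longrightarrow> c dvd a"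
    by (rule is_ideal_principal[OF is_ideal_axis_poly_vimage[OF PI]]) blast
  obtain d where d: "d \<in> {p. axis_poly p \<in> K}" "\<And>a. a \<in> {p. axis_poly p \<in> K} \<Longrightarrow> d dvd a"
    by (rule is_ideal_principal[OF is_ideal_axis_poly_vimage[OF K(1)]]) blast
  have "to_axis f \<noteq> 0" using f(2) by (simp add: axis_ideal_def)
  moreover have "c dvd to_axis f" using axis_poly_to_axis_mem[OF PI NP f(1)] by (intro c(2)) blast
  ultimately have "c \<noteq> 0" by auto
  have "d dvd c" using c(1) K(2) by (intro d(2)) blast
  then obtain e where e: "c = d * e" by (rule dvdE)
  have "axis_poly d * axis_poly e \<in> P" using c(1) by (simp add: e axis_poly_mult)
  then have "axis_poly d \<in> P \<or> axis_poly e \<in> P" by (rule prime)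
  then show ?thesis
  proof
    assume "axis_poly d \<in> P"
    have "d dvd to_axis h" using axis_poly_to_axis_mem[OF K(1) NK h(1)] by (intro d(2)) blast
    then obtain w where "to_axis h = d * w" by (rule dvdE)
    then have "axis_poly (to_axis h) \<in> P" using is_ideal_mult2[OF PI \<open>axis_poly d \<in> P\<close>] by (simp add: axis_poly_mult)
    then show ?thesis using hP by blast
  next
    assume "axis_poly e \<in> P"
    then have "c dvd e" by (intro c(2)) blast
    then obtain w where w: "e = c * w" by (rule dvdE)
    have "c = c * (d * w)" using e w by (simp add: ac_simps)
    then have "d * w = 1" using \<open>c \<noteq> 0\<close> by simp
    then have "axis_poly d * axis_poly w = 1" by (simp add: axis_poly_1 flip: axis_poly_mult)
    then show ?thesis using is_ideal_mult2[OF K(1), of "axis_poly d" "axis_poly w"] d(1) by simp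
  qed
qed

text \<open>Up to the tangent cone ideal, polynomials have exponents below \<open>n 1\<close> in \<open>x\<^sub>2\<close>, \<open>x\<^sub>3\<close> and
  \<open>x\<^sub>4\<close>, and there are only finitely many monomials of this kind without \<open>x\<^sub>1\<close>.\<close>

lemma finite_generation_over_cone:
  fixes K :: "'k::field poly4 set"
  assumes K: "is_ideal K" "tangent_cone_ideal n \<subseteq> K"
  shows "\<exists>G. finite G \<and> G \<subseteq> K \<and> K \<subseteq> Idl\<^bsub>poly4_ring\<^esub> (G \<union> tangent_cone_ideal n)"
proof -
  define E where "E = {e :: 4 \<Rightarrow>\<^sub>0 nat. Poly_Mapping.lookup e 1 = 0 \<and> (\<forall>i. i \<noteq> 1 \<longrightarrow> Poly_Mapping.lookup e i < n 1)}"
  have "E \<subseteq> (\<lambda>(b, c, d). Poly_Mapping.single 2 b + Poly_Mapping.single 3 c + Poly_Mapping.single 4 d) `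
      ({..<n 1} \<times> {..<n 1} \<times> {..<n 1})"
  proof
    fix e assume e: "e \<in> E"
    have "e = Poly_Mapping.single 2 (Poly_Mapping.lookup e 2) + Poly_Mapping.single 3 (Poly_Mapping.lookup e 3) + Poly_Mapping.single 4 (Poly_Mapping.lookup e 4)"
      using e by (intro exponent_eqI) (simp_all add: E_def lookup_add lookup_single when_def)
    moreover have "Poly_Mapping.lookup e 2 < n 1" "Poly_Mapping.lookup e 3 < n 1" "Poly_Mapping.lookup e 4 < n 1"
      using e by (simp_all add: E_def)
    ultimately show "e \<in> (\<lambda>(b, c, d). Poly_Mapping.single 2 b + Poly_Mapping.single 3 c + Poly_Mapping.single 4 d) `
      ({..<n 1} \<times> {..<n 1} \<times> {..<n 1})"
      by (intro image_eqI[of _ _ "(Poly_Mapping.lookup e 2, Poly_Mapping.lookup e 3, Poly_Mapping.lookup e 4)"]) simp_all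
  qed
  then have "finite E" by (rule finite_subset) simp
  then obtain G where G: "finite G" "G \<subseteq> K" "K \<inter> strip_span E \<subseteq> Idl\<^bsub>poly4_ring\<^esub> G"
    using strip_span_noetherian[OF _ K(1)] by blast
  let ?I = "Idl\<^bsub>poly4_ring\<^esub> (G \<union> tangent_cone_ideal n)"
  have I: "is_ideal ?I" by (rule is_ideal_Idl)
  have JI: "tangent_cone_ideal n \<subseteq> ?I" and "G \<subseteq> ?I" using Idl_contains[of "G \<union> tangent_cone_ideal n"] by blast+
  then have GI: "Idl\<^bsub>poly4_ring\<^esub> G \<subseteq> ?I" by (intro Idl_least[OF I])
  have "f \<in> ?I" if f: "f \<in> K" for f
  proof -
    define B where "B = {m \<in> Poly_Mapping.keys f. strip m \<in> E}"
    define g where "g = (\<Sum>m\<in>B. Poly_Mapping.single m (Poly_Mapping.lookup f m))"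
    have "f - g = (\<Sum>m\<in>Poly_Mapping.keys f - B. Poly_Mapping.single m (Poly_Mapping.lookup f m))"
      unfolding g_def by (subst (1) sum_single_lookup[symmetric]) (subst sum_diff, auto simp: B_def)
    also have "\<dots> \<in> tangent_cone_ideal n"
    proof (rule is_ideal_sum[OF is_ideal_tangent_cone])
      fix m assume "m \<in> Poly_Mapping.keys f - B"
      then have "strip m \<notin> E" by (simp add: B_def)
      then obtain i where "i \<noteq> 1" "n 1 \<le> Poly_Mapping.lookup m i"
        by (auto simp: E_def strip_def lookup_update not_less)
      then show "Poly_Mapping.single m (Poly_Mapping.lookup f m) \<in> tangent_cone_ideal n"
        using single_in_cone not_maxdeg_large by blast
    qed
    finally have d: "f - g \<in> tangent_cone_ideal n" .
    then have "g \<in> K" using is_ideal_diff_iff[OF K(1)] K(2) f by blast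
    moreover have "g \<in> strip_span E"
      unfolding strip_span_def g_def using keys_sum[of "\<lambda>m. Poly_Mapping.single m (Poly_Mapping.lookup f m)" B]
      by (auto simp: B_def in_keys_iff lookup_sum lookup_single when_def elim!: sum.not_neutral_contains_not_neutral split: if_splits)
    ultimately have "g \<in> ?I" using G(3) GI by blast
    then show ?thesis using is_ideal_diff_iff[OF I subsetD[OF JI d]] by blast
  qed
  then show ?thesis using G(1,2) by blast
qed

text \<open>Under the hypothesis, multiplication by \<open>x\<^sub>1\<close> becomes multiplication by \<open>t ^ n 1\<close> in \<open>K[t]\<close>, and multiplication by \<open>p(x\<^sub>1)\<close>
  becomes multiplication by the nonzero polynomial \<open>p(t ^ n 1)\<close>. So these elements are nonzerodivisors.\<close>

lemma cohen_macaulay_if_x1_preserves_maxdeg: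
  assumes ord: "\<And>m. maxdeg n m \<Longrightarrow> maxdeg n (Poly_Mapping.single 1 1 + m)"
  shows "cohen_macaulay_tangent_cone TYPE('k::field) n"
  unfolding cohen_macaulay_tangent_cone_def
proof -
  let ?J = "tangent_cone_ideal n :: 'k poly4 set"
  interpret C: type_quotient ?J by (rule type_quotient_cone)
  show "cohen_macaulay (poly4_ring Quot ?J)"
  proof (rule C.quotient_cohen_macaulayI[OF finite_generation_over_cone axis_prime axis_nilpotent
        is_ideal_origin axis_less_origin one_not_in_origin prime_over_axis_maximal])
    fix P :: "'k poly4 set" assume P: "C.is_prime P" "axis_ideal \<subset> P"
    have PI: "is_ideal P" using P(1) unfolding C.is_prime_def by blast
    obtain f where f: "f \<in> P" "f \<notin> axis_ideal" using P(2) by blast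
    let ?p = "to_axis f"
    have p: "?p \<noteq> 0" using f(2) by (simp add: axis_ideal_def)
    show "\<exists>f\<in>P. f \<notin> axis_ideal \<and> (\<forall>g. f * g \<in> ?J \<longrightarrow> g \<in> ?J)"
    proof (intro bexI conjI allI impI)
      show "axis_poly ?p \<in> P" by (rule axis_poly_to_axis_mem[OF PI _ f(1)]) (use P(2) in blast)
      show "axis_poly ?p \<notin> axis_ideal" using p by (simp add: axis_ideal_def)
      fix g assume g: "axis_poly ?p * g \<in> ?J"
      have "cone_val n (Poly_Mapping.single 1 1 + m) = monom (1::'k) (n 1) * cone_val n m" for m
        using ord[of m] maxdeg_right[of n "Poly_Mapping.single 1 1" m]
        by (auto simp: cone_val_def weight_add weight_single mult_monom)
      from linext_axis_poly_mult[of "cone_val n", OF this, of ?p g]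
      have "pcompose ?p (monom 1 (n 1)) * linext (cone_val n) g = 0"
        using g unfolding tangent_cone_ideal_eq_kernel by simp
      moreover have "pcompose ?p (monom 1 (n 1)) \<noteq> 0"
        using pcompose_eq_0[of ?p "monom 1 (n 1)"] p n_order by (auto simp: degree_monom_eq)
      ultimately show "g \<in> ?J" unfolding tangent_cone_ideal_eq_kernel by simp
    qed
  qed
qed

text \<open>Multiply \<open>m\<close> by \<open>x\<^sub>2\<close>, \<open>x\<^sub>3\<close> and \<open>x\<^sub>4\<close> as long as it stays \<open>maxdeg\<close>. This ends, since
  the exponents remain below \<open>n 1\<close>, and multiplication by \<open>x\<^sub>1\<close> still destroys \<open>maxdeg\<close> by
  \<open>maxdeg_right\<close>.\<close>

lemma socle_monomial:
  assumes "maxdeg n m" "\<not> maxdeg n (Poly_Mapping.single 1 1 + m)"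
  obtains v where "maxdeg n v" "\<And>i. \<not> maxdeg n (Poly_Mapping.single i 1 + v)"
proof -
  \<comment> \<open>The exponent of \<open>x\<^sub>1\<close> is kept fixed, as only the other exponents are bounded.\<close>
  define P where "P v \<longleftrightarrow> maxdeg n v \<and> Poly_Mapping.lookup v 1 = Poly_Mapping.lookup m 1 \<and> \<not> maxdeg n (Poly_Mapping.single 1 1 + v)" for v
  have Pm: "P m" using assms by (simp add: P_def)
  have bound: "mono_degree v < Poly_Mapping.lookup m 1 + 3 * n 1" if "P v" for v
  proof -
    have "Poly_Mapping.lookup v i < n 1" if "i \<noteq> 1" for i
    proof -
      have "\<not> n 1 \<le> Poly_Mapping.lookup v i"
        using not_maxdeg_large[OF that, of v] \<open>P v\<close> unfolding P_def by blast
      then show ?thesis by (simp only: not_le)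
    qed
    note this[of 2] this[of 3] this[of 4]
    then show ?thesis using that unfolding P_def mono_degree_4 by simp
  qed
  then have "\<forall>v. P v \<longrightarrow> mono_degree v < Poly_Mapping.lookup m 1 + 3 * n 1" by blast
  then obtain v where v: "P v" and max: "\<forall>w. P w \<longrightarrow> mono_degree w \<le> mono_degree v"
    using ex_has_greatest_nat[of P m mono_degree, OF Pm] by blast
  have "\<not> maxdeg n (Poly_Mapping.single i 1 + v)" for i
  proof (cases "i = 1")
    case True then show ?thesis using v by (simp add: P_def)
  next
    case False
    show ?thesis
    proof
      assume a: "maxdeg n (Poly_Mapping.single i 1 + v)"
      have "\<not> maxdeg n (Poly_Mapping.single 1 1 + (Poly_Mapping.single i 1 + v))"
      proof
        assume "maxdeg n (Poly_Mapping.single 1 1 + (Poly_Mapping.single i 1 + v))"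
        then have "maxdeg n (Poly_Mapping.single i 1 + (Poly_Mapping.single 1 1 + v))" by (simp only: add.left_commute)
        then show False using maxdeg_right v unfolding P_def by blast
      qed
      then have "P (Poly_Mapping.single i 1 + v)"
        using a v False unfolding P_def by (simp add: lookup_add lookup_single when_def)
      then have "mono_degree (Poly_Mapping.single i 1 + v) \<le> mono_degree v" using max by blast
      then show False by (simp add: mono_degree_add mono_degree_single)
    qed
  qed
  then show ?thesis using that v unfolding P_def by blast
qed

lemma x1_preserves_maxdeg_if_cohen_macaulay:
  assumes CM: "cohen_macaulay_tangent_cone TYPE('k::field) n" and m: "maxdeg n m"
  shows "maxdeg n (Poly_Mapping.single 1 1 + m)"
proof (rule ccontr)
  let ?J = "tangent_cone_ideal n :: 'k poly4 set"
  interpret C: type_quotient ?J by (rule type_quotient_cone)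
  note J = is_ideal_tangent_cone[of n, where 'a = 'k]
  assume "\<not> maxdeg n (Poly_Mapping.single 1 1 + m)"
  with m obtain v where v: "maxdeg n v" "\<And>i. \<not> maxdeg n (Poly_Mapping.single i 1 + v)" by (rule socle_monomial) blast
  have kill: "Poly_Mapping.single w c * mon v \<in> ?J" if w: "w \<noteq> 0" for w c
  proof -
    obtain i where i: "Poly_Mapping.lookup w i \<noteq> 0"
      using w poly_mapping_eqI[of w 0] unfolding lookup_zero by blast
    have "w + v = Poly_Mapping.update i (Poly_Mapping.lookup w i - 1) w + (Poly_Mapping.single i 1 + v)"
      using i by (intro poly_mapping_eqI) (auto simp: lookup_add lookup_update lookup_single when_def)
    then have "\<not> maxdeg n (w + v)" using v(2)[of i] maxdeg_right by metis
    then show ?thesis by (simp add: mult_single single_in_cone)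
  qed
  have mem: "f * mon v \<in> ?J" if f: "f \<in> origin_ideal" for f
  proof -
    have "Poly_Mapping.lookup f 0 = 0" using f unfolding origin_ideal_def coeff_to_axis by simp
    then have "(\<Sum>w\<in>Poly_Mapping.keys f. Poly_Mapping.single w (Poly_Mapping.lookup f w) * mon v) \<in> ?J"
      by (intro is_ideal_sum[OF J] kill) (auto simp: in_keys_iff)
    then show ?thesis by (simp only: sum_distrib_right[symmetric] sum_single_lookup)
  qed
  have "mon v \<notin> ?J" using v(1) by (simp add: tangent_cone_ideal_eq_kernel cone_val_def)
  have "u * mon v \<notin> ?J" if u: "u \<notin> origin_ideal" for u
  proof
    define c where "c = coeff (to_axis u) 0"
    assume "u * mon v \<in> ?J"
    moreover have "(u - Poly_Mapping.single 0 c) * mon v \<in> ?J" unfolding c_def by (intro mem diff_constant_in_origin)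
    then have "u * mon v - Poly_Mapping.single 0 c * mon v \<in> ?J" by (simp only: left_diff_distrib)
    ultimately have "Poly_Mapping.single 0 c * mon v \<in> ?J" using is_ideal_diff_iff[OF J] by blast
    then have "Poly_Mapping.single 0 (inverse c) * (Poly_Mapping.single 0 c * mon v) \<in> ?J" by (rule is_ideal_mult[OF J])
    moreover have "c \<noteq> 0" using u by (simp add: origin_ideal_def c_def)
    ultimately show False using \<open>mon v \<notin> ?J\<close> by (simp add: mult_single)
  qed
  then have "\<not> cohen_macaulay (poly4_ring Quot ?J)"
    using mem origin_maximal
    by (intro C.quotient_not_cohen_macaulayI[OF axis_prime axis_less_origin is_ideal_origin one_not_in_origin]) blast+
  then show False using CM unfolding cohen_macaulay_tangent_cone_def by blast
qed

end

definition monomial4 :: "nat \<Rightarrow> nat \<Rightarrow> nat \<Rightarrow> nat \<Rightarrow> (4 \<Rightarrow>\<^sub>0 nat)" where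
  "monomial4 b c d e = Poly_Mapping.single 1 b + Poly_Mapping.single 2 c + Poly_Mapping.single 3 d + Poly_Mapping.single 4 e"

lemma lookup_monomial4 [simp]:
  "Poly_Mapping.lookup (monomial4 b c d e) 1 = b" "Poly_Mapping.lookup (monomial4 b c d e) 2 = c"
  "Poly_Mapping.lookup (monomial4 b c d e) 3 = d" "Poly_Mapping.lookup (monomial4 b c d e) 4 = e"
  by (simp_all add: monomial4_def lookup_add lookup_single when_def)

lemma weight_monomial4: "weight n (monomial4 b c d e) = b * n 1 + c * n 2 + d * n 3 + e * n 4"
  unfolding weight_4 lookup_monomial4 ..

lemma mono_degree_monomial4: "mono_degree (monomial4 b c d e) = b + c + d + e"
  unfolding mono_degree_4 lookup_monomial4 ..

text \<open>Summing the coefficients over the monomials in \<open>T\<close> is a linear form. If \<open>T\<close> is closed under the moves, this form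
  vanishes on all multiples of the generators, hence on the binomial of two monomials of equal weight, and \<open>T\<close> contains both
  or none of them.\<close>

lemma closed_set_contains_fibre:
  fixes G :: "'k::field poly4 set"
  assumes gen: "Idl\<^bsub>poly4_ring\<^esub> G = curve_ideal n"
    and closed: "\<And>g. g \<in> G \<Longrightarrow> \<exists>A B. g = mon A - mon B \<and> (\<forall>m. m + A \<in> T \<longleftrightarrow> m + B \<in> T)"
    and u: "u \<in> T" "weight n u = weight n v"
  shows "v \<in> T"
proof -
  define \<phi> where "\<phi> m = (if m \<in> T then 1 else (0 :: 'k poly))" for m
  define Z where "Z = {f :: 'k poly4. \<forall>h. linext \<phi> (h * f) = 0}"
  have "is_ideal Z"
    by (rule is_idealI) (simp_all add: Z_def linext_add distrib_left mult.assoc[symmetric])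
  moreover have "G \<subseteq> Z"
  proof
    fix g assume "g \<in> G"
    then obtain A B where g: "g = mon A - mon B" "\<forall>m. m + A \<in> T \<longleftrightarrow> m + B \<in> T" using closed by blast
    have "linext \<phi> (h * g) = 0" for h
    proof (induction h rule: poly_mapping_induct_add)
      case (single m c)
      have "\<phi> (m + A) = \<phi> (m + B)" using g(2) by (simp add: \<phi>_def)
      then show ?case by (simp add: g(1) right_diff_distrib mult_single linext_diff)
    qed (simp add: distrib_right linext_add)
    then show "g \<in> Z" by (simp add: Z_def)
  qed
  ultimately have "Idl\<^bsub>poly4_ring\<^esub> G \<subseteq> Z" by (rule Idl_least)
  moreover have "mon u - mon v \<in> (curve_ideal n :: 'k poly4 set)" using u(2) by (rule binomial_in_curve_ideal)
  ultimately have "linext \<phi> (1 * (mon u - mon v)) = 0" unfolding gen Z_def by blast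
  then show ?thesis using u(1) by (simp add: linext_diff \<phi>_def split: if_splits)
qed

lemma weight_eq_if_binomial_in_curve_ideal:
  assumes "(mon u - mon v :: 'k::field poly4) \<in> curve_ideal n" shows "weight n u = weight n v"
proof -
  have "monom (1 :: 'k) (weight n u) = monom 1 (weight n v)"
    using assms by (simp add: curve_ideal_iff linext_diff)
  then show ?thesis by (simp add: monom_eq_iff')
qed

context curve_exponents
begin

lemma exists_maxdeg: "\<exists>v. maxdeg n v \<and> weight n v = weight n m"
proof -
  have "\<forall>v. weight n v = weight n m \<longrightarrow> mono_degree v < Suc (weight n m)"
    using mono_degree_bound by (metis less_Suc_eq_le)
  then obtain v where "weight n v = weight n m" "\<forall>w. weight n w = weight n m \<longrightarrow> mono_degree w \<le> mono_degree v"
    using ex_has_greatest_nat[of "\<lambda>v. weight n v = weight n m" m mono_degree] by blast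
  then show ?thesis unfolding maxdeg_def by (intro exI[of _ v]) simp
qed

text \<open>The condition on the right speaks only about weights and degrees of monomials: in every fibre that contains a
  multiple of \<open>x\<^sub>1\<close>, multiples of \<open>x\<^sub>1\<close> attain the largest degree.\<close>

lemma x1_preserves_maxdeg_iff:
  "(\<forall>m. maxdeg n m \<longrightarrow> maxdeg n (Poly_Mapping.single 1 1 + m)) \<longleftrightarrow>
   (\<forall>u v. 0 < Poly_Mapping.lookup u 1 \<and> weight n v = weight n u \<longrightarrow>
     (\<exists>w. 0 < Poly_Mapping.lookup w 1 \<and> weight n w = weight n u \<and> mono_degree v \<le> mono_degree w))"
  (is "?L \<longleftrightarrow> ?R")
proof
  assume L: ?L
  show ?R
  proof (intro allI impI, elim conjE)
    fix u v :: "4 \<Rightarrow>\<^sub>0 nat" assume u: "0 < Poly_Mapping.lookup u 1" "weight n v = weight n u"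
    define u' where "u' = Poly_Mapping.update 1 (Poly_Mapping.lookup u 1 - 1) u"
    have u': "u = Poly_Mapping.single 1 1 + u'"
      using u(1) by (intro poly_mapping_eqI) (auto simp: u'_def lookup_add lookup_update lookup_single when_def)
    obtain w where w: "maxdeg n w" "weight n w = weight n u'" using exists_maxdeg by blast
    let ?w = "Poly_Mapping.single 1 1 + w"
    have "maxdeg n ?w" using L w(1) by blast
    moreover have W: "weight n ?w = weight n u" unfolding u' by (simp add: weight_add w(2))
    ultimately have "mono_degree v \<le> mono_degree ?w" using u(2) unfolding maxdeg_def by simp
    moreover have "0 < Poly_Mapping.lookup ?w 1" by (simp add: lookup_add)
    ultimately show "\<exists>w. 0 < Poly_Mapping.lookup w 1 \<and> weight n w = weight n u \<and> mono_degree v \<le> mono_degree w"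
      using W by blast
  qed
next
  assume R: ?R
  show ?L
  proof (intro allI impI)
    fix m assume m: "maxdeg n m"
    show "maxdeg n (Poly_Mapping.single 1 1 + m)"
      unfolding maxdeg_def
    proof (intro allI impI)
      fix v assume v: "weight n v = weight n (Poly_Mapping.single 1 1 + m)"
      have "0 < Poly_Mapping.lookup (Poly_Mapping.single 1 1 + m) 1" by (simp add: lookup_add)
      then obtain w where w: "0 < Poly_Mapping.lookup w 1" "weight n w = weight n (Poly_Mapping.single 1 1 + m)"
        "mono_degree v \<le> mono_degree w" using R v by blast
      define w' where "w' = Poly_Mapping.update 1 (Poly_Mapping.lookup w 1 - 1) w"
      have w': "w = Poly_Mapping.single 1 1 + w'"
        using w(1) by (intro poly_mapping_eqI) (auto simp: w'_def lookup_add lookup_update lookup_single when_def)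
      have "weight n w' = weight n m" using w(2) unfolding w' by (simp add: weight_add)
      then have "mono_degree w' \<le> mono_degree m" using m unfolding maxdeg_def by blast
      then show "mono_degree v \<le> mono_degree (Poly_Mapping.single 1 1 + m)"
        using w(3) unfolding w' by (simp add: mono_degree_add)
    qed
  qed
qed

theorem cohen_macaulay_tangent_cone_iff:
  "cohen_macaulay_tangent_cone TYPE('k::field) n \<longleftrightarrow>
   (\<forall>u v. 0 < Poly_Mapping.lookup u 1 \<and> weight n v = weight n u \<longrightarrow>
     (\<exists>w. 0 < Poly_Mapping.lookup w 1 \<and> weight n w = weight n u \<and> mono_degree v \<le> mono_degree w))"
  unfolding x1_preserves_maxdeg_iff[symmetric]
proof
  assume "cohen_macaulay_tangent_cone TYPE('k) n"
  then show "\<forall>m. maxdeg n m \<longrightarrow> maxdeg n (Poly_Mapping.single 1 1 + m)"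
    using x1_preserves_maxdeg_if_cohen_macaulay by blast
next
  assume "\<forall>m. maxdeg n m \<longrightarrow> maxdeg n (Poly_Mapping.single 1 1 + m)"
  then show "cohen_macaulay_tangent_cone TYPE('k) n"
    by (intro cohen_macaulay_if_x1_preserves_maxdeg) blast
qed

end

section \<open>Monomials of equal weight in case 3(b)\<close>

text \<open>The exponents of case 3(b). The equations \<open>weight1\<close> to \<open>weight5\<close> state that the five binomials vanish on the curve, and
  \<open>connected\<close> that they generate its ideal: a set of exponent vectors that is closed under the five moves contains all vectors
  of the same weight as one of its members.\<close>

locale curve_3b =
  fixes n1 n2 n3 n4 a1 a2 a3 a4 a12 a14 a23 a24 a31 a32 a41 a43 :: nat
  assumes order: "0 < n1" "n1 < n2" "n2 < n3" "n3 < n4"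
    and pos: "0 < a12" "0 < a14" "0 < a23" "0 < a24" "0 < a31" "0 < a32" "0 < a41" "0 < a43"
    and sums: "a1 = a31 + a41" "a2 = a12 + a32" "a3 = a23 + a43" "a4 = a14 + a24"
    and a43_le: "a43 \<le> a23"
    and weight1: "a1 * n1 = a12 * n2 + a14 * n4"
    and weight2: "a2 * n2 = a23 * n3 + a24 * n4"
    and weight3: "a3 * n3 = a31 * n1 + a32 * n2"
    and weight4: "a4 * n4 = a41 * n1 + a43 * n3"
    and weight5: "a31 * n1 + a24 * n4 = a12 * n2 + a43 * n3"
    and connected: "\<And>t b c d e b' c' d' e'.
      \<lbrakk>\<And>b c d e. t (b + a1) c d e = t b (c + a12) d (e + a14);
       \<And>b c d e. t b (c + a2) d e = t b c (d + a23) (e + a24);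
       \<And>b c d e. t b c (d + a3) e = t (b + a31) (c + a32) d e;
       \<And>b c d e. t b c d (e + a4) = t (b + a41) c (d + a43) e;
       \<And>b c d e. t (b + a31) c d (e + a24) = t b (c + a12) (d + a43) e;
       t b c d e; b * n1 + c * n2 + d * n3 + e * n4 = b' * n1 + c' * n2 + d' * n3 + e' * n4\<rbrakk>
      \<Longrightarrow> t b' c' d' (e'::nat)"
begin

abbreviation wgt where "wgt b c d e \<equiv> b * n1 + c * n2 + d * n3 + e * n4"

text \<open>The condition of \<open>cohen_macaulay_tangent_cone_iff\<close> in coordinates.\<close>

definition filled_by_x1 :: bool where
  "filled_by_x1 \<longleftrightarrow> (\<forall>b c d e b' c' d' e'. 0 < b \<and> wgt b' c' d' e' = wgt b c d e \<longrightarrow>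
     (\<exists>p q r s. 0 < p \<and> wgt p q r s = wgt b c d e \<and> b' + c' + d' + e' \<le> p + q + r + s))"

lemma filled_by_x1D:
  assumes filled_by_x1 "0 < b" "wgt b' c' d' e' = wgt b c d e"
  obtains p q r s where "0 < p" "wgt p q r s = wgt b c d e" "b' + c' + d' + e' \<le> p + q + r + s"
proof -
  have "\<exists>p q r s. 0 < p \<and> wgt p q r s = wgt b c d e \<and> b' + c' + d' + e' \<le> p + q + r + s"
    using assms(1)[unfolded filled_by_x1_def, rule_format, OF conjI, OF assms(2,3)] .
  then show ?thesis using that by blast
qed

text \<open>Of two monomials of equal weight, the one in lighter variables has the larger degree. In \<open>f1\<close> the variable
  \<open>x\<^sub>1\<close> is lighter than \<open>x\<^sub>2\<close> and \<open>x\<^sub>4\<close>; the next three lemmas treat \<open>f2\<close>, \<open>f3\<close> and \<open>f4\<close> in the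
  same way.\<close>

lemma degree1: "a12 + a14 < a1"
proof -
  have "a12 * n1 < a12 * n2" "a14 * n1 < a14 * n4" using order pos by simp_all
  then have "(a12 + a14) * n1 < a1 * n1" unfolding weight1 add_mult_distrib by (rule add_strict_mono)
  then show ?thesis by simp
qed

lemma degree2: "a23 + a24 < a2"
proof -
  have "a23 * n2 < a23 * n3" "a24 * n2 < a24 * n4" using order pos by simp_all
  then have "(a23 + a24) * n2 < a2 * n2" unfolding weight2 add_mult_distrib by (rule add_strict_mono)
  then show ?thesis by simp
qed

lemma degree3: "a3 < a31 + a32"
proof -
  have "a31 * n1 < a31 * n3" "a32 * n2 < a32 * n3" using order pos by simp_all
  then have "a3 * n3 < (a31 + a32) * n3" unfolding weight3 add_mult_distrib by (rule add_strict_mono)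
  then show ?thesis by simp
qed

lemma degree4: "a4 < a41 + a43"
proof -
  have "a41 * n1 < a41 * n4" "a43 * n3 < a43 * n4" using order pos by simp_all
  then have "a4 * n4 < (a41 + a43) * n4" unfolding weight4 add_mult_distrib by (rule add_strict_mono)
  then show ?thesis by simp
qed

lemma degree_le_wgt: "b + c + d + e \<le> wgt b c d e"
proof -
  have "b \<le> b * n1" "c \<le> c * n2" "d \<le> d * n3" "e \<le> e * n4" using order by simp_all
  then show ?thesis by linarith
qed

text \<open>Take a vector \<open>(x, y, z, w)\<close> of largest degree for the given weight and suppose that multiples of
  \<open>x\<^sub>1\<close> have smaller degree. Every move that creates a factor \<open>x\<^sub>1\<close> without lowering the degree is
  then impossible, and so is the \<open>f2\<close> move that raises the degree. Only the opposite \<open>f2\<close> move may be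
  possible, after which no move but its inverse is. So at most two vectors have this weight, both without
  \<open>x\<^sub>1\<close>, although a multiple of \<open>x\<^sub>1\<close> was assumed to have it.\<close>

lemma filled_by_x1I:
  assumes c1: "a12 + a43 \<le> a31 + a24"
    and c2: "a24 < a14 \<Longrightarrow> a2 + a12 + a43 \<le> a31 + 2 * a24 + a23"
    and c3: "a14 \<le> a24 \<Longrightarrow> a2 + a12 + a14 \<le> a1 + a23 + a24"
  shows filled_by_x1
  unfolding filled_by_x1_def
proof (intro allI impI, elim conjE)
  fix b c d e b0 c0 d0 e0
  assume b: "0 < b" and W0: "wgt b0 c0 d0 e0 = wgt b c d e"
  define P where "P k \<longleftrightarrow> (\<exists>b' c' d' e'. wgt b' c' d' e' = wgt b c d e \<and> k = b' + c' + d' + e')" for k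
  have P0: "P (b0 + c0 + d0 + e0)" unfolding P_def using W0 by blast
  have Pb: "k \<le> wgt b c d e" if "P k" for k
    using that degree_le_wgt unfolding P_def by metis
  define k where "k = Greatest P"
  have "P k" unfolding k_def by (rule GreatestI_nat[of P, OF P0]) (rule Pb)
  have k_max: "j \<le> k" if "P j" for j unfolding k_def by (rule Greatest_le_nat[of P, OF that]) (rule Pb)
  obtain x y z w where v: "wgt x y z w = wgt b c d e" "k = x + y + z + w" using \<open>P k\<close> unfolding P_def by blast
  have max: "p + q + r + s \<le> x + y + z + w" if "wgt p q r s = wgt b c d e" for p q r s
    using k_max[of "p + q + r + s"] that unfolding P_def v(2)[symmetric] by blast
  show "\<exists>p q r s. 0 < p \<and> wgt p q r s = wgt b c d e \<and> b0 + c0 + d0 + e0 \<le> p + q + r + s"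
  proof (rule ccontr)
    assume "\<not> ?thesis"
    then have no: "\<not> x + y + z + w \<le> p + q + r + s" if "0 < p" "wgt p q r s = wgt b c d e" for p q r s
      using that max[OF W0] by (meson order_trans)
    have x: "x = 0" using no[of x y z w] v(1) by auto
    have m1: "y < a12 \<or> w < a14"
    proof (rule ccontr)
      assume "\<not> ?thesis"
      then obtain y' w' where e: "y = a12 + y'" "w = a14 + w'" by (metis le_Suc_ex not_less)
      show False using no[of a1 y' z w'] v(1) weight1 degree1 pos sums x unfolding e by (simp add: algebra_simps)
    qed
    have m2: "z < a23 \<or> w < a24"
    proof (rule ccontr)
      assume "\<not> ?thesis"
      then obtain z' w' where e: "z = a23 + z'" "w = a24 + w'" by (metis le_Suc_ex not_less)
      show False using max[of 0 "y + a2" z' w'] v(1) weight2 degree2 x unfolding e by (simp add: algebra_simps)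
    qed
    have m3: "z < a3"
    proof (rule ccontr)
      assume "\<not> ?thesis"
      then obtain z' where e: "z = a3 + z'" by (metis le_Suc_ex not_less)
      show False using no[of a31 "y + a32" z' w] v(1) weight3 degree3 pos x unfolding e by (simp add: algebra_simps)
    qed
    have m4: "w < a4"
    proof (rule ccontr)
      assume "\<not> ?thesis"
      then obtain w' where e: "w = a4 + w'" by (metis le_Suc_ex not_less)
      show False using no[of a41 y "z + a43" w'] v(1) weight4 degree4 pos x unfolding e by (simp add: algebra_simps)
    qed
    have m5: "y < a12 \<or> z < a43"
    proof (rule ccontr)
      assume "\<not> ?thesis"
      then obtain y' z' where e: "y = a12 + y'" "z = a43 + z'" by (metis le_Suc_ex not_less)
      show False using no[of a31 y' z' "w + a24"] v(1) weight5 c1 pos x unfolding e by (simp add: algebra_simps)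
    qed
    \<comment> \<open>The composite of the \<open>f2\<close> move with the \<open>f5\<close> move, or with the \<open>f1\<close> move if \<open>a14 \<le> a24\<close>.\<close>
    have m6: "y < a2 + a12"
    proof (rule ccontr)
      assume "\<not> ?thesis"
      then obtain y' where y': "y = a2 + a12 + y'" by (metis le_Suc_ex not_less)
      show False
      proof (cases "a24 < a14")
        case True
        obtain u where u: "a23 = a43 + u" using a43_le by (metis le_Suc_ex)
        show False
          using no[of a31 y' "z + u" "w + 2 * a24"] v(1) weight2 weight5 c2[OF True] pos x
          unfolding y' by (simp add: algebra_simps u)
      next
        case False
        then obtain u where u: "a24 = a14 + u" by (metis le_Suc_ex not_less)
        show False
          using no[of a1 y' "z + a23" "w + u"] v(1) weight2 weight1 c3 False pos sums(1) x
          unfolding y' by (simp add: algebra_simps u)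
      qed
    qed
    \<comment> \<open>The vector itself and its image under the \<open>f2\<close> move: closed under all moves, by \<open>m1\<close> to \<open>m6\<close>.\<close>
    define t where "t p q r s \<longleftrightarrow> p = 0 \<and> ((q = y \<and> r = z \<and> s = w) \<or> (q + a2 = y \<and> r = z + a23 \<and> s = w + a24))"
      for p q r s :: nat
    have "t b c d e"
    proof (rule connected[where t = t])
      show "t x y z w" unfolding t_def using x by simp
      show "wgt x y z w = wgt b c d e" by (rule v(1))
    qed (use m1 m2 m3 m4 m5 m6 pos sums in \<open>auto simp: t_def\<close>)
    then show False using b unfolding t_def by simp
  qed
qed

text \<open>Only the two monomials of \<open>f5\<close> have their weight.\<close>

lemma filled_by_x1_cond1:
  assumes filled_by_x1
  shows "a12 + a43 \<le> a31 + a24"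
proof -
  have "wgt 0 a12 a43 0 = wgt a31 0 0 a24" using weight5 by simp
  then obtain p q r s where p: "0 < p" "wgt p q r s = wgt a31 0 0 a24" "0 + a12 + a43 + 0 \<le> p + q + r + s"
    by (rule filled_by_x1D[OF assms pos(5)])
  define t where "t p q r s \<longleftrightarrow> (p = a31 \<and> q = 0 \<and> r = 0 \<and> s = a24) \<or> (p = 0 \<and> q = a12 \<and> r = a43 \<and> s = 0)"
    for p q r s :: nat
  have "t p q r s"
  proof (rule connected[where t = t])
    show "t a31 0 0 a24" unfolding t_def by simp
    show "wgt a31 0 0 a24 = wgt p q r s" using p(2) by simp
  qed (use pos sums in \<open>auto simp: t_def\<close>)
  then show ?thesis using p unfolding t_def by auto
qed

text \<open>The monomials with the weight of \<open>x\<^sub>2 ^ (a2 + a12)\<close> are this one, its image under \<open>f2\<close>, and a chain of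
  monomials without \<open>x\<^sub>2\<close> that are connected by the move \<open>f4\<close>. The chain is indexed by \<open>j\<close>, where
  \<open>j = 0\<close> is reached by \<open>f1\<close> (if \<open>a14 \<le> a24\<close>) and \<open>j = 1\<close> by \<open>f5\<close>. The degree decreases with \<open>j\<close>,
  so its maximum is attained at the smallest possible \<open>j\<close>, which is one if \<open>a24 < a14\<close> and zero otherwise.\<close>

lemma filled_by_x1_cond2:
  assumes filled_by_x1
  shows "if a24 < a14 then a2 + a12 + a43 \<le> a31 + 2 * a24 + a23 else a2 + a12 + a14 \<le> a1 + a23 + a24"
proof -
  obtain u where u: "a23 = a43 + u" using a43_le by (metis le_Suc_ex)
  have "wgt 0 (a2 + a12) 0 0 = wgt a31 0 u (2 * a24)"
    using weight2 weight5 by (simp add: algebra_simps u)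
  then obtain p q r s where p: "0 < p" "wgt p q r s = wgt a31 0 u (2 * a24)" "0 + (a2 + a12) + 0 + 0 \<le> p + q + r + s"
    by (rule filled_by_x1D[OF assms pos(5)])
  define t where "t p q r s \<longleftrightarrow> (p = 0 \<and> q = a2 + a12 \<and> r = 0 \<and> s = 0) \<or> (p = 0 \<and> q = a12 \<and> r = a23 \<and> s = a24) \<or>
      (q = 0 \<and> (\<exists>j. p + j * a41 = a1 \<and> r + j * a43 = a23 \<and> s + a14 = a24 + j * a4))"
    for p q r s :: nat
  \<comment> \<open>Only the members with \<open>j \<le> 1\<close> admit a move other than \<open>f4\<close>.\<close>
  have at_most_one: "j \<le> 1" if "b + a31 + j * a41 = a1" for b j
  proof -
    have "j * a41 \<le> 1 * a41" using that sums(1) by linarith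
    then show ?thesis using pos(7) mult_le_cancel2[of j a41 1] by blast
  qed
  have "t p q r s"
  proof (rule connected[where t = t])
    show "t a31 0 u (2 * a24)" unfolding t_def using u sums by (auto intro!: exI[of _ 1])
    show "wgt a31 0 u (2 * a24) = wgt p q r s" using p(2) by simp
  next
    fix b c d e
    show "t (b + a1) c d e = t b (c + a12) d (e + a14)"
    proof
      assume "t (b + a1) c d e"
      then obtain j where j: "c = 0" "b + a1 + j * a41 = a1 \<and> d + j * a43 = a23 \<and> e + a14 = a24 + j * a4"
        using sums pos unfolding t_def by auto
      then show "t b (c + a12) d (e + a14)" using j pos unfolding t_def by auto
    next
      assume "t b (c + a12) d (e + a14)"
      then have "b = 0 \<and> c = 0 \<and> d = a23 \<and> e + a14 = a24"
        using sums pos unfolding t_def by auto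
      then show "t (b + a1) c d e" unfolding t_def by (auto intro!: exI[of _ 0])
    qed
    show "t b (c + a2) d e = t b c (d + a23) (e + a24)"
    proof
      assume "t b (c + a2) d e"
      then show "t b c (d + a23) (e + a24)" using sums pos unfolding t_def by auto
    next
      assume t: "t b c (d + a23) (e + a24)"
      have "False" if "b + j * a41 = a1 \<and> d + a23 + j * a43 = a23 \<and> e + a24 + a14 = a24 + j * a4" for j
        using that pos by auto
      with t show "t b (c + a2) d e" using sums pos unfolding t_def by auto
    qed
    show "t b c (d + a3) e = t (b + a31) (c + a32) d e"
    proof -
      have "False" if "b + j * a41 = a1 \<and> d + a3 + j * a43 = a23 \<and> e + a14 = a24 + j * a4" for j
        using that sums pos by auto
      then show ?thesis using sums pos unfolding t_def by auto
    qed
    show "t b c d (e + a4) = t (b + a41) c (d + a43) e"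
    proof
      assume "t b c d (e + a4)"
      then obtain j where j: "c = 0" "b + j * a41 = a1 \<and> d + j * a43 = a23 \<and> e + a4 + a14 = a24 + j * a4"
        using sums pos unfolding t_def by auto
      have "j \<noteq> 0" using j(2) sums pos by (intro notI) simp
      then obtain i where "j = Suc i" by (cases j) auto
      then show "t (b + a41) c (d + a43) e"
        using j unfolding t_def by (auto intro!: exI[of _ i] simp: algebra_simps)
    next
      assume "t (b + a41) c (d + a43) e"
      then obtain j where j: "c = 0" "b + a41 + j * a41 = a1 \<and> d + a43 + j * a43 = a23 \<and> e + a14 = a24 + j * a4"
        using sums pos unfolding t_def by auto
      then show "t b c d (e + a4)"
        unfolding t_def by (auto intro!: exI[of _ "Suc j"] simp: algebra_simps)
    qed
    show "t (b + a31) c d (e + a24) = t b (c + a12) (d + a43) e"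
    proof
      assume "t (b + a31) c d (e + a24)"
      then obtain j where j: "c = 0" "b + a31 + j * a41 = a1 \<and> d + j * a43 = a23 \<and> e + a24 + a14 = a24 + j * a4"
        using sums pos unfolding t_def by auto
      have "j \<noteq> 0"
        using j(2) sums pos by (intro notI) auto
      moreover have "j \<le> 1" by (rule at_most_one) (use j(2) in blast)
      ultimately have "j = 1" by simp
      then show "t b (c + a12) (d + a43) e" using j sums unfolding t_def by auto
    next
      assume "t b (c + a12) (d + a43) e"
      then show "t (b + a31) c d (e + a24)" using sums pos unfolding t_def by (auto intro!: exI[of _ 1])
    qed
  qed
  then obtain j where j: "q = 0" "p + j * a41 = a1 \<and> r + j * a43 = a23 \<and> s + a14 = a24 + j * a4"
    using p(1) unfolding t_def by auto
  have deg: "a2 + a12 + a14 + j * (a41 + a43) \<le> a1 + a23 + a24 + j * a4"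
    using p(3) j by (simp add: algebra_simps)
  show ?thesis
  proof (cases "a24 < a14")
    case True
    then obtain i where i: "j = Suc i" using j(2) by (cases j) auto
    have "i * a4 \<le> i * (a41 + a43)" by (rule mult_le_mono2[OF less_imp_le[OF degree4]])
    then have "a2 + a12 + a14 + (a41 + a43) \<le> a1 + a23 + a24 + a4"
      using deg unfolding i mult_Suc by linarith
    then show ?thesis using True sums by simp
  next
    case False
    have "j * a4 \<le> j * (a41 + a43)" by (rule mult_le_mono2[OF less_imp_le[OF degree4]])
    then have "a2 + a12 + a14 \<le> a1 + a23 + a24" using deg by linarith
    then show ?thesis using False by simp
  qed
qed

end

section \<open>The criterion\<close>

theorem theorem3p33:
  fixes n :: "4 \<Rightarrow> nat"
    and a1 a2 a3 a4 a12 a14 a23 a24 a31 a32 a41 a43 :: nat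
    and f1 f2 f3 f4 f5 :: "'k::field poly4"
  assumes "0 < n 1" and "n 1 < n 2" and "n 2 < n 3" and "n 3 < n 4"
    and "Gcd (range n) = 1"
    and "\<not> complete_intersection_curve TYPE('k) n"
    and "gorenstein_curve n"
    and "0 < a12" "a12 < a2" and "0 < a14" "a14 < a4" and "0 < a23" "a23 < a3"
    and "0 < a24" "a24 < a4" and "0 < a31" "a31 < a1" and "0 < a32" "a32 < a2"
    and "0 < a41" "a41 < a1" and "0 < a43" "a43 < a3"
    and "a1 = a31 + a41" and "a2 = a12 + a32" and "a3 = a23 + a43" and "a4 = a14 + a24"
    and "f1 = Var 1 ^ a1 - Var 2 ^ a12 * Var 4 ^ a14"
    and "f2 = Var 2 ^ a2 - Var 3 ^ a23 * Var 4 ^ a24"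
    and "f3 = Var 3 ^ a3 - Var 1 ^ a31 * Var 2 ^ a32"
    and "f4 = Var 4 ^ a4 - Var 1 ^ a41 * Var 3 ^ a43"
    and "f5 = Var 1 ^ a31 * Var 4 ^ a24 - Var 2 ^ a12 * Var 3 ^ a43"
    and "minimally_generates poly4_ring {f1, f2, f3, f4, f5} (curve_ideal n)"
    and "a43 \<le> a23"
  shows "cohen_macaulay_tangent_cone TYPE('k) n \<longleftrightarrow>
    a12 + a43 \<le> a31 + a24 \<and>
    ((a24 < a14 \<and> int a2 + int a12 \<le> int a31 + 2 * int a24 + int a23 - int a43) \<or>
     (a14 \<le> a24 \<and> int a2 + int a12 \<le> int a1 + int a23 + int a24 - int a14))"
proof -
  interpret curve_exponents n by unfold_locales (fact assms)+
  have Var4: "(Var 1 ^ b * Var 2 ^ c * Var 3 ^ d * Var 4 ^ e :: 'k poly4) = mon (monomial4 b c d e)" for b c d e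
    unfolding Var_power mult_mon monomial4_def ..
  have f1: "f1 = mon (monomial4 a1 0 0 0) - mon (monomial4 0 a12 0 a14)"
    and f2: "f2 = mon (monomial4 0 a2 0 0) - mon (monomial4 0 0 a23 a24)"
    and f3: "f3 = mon (monomial4 0 0 a3 0) - mon (monomial4 a31 a32 0 0)"
    and f4: "f4 = mon (monomial4 0 0 0 a4) - mon (monomial4 a41 0 a43 0)"
    and f5: "f5 = mon (monomial4 a31 0 0 a24) - mon (monomial4 0 a12 a43 0)"
    unfolding Var4[symmetric] assms(28-32) by simp_all
  have gen: "Idl\<^bsub>poly4_ring\<^esub> {f1, f2, f3, f4, f5} = curve_ideal n"
    using assms(33) unfolding minimally_generates_def by blast
  then have "{f1, f2, f3, f4, f5} \<subseteq> curve_ideal n" using Idl_contains[of "{f1, f2, f3, f4, f5}"] by blast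
  then have in_ideal: "f1 \<in> curve_ideal n" "f2 \<in> curve_ideal n" "f3 \<in> curve_ideal n" "f4 \<in> curve_ideal n"
    "f5 \<in> curve_ideal n" by blast+
  note weights = in_ideal[unfolded f1 f2 f3 f4 f5, THEN weight_eq_if_binomial_in_curve_ideal, unfolded weight_monomial4]
  interpret C: curve_3b "n 1" "n 2" "n 3" "n 4" a1 a2 a3 a4 a12 a14 a23 a24 a31 a32 a41 a43
  proof
    fix t :: "nat \<Rightarrow> nat \<Rightarrow> nat \<Rightarrow> nat \<Rightarrow> bool" and b c d e b' c' d' e'
    assume closed: "\<And>b c d e. t (b + a1) c d e = t b (c + a12) d (e + a14)"
       "\<And>b c d e. t b (c + a2) d e = t b c (d + a23) (e + a24)"
       "\<And>b c d e. t b c (d + a3) e = t (b + a31) (c + a32) d e"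
       "\<And>b c d e. t b c d (e + a4) = t (b + a41) c (d + a43) e"
       "\<And>b c d e. t (b + a31) c d (e + a24) = t b (c + a12) (d + a43) e"
    assume t: "t b c d e" "b * n 1 + c * n 2 + d * n 3 + e * n 4 = b' * n 1 + c' * n 2 + d' * n 3 + e' * n 4"
    define T where "T = {m :: 4 \<Rightarrow>\<^sub>0 nat. t (Poly_Mapping.lookup m 1) (Poly_Mapping.lookup m 2) (Poly_Mapping.lookup m 3) (Poly_Mapping.lookup m 4)}"
    have mem: "m + monomial4 p q r s \<in> T \<longleftrightarrow> t (Poly_Mapping.lookup m 1 + p) (Poly_Mapping.lookup m 2 + q)
        (Poly_Mapping.lookup m 3 + r) (Poly_Mapping.lookup m 4 + s)" for m p q r s
      unfolding T_def by (simp add: lookup_add)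
    have "monomial4 b' c' d' e' \<in> T"
    proof (rule closed_set_contains_fibre[OF gen])
      show "monomial4 b c d e \<in> T" using t(1) unfolding T_def by simp
      show "weight n (monomial4 b c d e) = weight n (monomial4 b' c' d' e')" unfolding weight_monomial4 by (rule t(2))
      fix g assume "g \<in> {f1, f2, f3, f4, f5}"
      then consider "g = f1" | "g = f2" | "g = f3" | "g = f4" | "g = f5" by blast
      then show "\<exists>A B. g = mon A - mon B \<and> (\<forall>m. m + A \<in> T \<longleftrightarrow> m + B \<in> T)"
      proof cases
        case 1 show ?thesis
          unfolding 1 f1 by (intro exI conjI allI, rule refl) (unfold mem add_0_right, rule closed(1))
      next
        case 2 show ?thesis
          unfolding 2 f2 by (intro exI conjI allI, rule refl) (unfold mem add_0_right, rule closed(2))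
      next
        case 3 show ?thesis
          unfolding 3 f3 by (intro exI conjI allI, rule refl) (unfold mem add_0_right, rule closed(3))
      next
        case 4 show ?thesis
          unfolding 4 f4 by (intro exI conjI allI, rule refl) (unfold mem add_0_right, rule closed(4))
      next
        case 5 show ?thesis
          unfolding 5 f5 by (intro exI conjI allI, rule refl) (unfold mem add_0_right, rule closed(5))
      qed
    qed
    then show "t b' c' d' e'" unfolding T_def by simp
  qed (use assms(1-4,8-27,34) weights in simp_all)
  have "cohen_macaulay_tangent_cone TYPE('k) n \<longleftrightarrow> C.filled_by_x1"
    unfolding cohen_macaulay_tangent_cone_iff
  proof
    assume R: "\<forall>u v. 0 < Poly_Mapping.lookup u 1 \<and> weight n v = weight n u \<longrightarrow>
     (\<exists>w. 0 < Poly_Mapping.lookup w 1 \<and> weight n w = weight n u \<and> mono_degree v \<le> mono_degree w)"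
    show C.filled_by_x1
      unfolding C.filled_by_x1_def
    proof (intro allI impI, elim conjE)
      fix b c d e b' c' d' e' :: nat
      assume b: "0 < b" "C.wgt b' c' d' e' = C.wgt b c d e"
      have "0 < Poly_Mapping.lookup (monomial4 b c d e) 1 \<and> weight n (monomial4 b' c' d' e') = weight n (monomial4 b c d e)"
        using b unfolding weight_monomial4 lookup_monomial4 by (rule conjI)
      then obtain w where w: "0 < Poly_Mapping.lookup w 1" "weight n w = weight n (monomial4 b c d e)"
        "mono_degree (monomial4 b' c' d' e') \<le> mono_degree w" using R by blast
      show "\<exists>p q r s. 0 < p \<and> C.wgt p q r s = C.wgt b c d e \<and> b' + c' + d' + e' \<le> p + q + r + s"
        using w unfolding weight_monomial4 mono_degree_monomial4 unfolding weight_4 mono_degree_4 by blast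
    qed
  next
    assume F: C.filled_by_x1
    show "\<forall>u v. 0 < Poly_Mapping.lookup u 1 \<and> weight n v = weight n u \<longrightarrow>
     (\<exists>w. 0 < Poly_Mapping.lookup w 1 \<and> weight n w = weight n u \<and> mono_degree v \<le> mono_degree w)"
    proof (intro allI impI, elim conjE)
      fix u v assume u: "0 < Poly_Mapping.lookup u 1" "weight n v = weight n u"
      obtain p q r s where p: "0 < p" "C.wgt p q r s = weight n u" "mono_degree v \<le> p + q + r + s"
        using C.filled_by_x1D[OF F u(1) u(2)[unfolded weight_4]] unfolding weight_4[symmetric] mono_degree_4[symmetric] .
      show "\<exists>w. 0 < Poly_Mapping.lookup w 1 \<and> weight n w = weight n u \<and> mono_degree v \<le> mono_degree w"
        using p by (intro exI[of _ "monomial4 p q r s"]) (simp add: weight_monomial4 mono_degree_monomial4)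
    qed
  qed
  also have "\<dots> \<longleftrightarrow> a12 + a43 \<le> a31 + a24 \<and>
      (if a24 < a14 then a2 + a12 + a43 \<le> a31 + 2 * a24 + a23 else a2 + a12 + a14 \<le> a1 + a23 + a24)"
    using C.filled_by_x1I C.filled_by_x1_cond1 C.filled_by_x1_cond2 by (auto simp: not_less)
  also have "\<dots> \<longleftrightarrow> a12 + a43 \<le> a31 + a24 \<and>
    ((a24 < a14 \<and> int a2 + int a12 \<le> int a31 + 2 * int a24 + int a23 - int a43) \<or>
     (a14 \<le> a24 \<and> int a2 + int a12 \<le> int a1 + int a23 + int a24 - int a14))"
    by auto
  finally show ?thesis .
qed

end
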